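(* Let $T>0$, $0<\alpha<\frac12$, $g\in W_T^{1-\alpha,\infty}(0,T)$, and let $f:[0,T]^2\to\mathbb R^d$ be such that $f(t,\cdot)\in W_0^{\alpha,1}(0,T)$ for all $t\in[0,T]$ and $|f(t_1,s)-f(t_2,s)|\le K(s)|t_1-t_2|^\mu$ for all $s,t_1,t_2\in[0,T]$, with $\mu>\alpha$ and $K:[0,T]\to[0,\infty)$ measurable. Put $G_t(f)=\int_0^t f(t,s)\,dg_s$. Then for all $0\le s<t\le T$ $$|G_t(f)-G_s(f)|\le\Lambda_\alpha(g)\Big(|t-s|^\mu\int_0^s\frac{K(u)}{u^\alpha}du+\int_s^t\frac{|f(t,u)|}{(u-s)^\alpha}du+\alpha\int_0^s\int_0^u\frac{|f(t,u)-f(s,u)-f(t,y)+f(s,y)|}{(u-y)^{\alpha+1}}dy\,du+\alpha\int_s^t\int_s^u\frac{|f(t,u)-f(t,y)|}{(u-y)^{\alpha+1}}dy\,du\Big),$$ and there exist a constant $C^{(3)}_\alpha$ depending only on $\alpha$ and $\mu$, and a constant $C^{(4)}_{\alpha,T}$ depending only on $\alpha$ and $T$, such that for all $t\in[0,T]$ $$|G_t(f)|+\int_0^t\frac{|G_t(f)-G_s(f)|}{(t-s)^{\alpha+1}}ds\le\Lambda_\alpha(g)\Big(C^{(3)}_\alpha\int_0^t\frac{K(u)}{u^\alpha}(t-u)^{\mu-\alpha}du+C^{(4)}_{\alpha,T}\int_0^t\big((t-u)^{-2\alpha}+u^{-\alpha}\big)\Big(|f(t,u)|+\int_0^u\fr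ac{|f(t,u)-f(t,y)|}{(u-y)^{\alpha+1}}dy\Big)du+\alpha\int_0^t\int_0^s\int_0^u\frac{|f(t,u)-f(s,u)-f(t,y)+f(s,y)|}{(u-y)^{\alpha+1}(t-s)^{\alpha+1}}dy\,du\,ds\Big).$$
   Context: $W_T^{1-\alpha,\infty}(0,T)$ is the space of measurable $g:[0,T]\to\mathbb R$ with $\sup_{0<s<t<T}\Big(\frac{|g(t)-g(s)|}{(t-s)^{1-\alpha}}+\int_s^t\frac{|g(y)-g(s)|}{(y-s)^{2-\alpha}}dy\Big)<\infty$. $W_0^{\alpha,1}(0,T)$ is the space of measurable functions $f$ on $[0,T]$ with $\|f\|_{\alpha,1}:=\int_0^T\frac{|f(s)|}{s^\alpha}ds+\int_0^T\int_0^s\frac{|f(s)-f(y)|}{(s-y)^{\alpha+1}}dy\,ds<\infty$. Fractional (Weyl) derivatives, written without the unimodular sign factors: $$(D^\alpha_{0+}f)(x)=\frac1{\Gamma(1-\alpha)}\Big(\frac{f(x)}{x^\alpha}+\alpha\int_0^x\frac{f(x)-f(y)}{(x-y)^{\alpha+1}}dy\Big),$$ $$(\widetilde D^{1-\alpha}_{t-}g_{t-})(x)=\frac1{\Gamma(\alpha)}\Big(\frac{g(x)-g(t-)}{(t-x)^{1-\alpha}}+(1-\alpha)\int_x^t\frac{g(x)-g(y)}{(y-x)^{2-\alpha}}dy\Big),\quad 0<x<t.$$ For $g\in W_T^{1-\alpha,\infty}(0,T)$ put $\Lambda_\alpha(g):=\frac1{\Gamma(1-\alpha)}\sup_{0<s<t<T}|(\widetilde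 D^{1-\alpha}_{t-}g_{t-})(s)|<\infty$. For $f\in W_0^{\alpha,1}(0,T)$ (componentwise if $\mathbb R^d$-valued) and $g\in W_T^{1-\alpha,\infty}(0,T)$ the (Zähle) generalized Stieltjes integral is $\int_0^t f\,dg:=-\int_0^t(D^\alpha_{0+}f)(x)\,(\widetilde D^{1-\alpha}_{t-}g_{t-})(x)\,dx$, which equals $\int_0^T f\,\mathbf 1_{(0,t)}\,dg$. Right-hand sides of the inequalities may be $+\infty$. *)

theory Defs
  imports "HOL-Analysis.Analysis"
begin

text \<open>
  Functions on an interval are total functions of which only the values on that interval matter.
  ``Measurable'' means Lebesgue measurable. Quantities that may be infinite are
  \<^typ>\<open>ennreal\<close>-valued. The integrals run over open intervals, so that the singular endpoints of
  the kernels are never evaluated.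
\<close>

definition W_T_inf :: "real \<Rightarrow> real \<Rightarrow> (real \<Rightarrow> real) set" where
  "W_T_inf \<alpha> T = {g. g \<in> borel_measurable (lebesgue_on {0..T}) \<and>
     (SUP s\<in>{0<..<T}. SUP t\<in>{s<..<T}.
        ennreal (\<bar>g t - g s\<bar> / (t - s) powr (1 - \<alpha>)) +
        (\<integral>\<^sup>+ y\<in>{s<..<t}. ennreal (\<bar>g y - g s\<bar> / (y - s) powr (2 - \<alpha>)) \<partial>lebesgue)) < \<infinity>}"

definition W_0_one :: "real \<Rightarrow> real \<Rightarrow> (real \<Rightarrow> real) set" where
  "W_0_one \<alpha> T = {f. f \<in> borel_measurable (lebesgue_on {0..T}) \<and>
     (\<integral>\<^sup>+ s\<in>{0<..<T}. ennreal (\<bar>f s\<bar> / s powr \<alpha>) \<partial>lebesgue) +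
     (\<integral>\<^sup>+ s\<in>{0<..<T}. (\<integral>\<^sup>+ y\<in>{0<..<s}.
        ennreal (\<bar>f s - f y\<bar> / (s - y) powr (\<alpha> + 1)) \<partial>lebesgue) \<partial>lebesgue) < \<infinity>}"

definition left_weyl :: "real \<Rightarrow> (real \<Rightarrow> real) \<Rightarrow> real \<Rightarrow> real" where
  "left_weyl \<alpha> f x = 1 / Gamma (1 - \<alpha>) *
     (f x / x powr \<alpha> + \<alpha> * (LINT y:{0<..<x}|lebesgue. (f x - f y) / (x - y) powr (\<alpha> + 1)))"

text \<open>\<open>right_weyl \<alpha> t g\<close> is the derivative of order \<open>1 - \<alpha>\<close> (not \<open>\<alpha>\<close>) of \<open>g - g(t-)\<close>, without the
  sign factor.\<close>

definition right_weyl :: "real \<Rightarrow> real \<Rightarrow> (real \<Rightarrow> real) \<Rightarrow> real \<Rightarrow> real" where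
  "right_weyl \<alpha> t g x = 1 / Gamma \<alpha> *
     ((g x - Lim (at_left t) g) / (t - x) powr (1 - \<alpha>) +
      (1 - \<alpha>) * (LINT y:{x<..<t}|lebesgue. (g x - g y) / (y - x) powr (2 - \<alpha>)))"

definition Lambda :: "real \<Rightarrow> real \<Rightarrow> (real \<Rightarrow> real) \<Rightarrow> ennreal" where
  "Lambda \<alpha> T g = ennreal (1 / Gamma (1 - \<alpha>)) *
     (SUP s\<in>{0<..<T}. SUP t\<in>{s<..<T}. ennreal \<bar>right_weyl \<alpha> t g s\<bar>)"

definition stieltjes :: "real \<Rightarrow> real \<Rightarrow> (real \<Rightarrow> real) \<Rightarrow> (real \<Rightarrow> real) \<Rightarrow> real" where
  "stieltjes \<alpha> t f g = - (LINT x:{0<..<t}|lebesgue. left_weyl \<alpha> f x * right_weyl \<alpha> t g x)"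

text \<open>
  A vector in \<open>\<real>\<^sup>d\<close> is a function \<^typ>\<open>nat \<Rightarrow> real\<close> of which only the components \<open>i < d\<close> matter.
  The dimension is a number rather than an index type, so that constants can be chosen
  independently of it.
\<close>

definition vnorm :: "nat \<Rightarrow> (nat \<Rightarrow> real) \<Rightarrow> real" where
  "vnorm d v = L2_set v {..<d}"

definition G :: "real \<Rightarrow> (real \<Rightarrow> real) \<Rightarrow> (real \<Rightarrow> real \<Rightarrow> nat \<Rightarrow> real) \<Rightarrow> real \<Rightarrow> nat \<Rightarrow> real" where
  "G \<alpha> g f t = (\<lambda>i. stieltjes \<alpha> t (\<lambda>s. f t s i) g)"

end

theory Submission
  imports Defs
begin

text \<open>
  The whole estimate rests on the additivity of the integral in its domain of integration,
    \<open>\<integral>_0^t \<phi> dg = \<integral>_0^s \<phi> dg + \<integral>_s^t \<phi> dg\<close> for \<open>0 < s < t\<close>,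
  where the last integral uses the left Weyl derivative based at \<open>s\<close>. Once it is known,
  \<open>G_t(f) - G_s(f)\<close> is the integral of \<open>f(t,.) - f(s,.)\<close> over \<open>(0,s)\<close> plus the integral of
  \<open>f(t,.)\<close> over \<open>(s,t)\<close>. In both integrals the Weyl derivative of \<open>g\<close> is at most
  \<open>\<Gamma>(1-\<alpha>) \<Lambda>_\<alpha>(g)\<close>, the factor \<open>\<Gamma>(1-\<alpha>)\<close> cancels the normalisation of the left derivative,
  and the triangle inequality under the integral sign gives the first claim. The second claim is
  the first one, at \<open>s = 0\<close> and integrated against \<open>(t-s)^(-\<alpha>-1) ds\<close>, after exchanging the order
  of integration and estimating the resulting integrals over \<open>s\<close>.

  Additivity is not visible from the definition, because the right Weyl derivative of \<open>g\<close> changes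
  with the end point of integration and the left one of \<open>\<phi>\<close> with the base point. Write \<open>D_a\<close> for
  \<open>frac_left\<close> and \<open>\<rho>_t\<close> for the right derivative \<open>frac_right\<close> of \<open>g\<close>, with the Gamma factors
  dropped. On \<open>(0,s)\<close> the difference \<open>\<rho>_s - \<rho>_t\<close> is an integral over \<open>z\<close> in \<open>(s,t)\<close> of
  increments of \<open>g\<close> against the powers \<open>(z-x)^(\<alpha>-2)\<close>, plus a boundary term at \<open>t\<close>; on \<open>(s,t)\<close> the difference
  \<open>D_s \<phi> - D_0 \<phi>\<close> is an integral over \<open>y\<close> in \<open>(0,s)\<close> of \<open>\<phi>(y)\<close> against the powers
  \<open>(x-y)^(-\<alpha>-1)\<close>. Fractional integration by parts (\<open>fractional_integration_by_parts\<close>) moves the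
  derivative of \<open>\<phi>\<close>, respectively of \<open>g\<close>, onto these powers, where it can be computed in closed
  form (\<open>exchange_kernel_eq\<close>). Both sides turn into the same double integral of \<open>\<phi>(y)\<close> and
  \<open>g(z) - g(s)\<close> against one explicit kernel on \<open>y < s < z\<close>, with opposite signs
  (\<open>kernel_exchange_left\<close>, \<open>kernel_exchange_right\<close>), and this is \<open>stieltjes_additive\<close>.

  Integration by parts itself comes from one identity on the triangle \<open>a < y < x < b\<close>
  (\<open>truncated_identity\<close>): for the kernel \<open>(x-y)^(-\<beta>-1)\<close> cut off at distance \<open>\<epsilon>\<close> from the
  diagonal, the two halves of the double integral of \<open>\<psi>(x) - \<psi>(y)\<close> can be integrated separately.
  The same identity for \<open>|\<psi>|\<close> yields a Hardy inequality (\<open>fractional_hardy\<close>) at the end point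
  \<open>b\<close>, where the norm of \<open>W_0^(\<alpha>,1)\<close> imposes no weight; this makes all boundary terms meaningful.

  The Euclidean norm is handled by pairing with a unit vector (\<open>vnorm_dual\<close>), which reduces every
  estimate to real integrands. In the second claim the term with the second order increments of \<open>f\<close>
  is treated as a lower integral in \<open>s\<close>, because \<open>f\<close> is measurable in its second argument for each
  fixed first one. The lower integral is additive when one of two summands is measurable
  (\<open>nn_integral_add_le_any\<close>), and in each sum here at most this one term is not known to be.
\<close>

section \<open>Lebesgue measure on the plane and power kernels\<close>

lemma sigma_finite_lebesgue: "sigma_finite_measure (lebesgue :: real measure)"
proof
  show "\<exists>A::real set set. countable A \<and> A \<subseteq> sets lebesgue \<and> \<Union> A = space lebesgue \<and>
          (\<forall>a\<in>A. emeasure lebesgue a \<noteq> \<infinity>)"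
  proof (intro exI[of _ "range (\<lambda>n::nat. {- real n..real n})"] conjI ballI)
    show "\<Union> (range (\<lambda>n::nat. {- real n..real n})) = space lebesgue"
    proof -
      have "\<exists>n::nat. - real n \<le> x \<and> x \<le> real n" for x :: real
        by (metis abs_le_iff minus_le_iff real_arch_simple)
      then show ?thesis by auto
    qed
  qed auto
qed

interpretation leb: pair_sigma_finite "lebesgue :: real measure" "lebesgue :: real measure"
  by (intro pair_sigma_finite.intro sigma_finite_lebesgue)

lemma measurable_id_lebesgue [measurable]: "(\<lambda>x. x) \<in> borel_measurable (lebesgue :: real measure)"
  by (simp add: measurable_completion)

lemma measurable_fst_lebesgue [measurable]:
  "(\<lambda>p. fst p) \<in> borel_measurable ((lebesgue :: real measure) \<Otimes>\<^sub>M (lebesgue :: real measure))"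
  by (rule measurable_compose[OF measurable_fst measurable_id_lebesgue])

lemma measurable_snd_lebesgue [measurable]:
  "(\<lambda>p. snd p) \<in> borel_measurable ((lebesgue :: real measure) \<Otimes>\<^sub>M (lebesgue :: real measure))"
  by (rule measurable_compose[OF measurable_snd measurable_id_lebesgue])

text \<open>
  The completion of this product is Lebesgue measure on the plane. The measurable
  functions of the product include \<open>f \<circ> fst\<close> and \<open>f \<circ> snd\<close> for every Lebesgue measurable \<open>f\<close>.
\<close>

abbreviation (input) "LL \<equiv> (lebesgue :: real measure) \<Otimes>\<^sub>M (lebesgue :: real measure)"

lemma integrable_tensor:
  fixes f g :: "real \<Rightarrow> real"
  assumes "integrable lebesgue f" "integrable lebesgue g"
  shows "integrable LL (\<lambda>(x, y). f x * g y)"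
proof (rule leb.Fubini_integrable)
  have [measurable]: "f \<in> borel_measurable lebesgue" "g \<in> borel_measurable lebesgue"
    using assms by auto
  show "(\<lambda>(x, y). f x * g y) \<in> borel_measurable LL" by measurable
  show "integrable lebesgue (\<lambda>x. LINT y|lebesgue. norm (case (x, y) of (x, y) \<Rightarrow> f x * g y))"
    using assms by (simp add: abs_mult)
  show "AE x in lebesgue. integrable lebesgue (\<lambda>y. case (x, y) of (x, y) \<Rightarrow> f x * g y)"
    using assms by simp
qed

text \<open>
  A derivative of constant sign is automatically absolutely integrable, so the singular power
  functions below need only a continuous antiderivative up to the end points.
\<close>

lemma ftc_nonneg:
  fixes F f :: "real \<Rightarrow> real"
  assumes "a \<le> b" "continuous_on {a..b} F"
    and "\<And>x. a < x \<Longrightarrow> x < b \<Longrightarrow> (F has_real_derivative f x) (at x)"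
    and "\<And>x. a < x \<Longrightarrow> x < b \<Longrightarrow> 0 \<le> f x"
  shows "set_integrable lebesgue {a<..<b} f" "(LINT x:{a<..<b}|lebesgue. f x) = F b - F a"
proof -
  have "(f has_integral F b - F a) {a..b}"
    using assms by (intro fundamental_theorem_of_calculus_interior)
      (auto simp: has_real_derivative_iff_has_vector_derivative)
  then have *: "(f has_integral F b - F a) {a<..<b}"
    by (simp add: has_integral_Icc_iff_Ioo)
  then show "set_integrable lebesgue {a<..<b} f"
    using assms(4) by (intro nonnegative_absolutely_integrable_1) (auto simp: has_integral_integrable)
  then show "(LINT x:{a<..<b}|lebesgue. f x) = F b - F a"
    using * set_lebesgue_integral_eq_integral(2) by (metis integral_unique)
qed

lemma integral_power_kernel_left:
  fixes \<beta> p q x :: real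
  assumes "0 < \<beta>" "p \<le> q" "q < x"
  shows "set_integrable lebesgue {p<..<q} (\<lambda>y. 1 / (x - y) powr (\<beta> + 1))"
    "(LINT y:{p<..<q}|lebesgue. 1 / (x - y) powr (\<beta> + 1)) = ((x - q) powr -\<beta> - (x - p) powr -\<beta>) / \<beta>"
proof -
  have c: "continuous_on {p..q} (\<lambda>y. (x - y) powr -\<beta> / \<beta>)"
    using assms by (intro continuous_intros) auto
  have d: "((\<lambda>y. (x - y) powr -\<beta> / \<beta>) has_real_derivative 1 / (x - y) powr (\<beta> + 1)) (at y)" if "y < q" for y
    using assms that
    by (auto intro!: derivative_eq_intros simp: powr_minus field_simps powr_diff powr_add)
  note F = ftc_nonneg[OF assms(2) c d]
  show "set_integrable lebesgue {p<..<q} (\<lambda>y. 1 / (x - y) powr (\<beta> + 1))" by (rule F) auto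
  have "(LINT y:{p<..<q}|lebesgue. 1 / (x - y) powr (\<beta> + 1)) = (x - q) powr -\<beta> / \<beta> - (x - p) powr -\<beta> / \<beta>"
    by (rule F) auto
  then show "(LINT y:{p<..<q}|lebesgue. 1 / (x - y) powr (\<beta> + 1)) = ((x - q) powr -\<beta> - (x - p) powr -\<beta>) / \<beta>"
    by (simp add: diff_divide_distrib)
qed

lemma integral_power_kernel_right:
  fixes \<beta> p q y :: real
  assumes "0 < \<beta>" "p \<le> q" "y < p"
  shows "set_integrable lebesgue {p<..<q} (\<lambda>x. 1 / (x - y) powr (\<beta> + 1))"
    "(LINT x:{p<..<q}|lebesgue. 1 / (x - y) powr (\<beta> + 1)) = ((p - y) powr -\<beta> - (q - y) powr -\<beta>) / \<beta>"
proof -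
  have c: "continuous_on {p..q} (\<lambda>x. - ((x - y) powr -\<beta> / \<beta>))"
    using assms by (intro continuous_intros) auto
  have d: "((\<lambda>x. - ((x - y) powr -\<beta> / \<beta>)) has_real_derivative 1 / (x - y) powr (\<beta> + 1)) (at x)" if "p < x" for x
    using assms that
    by (auto intro!: derivative_eq_intros simp: powr_minus field_simps powr_diff powr_add)
  note F = ftc_nonneg[OF assms(2) c d]
  show "set_integrable lebesgue {p<..<q} (\<lambda>x. 1 / (x - y) powr (\<beta> + 1))" by (rule F) auto
  have "(LINT x:{p<..<q}|lebesgue. 1 / (x - y) powr (\<beta> + 1)) = - ((q - y) powr -\<beta> / \<beta>) - - ((p - y) powr -\<beta> / \<beta>)"
    by (rule F) auto
  then show "(LINT x:{p<..<q}|lebesgue. 1 / (x - y) powr (\<beta> + 1)) = ((p - y) powr -\<beta> - (q - y) powr -\<beta>) / \<beta>"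
    by (simp add: diff_divide_distrib)
qed

section \<open>A summation identity on the ordered triangle\<close>

lemma kernel_mass_left:
  fixes \<beta> \<epsilon> a b x :: real
  assumes "0 < \<beta>" "0 < \<epsilon>" "a < x" "x < b"
  shows "\<beta> * (LINT y|lebesgue. (if a < y \<and> y + \<epsilon> < x \<and> x < b then 1 / (x - y) powr (\<beta> + 1) else 0))
      = \<epsilon> powr -\<beta> - max \<epsilon> (x - a) powr -\<beta>"
proof -
  have *: "(\<lambda>y. if a < y \<and> y + \<epsilon> < x \<and> x < b then 1 / (x - y) powr (\<beta> + 1) else 0)
    = (\<lambda>y. indicator {a<..<max a (x - \<epsilon>)} y *\<^sub>R (1 / (x - y) powr (\<beta> + 1)))"
    using assms by (auto simp: fun_eq_iff indicator_def)
  note K = integral_power_kernel_left[of \<beta> a "max a (x - \<epsilon>)" x, unfolded set_integrable_def set_lebesgue_integral_def]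
  show ?thesis
    unfolding * using assms by (subst K) (auto simp: max_def)
qed

lemma kernel_mass_right:
  fixes \<beta> \<epsilon> a b y :: real
  assumes "0 < \<beta>" "0 < \<epsilon>" "a < y" "y < b"
  shows "\<beta> * (LINT x|lebesgue. (if a < y \<and> y + \<epsilon> < x \<and> x < b then 1 / (x - y) powr (\<beta> + 1) else 0))
      = \<epsilon> powr -\<beta> - max \<epsilon> (b - y) powr -\<beta>"
proof -
  have *: "(\<lambda>x. if a < y \<and> y + \<epsilon> < x \<and> x < b then 1 / (x - y) powr (\<beta> + 1) else 0)
    = (\<lambda>x. indicator {min b (y + \<epsilon>)<..<b} x *\<^sub>R (1 / (x - y) powr (\<beta> + 1)))"
    using assms by (auto simp: fun_eq_iff indicator_def)
  note K = integral_power_kernel_right[of \<beta> "min b (y + \<epsilon>)" b y, unfolded set_integrable_def set_lebesgue_integral_def]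
  show ?thesis
    unfolding * using assms by (subst K) (auto simp: max_def min_def intro!: arg_cong2[where f = "(powr)"])
qed

lemma integrable_max_powr:
  fixes \<psi> :: "real \<Rightarrow> real"
  assumes "0 < \<beta>" "0 < \<epsilon>" "integrable lebesgue \<psi>" and [measurable]: "h \<in> borel_measurable lebesgue"
  shows "integrable lebesgue (\<lambda>x. \<psi> x * max \<epsilon> (h x) powr -\<beta>)"
proof (rule Bochner_Integration.integrable_bound)
  have [measurable]: "\<psi> \<in> borel_measurable lebesgue" using assms by auto
  show "integrable lebesgue (\<lambda>x. \<psi> x * \<epsilon> powr -\<beta>)" using assms by simp
  show "(\<lambda>x. \<psi> x * max \<epsilon> (h x) powr - \<beta>) \<in> borel_measurable lebesgue" by measurable
  have "max \<epsilon> (h x) powr -\<beta> \<le> \<epsilon> powr -\<beta>" for x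
    using assms by (intro powr_mono2') auto
  then show "AE x in lebesgue. norm (\<psi> x * max \<epsilon> (h x) powr - \<beta>) \<le> norm (\<psi> x * \<epsilon> powr - \<beta>)"
    by (auto simp: abs_mult intro!: mult_left_mono)
qed

text \<open>
  With the kernel cut off at distance \<open>\<epsilon>\<close> from the diagonal, the parts with \<open>\<psi>(x)\<close> and \<open>\<psi>(y)\<close>
  are separately integrable, and integrating out the other variable gives
  \<open>\<epsilon>^(-\<beta>) - max(\<epsilon>, x-a)^(-\<beta>)\<close> and \<open>\<epsilon>^(-\<beta>) - max(\<epsilon>, b-x)^(-\<beta>)\<close>. The divergent
  terms \<open>\<epsilon>^(-\<beta>)\<close> cancel, which is why the identity survives the limit \<open>\<epsilon> \<rightarrow> 0\<close>.
\<close>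

lemma truncated_identity:
  fixes \<psi> :: "real \<Rightarrow> real" and a b \<beta> \<epsilon> :: real
  assumes \<beta>: "0 < \<beta>" and \<epsilon>: "0 < \<epsilon>" and \<psi>: "integrable lebesgue \<psi>"
    and supp: "\<And>x. x \<notin> {a<..<b} \<Longrightarrow> \<psi> x = 0"
  defines "k \<equiv> (\<lambda>x y. if a < y \<and> y + \<epsilon> < x \<and> x < b then 1 / (x - y) powr (\<beta> + 1) else 0)"
  shows "integrable LL (\<lambda>(x, y). (\<psi> x - \<psi> y) * k x y)"
    "(LINT x|lebesgue. \<psi> x * max \<epsilon> (x - a) powr -\<beta>) + \<beta> * (\<integral>(x, y). (\<psi> x - \<psi> y) * k x y \<partial>LL)
      = (LINT x|lebesgue. \<psi> x * max \<epsilon> (b - x) powr -\<beta>)"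
proof -
  have [measurable]: "\<psi> \<in> borel_measurable lebesgue" using \<psi> by auto
  have kb: "\<bar>k x y\<bar> \<le> \<epsilon> powr (-\<beta> - 1) * indicator {a<..<b} x * indicator {a<..<b} y" for x y
  proof (cases "a < y \<and> y + \<epsilon> < x \<and> x < b")
    case True
    then have "(x - y) powr (-(\<beta> + 1)) \<le> \<epsilon> powr (-(\<beta> + 1))"
      using \<beta> \<epsilon> by (intro powr_mono2') auto
    moreover have "k x y = (x - y) powr (-(\<beta> + 1))"
      unfolding k_def powr_minus using True by (simp add: divide_inverse)
    ultimately show ?thesis using True \<epsilon> by (simp add: indicator_def)
  qed (auto simp: k_def indicator_def)
  have one: "integrable lebesgue (\<lambda>x::real. indicator {a<..<b} x * \<epsilon> powr (-\<beta> - 1))"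
    using lmeasurable_box[of a b] by (intro integrable_mult_left) (simp add: lmeasurable_iff_integrable)
  have [measurable]: "(\<lambda>(x, y). k x y) \<in> borel_measurable LL"
    unfolding k_def by measurable
  have i1: "integrable LL (\<lambda>(x, y). \<psi> x * k x y)"
  proof (rule Bochner_Integration.integrable_bound[OF integrable_tensor[OF \<psi> one]])
    show "AE p in LL. norm (case p of (x, y) \<Rightarrow> \<psi> x * k x y)
        \<le> norm (case p of (x, y) \<Rightarrow> \<psi> x * (indicator {a<..<b} y * \<epsilon> powr (-\<beta> - 1)))"
    proof (intro AE_I2, clarsimp simp: abs_mult)
      fix x y
      have "\<bar>k x y\<bar> \<le> indicator {a<..<b} y * \<epsilon> powr (-\<beta> - 1)"
        using kb[of x y] by (cases "a < x \<and> x < b") (auto simp: indicator_def)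
      then show "\<bar>\<psi> x\<bar> * \<bar>k x y\<bar> \<le> \<bar>\<psi> x\<bar> * (indicator {a<..<b} y * \<epsilon> powr (-\<beta> - 1))"
        by (intro mult_left_mono) auto
    qed
  qed measurable
  have i2: "integrable LL (\<lambda>(x, y). \<psi> y * k x y)"
  proof (rule Bochner_Integration.integrable_bound[OF integrable_tensor[OF one \<psi>]])
    show "AE p in LL. norm (case p of (x, y) \<Rightarrow> \<psi> y * k x y)
        \<le> norm (case p of (x, y) \<Rightarrow> (indicator {a<..<b} x * \<epsilon> powr (-\<beta> - 1)) * \<psi> y)"
    proof (intro AE_I2, clarsimp simp: abs_mult)
      fix x y
      have "\<bar>k x y\<bar> \<le> indicator {a<..<b} x * \<epsilon> powr (-\<beta> - 1)"
        using kb[of x y] by (cases "a < y \<and> y < b") (auto simp: indicator_def)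
      then show "\<bar>\<psi> y\<bar> * \<bar>k x y\<bar> \<le> indicator {a<..<b} x * \<epsilon> powr (-\<beta> - 1) * \<bar>\<psi> y\<bar>"
        by (subst mult.commute) (intro mult_right_mono, auto)
    qed
  qed measurable
  have eq: "(\<lambda>(x, y). (\<psi> x - \<psi> y) * k x y) = (\<lambda>p. (case p of (x, y) \<Rightarrow> \<psi> x * k x y) - (case p of (x, y) \<Rightarrow> \<psi> y * k x y))"
    by (auto simp: fun_eq_iff algebra_simps)
  show "integrable LL (\<lambda>(x, y). (\<psi> x - \<psi> y) * k x y)"
    unfolding eq by (rule Bochner_Integration.integrable_diff[OF i1 i2])
  have e1: "\<beta> * (\<integral>(x, y). \<psi> x * k x y \<partial>LL) = (LINT x|lebesgue. \<psi> x * (\<epsilon> powr -\<beta> - max \<epsilon> (x - a) powr -\<beta>))"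
  proof -
    have "\<psi> x * (\<beta> * (LINT y|lebesgue. k x y)) = \<psi> x * (\<epsilon> powr -\<beta> - max \<epsilon> (x - a) powr -\<beta>)" for x
      using supp[of x] kernel_mass_left[OF \<beta> \<epsilon>, of a x b] unfolding k_def by (cases "x \<in> {a<..<b}") auto
    then show ?thesis
      by (subst leb.integral_fst[OF i1, symmetric]) (simp flip: integral_mult_right_zero add: mult.left_commute)
  qed
  have e2: "\<beta> * (\<integral>(x, y). \<psi> y * k x y \<partial>LL) = (LINT y|lebesgue. \<psi> y * (\<epsilon> powr -\<beta> - max \<epsilon> (b - y) powr -\<beta>))"
  proof -
    have "\<psi> y * (\<beta> * (LINT x|lebesgue. k x y)) = \<psi> y * (\<epsilon> powr -\<beta> - max \<epsilon> (b - y) powr -\<beta>)" for y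
      using supp[of y] kernel_mass_right[OF \<beta> \<epsilon>, of a y b] unfolding k_def by (cases "y \<in> {a<..<b}") auto
    then show ?thesis
      by (subst leb.integral_snd[OF i2, symmetric]) (simp flip: integral_mult_right_zero add: mult.left_commute)
  qed
  have m: "integrable lebesgue (\<lambda>x. \<psi> x * max \<epsilon> (x - a) powr -\<beta>)" "integrable lebesgue (\<lambda>x. \<psi> x * max \<epsilon> (b - x) powr -\<beta>)"
    using \<beta> \<epsilon> \<psi> by (auto intro!: integrable_max_powr)
  have "\<beta> * (\<integral>(x, y). (\<psi> x - \<psi> y) * k x y \<partial>LL) = \<beta> * (\<integral>(x, y). \<psi> x * k x y \<partial>LL) - \<beta> * (\<integral>(x, y). \<psi> y * k x y \<partial>LL)"
    unfolding eq by (subst Bochner_Integration.integral_diff[OF i1 i2]) (simp add: right_diff_distrib)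
  also have "\<dots> = (LINT x|lebesgue. \<psi> x * max \<epsilon> (b - x) powr -\<beta>) - (LINT x|lebesgue. \<psi> x * max \<epsilon> (x - a) powr -\<beta>)"
    unfolding e1 e2 using m \<psi> by (simp add: right_diff_distrib)
  finally show "(LINT x|lebesgue. \<psi> x * max \<epsilon> (x - a) powr -\<beta>) + \<beta> * (\<integral>(x, y). (\<psi> x - \<psi> y) * k x y \<partial>LL)
      = (LINT x|lebesgue. \<psi> x * max \<epsilon> (b - x) powr -\<beta>)" by simp
qed

text \<open>
  The kernel of order \<open>\<beta>\<close> on the triangle \<open>a < y < x < b\<close>. Its first argument after the interval
  is the larger variable.
\<close>

definition tri :: "real \<Rightarrow> real \<Rightarrow> real \<Rightarrow> real \<Rightarrow> real \<Rightarrow> real" where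
  "tri \<beta> a b x y = (if a < y \<and> y < x \<and> x < b then 1 / (x - y) powr (\<beta> + 1) else 0)"

lemma tri_nonneg: "0 \<le> tri \<beta> a b x y"
  by (simp add: tri_def)

lemma measurable_tri [measurable (raw)]:
  assumes [measurable]: "f \<in> borel_measurable M" "g \<in> borel_measurable M"
  shows "(\<lambda>x. tri \<beta> a b (f x) (g x)) \<in> borel_measurable M"
  unfolding tri_def by measurable

lemma integrable_unweighted:
  fixes \<psi> :: "real \<Rightarrow> real"
  assumes "0 < \<beta>" and [measurable]: "\<psi> \<in> borel_measurable lebesgue"
    and supp: "\<And>x. x \<notin> {a<..<b} \<Longrightarrow> \<psi> x = 0"
    and "integrable lebesgue (\<lambda>x. \<psi> x * (x - a) powr -\<beta>)"
  shows "integrable lebesgue \<psi>"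
proof (rule Bochner_Integration.integrable_bound)
  show "integrable lebesgue (\<lambda>x. (\<psi> x * (x - a) powr -\<beta>) * (b - a) powr \<beta>)"
    using assms by simp
  have "\<bar>\<psi> x\<bar> \<le> \<bar>\<psi> x\<bar> * ((x - a) powr -\<beta> * (b - a) powr \<beta>)" for x
  proof (cases "x \<in> {a<..<b}")
    case True
    then have "(x - a) powr \<beta> \<le> (b - a) powr \<beta>"
      using assms by (intro powr_mono2) auto
    then have "1 \<le> (x - a) powr -\<beta> * (b - a) powr \<beta>"
      using True by (simp add: powr_minus field_simps)
    then show ?thesis by (metis abs_ge_zero mult.right_neutral mult_left_mono)
  qed (simp add: supp)
  then show "AE x in lebesgue. norm (\<psi> x) \<le> norm ((\<psi> x * (x - a) powr -\<beta>) * (b - a) powr \<beta>)"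
    by (auto simp: abs_mult mult_ac)
qed measurable

lemma max_inverse_Suc_powr_tendsto:
  assumes "(0::real) < d"
  shows "(\<lambda>n. max (inverse (real (Suc n))) d powr -\<beta>) \<longlonglongrightarrow> d powr -\<beta>"
proof (rule tendsto_eventually)
  have "\<forall>\<^sub>F n in sequentially. inverse (real (Suc n)) < d"
    using LIMSEQ_inverse_real_of_nat assms by (rule order_tendstoD)
  then show "\<forall>\<^sub>F n in sequentially. max (inverse (real (Suc n))) d powr - \<beta> = d powr -\<beta>"
    by eventually_elim (simp add: max_def)
qed

text \<open>
  The weight at \<open>b\<close> is bounded by the weight at \<open>a\<close> and the double increments. In the truncated
  identity for \<open>|\<psi>|\<close> the left-hand side is bounded independently of \<open>\<epsilon>\<close> because
  \<open>|\<psi>(x)| - |\<psi>(y)| \<le> |\<psi>(x) - \<psi>(y)|\<close>, and Fatou's lemma removes the truncation.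
\<close>

lemma fractional_hardy:
  fixes \<psi> :: "real \<Rightarrow> real"
  assumes \<beta>: "0 < \<beta>" and [measurable]: "\<psi> \<in> borel_measurable lebesgue"
    and supp: "\<And>x. x \<notin> {a<..<b} \<Longrightarrow> \<psi> x = 0"
    and left: "integrable lebesgue (\<lambda>x. \<psi> x * (x - a) powr -\<beta>)"
    and dbl: "integrable LL (\<lambda>(x, y). (\<psi> x - \<psi> y) * tri \<beta> a b x y)"
  shows "integrable lebesgue (\<lambda>x. \<psi> x * (b - x) powr -\<beta>)"
proof -
  \<comment> \<open>a bound for the truncated weights that does not depend on the truncation\<close>
  define C where "C = (LINT x|lebesgue. \<bar>\<psi> x\<bar> * (x - a) powr -\<beta>)
     + \<beta> * (\<integral>(x, y). \<bar>\<psi> x - \<psi> y\<bar> * tri \<beta> a b x y \<partial>LL)"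
  have left': "integrable lebesgue (\<lambda>x. \<bar>\<psi> x\<bar> * (x - a) powr -\<beta>)"
    using integrable_abs[OF left] by (simp add: abs_mult)
  have dbl': "integrable LL (\<lambda>(x, y). \<bar>\<psi> x - \<psi> y\<bar> * tri \<beta> a b x y)"
    using integrable_abs[OF dbl] by (simp add: abs_mult tri_nonneg case_prod_unfold)
  have \<psi>: "integrable lebesgue (\<lambda>x. \<bar>\<psi> x\<bar>)"
    using integrable_unweighted[OF \<beta> _ supp left] by simp
  have bd: "(LINT x|lebesgue. \<bar>\<psi> x\<bar> * max \<epsilon> (b - x) powr -\<beta>) \<le> C" if \<epsilon>: "0 < \<epsilon>" for \<epsilon>
  proof -
    note T = truncated_identity[OF \<beta> \<epsilon> \<psi>, of a b]
    have "(LINT x|lebesgue. \<bar>\<psi> x\<bar> * max \<epsilon> (x - a) powr -\<beta>) \<le> (LINT x|lebesgue. \<bar>\<psi> x\<bar> * (x - a) powr -\<beta>)"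
    proof (intro integral_mono left' integrable_max_powr[OF \<beta> \<epsilon> \<psi>])
      show "\<bar>\<psi> x\<bar> * max \<epsilon> (x - a) powr -\<beta> \<le> \<bar>\<psi> x\<bar> * (x - a) powr -\<beta>" for x
        using \<beta> by (cases "x \<in> {a<..<b}") (auto simp: supp intro!: mult_left_mono powr_mono2')
    qed measurable
    moreover have "(\<integral>(x, y). (\<bar>\<psi> x\<bar> - \<bar>\<psi> y\<bar>) * (if a < y \<and> y + \<epsilon> < x \<and> x < b then 1 / (x - y) powr (\<beta> + 1) else 0) \<partial>LL)
        \<le> (\<integral>(x, y). \<bar>\<psi> x - \<psi> y\<bar> * tri \<beta> a b x y \<partial>LL)"
    proof (intro integral_mono dbl' T(1))
      show "(case p of (x, y) \<Rightarrow> (\<bar>\<psi> x\<bar> - \<bar>\<psi> y\<bar>) * (if a < y \<and> y + \<epsilon> < x \<and> x < b then 1 / (x - y) powr (\<beta> + 1) else 0))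
         \<le> (case p of (x, y) \<Rightarrow> \<bar>\<psi> x - \<psi> y\<bar> * tri \<beta> a b x y)" for p
        using \<epsilon> by (auto simp: tri_def split: prod.split intro!: divide_right_mono)
    qed (use supp in auto)
    ultimately show ?thesis
      unfolding C_def using \<beta> supp by (subst T(2)[symmetric]) (auto intro!: add_mono mult_left_mono)
  qed
  have "(\<integral>\<^sup>+x. ennreal (norm (\<psi> x * (b - x) powr -\<beta>)) \<partial>lebesgue)
      = (\<integral>\<^sup>+x. liminf (\<lambda>n. ennreal (\<bar>\<psi> x\<bar> * max (inverse (real (Suc n))) (b - x) powr -\<beta>)) \<partial>lebesgue)"
  proof (intro nn_integral_cong)
    fix x
    have "(\<lambda>n. \<bar>\<psi> x\<bar> * max (inverse (real (Suc n))) (b - x) powr -\<beta>) \<longlonglongrightarrow> \<bar>\<psi> x\<bar> * (b - x) powr -\<beta>"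
      using supp[of x] by (cases "x \<in> {a<..<b}") (auto simp del: of_nat_Suc intro!: tendsto_mult max_inverse_Suc_powr_tendsto)
    then have "(\<lambda>n. ennreal (\<bar>\<psi> x\<bar> * max (inverse (real (Suc n))) (b - x) powr -\<beta>)) \<longlonglongrightarrow> ennreal (\<bar>\<psi> x\<bar> * (b - x) powr -\<beta>)"
      by (rule tendsto_ennrealI)
    then show "ennreal (norm (\<psi> x * (b - x) powr -\<beta>)) = liminf (\<lambda>n. ennreal (\<bar>\<psi> x\<bar> * max (inverse (real (Suc n))) (b - x) powr -\<beta>))"
      by (subst lim_imp_Liminf) (auto simp: abs_mult)
  qed
  also have "\<dots> \<le> liminf (\<lambda>n. \<integral>\<^sup>+x. ennreal (\<bar>\<psi> x\<bar> * max (inverse (real (Suc n))) (b - x) powr -\<beta>) \<partial>lebesgue)"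
    by (rule nn_integral_liminf) measurable
  also have "\<dots> \<le> ennreal C"
  proof (rule Liminf_le)
    show "\<forall>\<^sub>F n in sequentially. (\<integral>\<^sup>+x. ennreal (\<bar>\<psi> x\<bar> * max (inverse (real (Suc n))) (b - x) powr -\<beta>) \<partial>lebesgue) \<le> ennreal C"
    proof (intro always_eventually allI)
      fix n
      have "(\<integral>\<^sup>+x. ennreal (\<bar>\<psi> x\<bar> * max (inverse (real (Suc n))) (b - x) powr -\<beta>) \<partial>lebesgue)
         = ennreal (LINT x|lebesgue. \<bar>\<psi> x\<bar> * max (inverse (real (Suc n))) (b - x) powr -\<beta>)"
        using \<beta> \<psi> by (intro nn_integral_eq_integral integrable_max_powr) auto
      then show "(\<integral>\<^sup>+x. ennreal (\<bar>\<psi> x\<bar> * max (inverse (real (Suc n))) (b - x) powr -\<beta>) \<partial>lebesgue) \<le> ennreal C"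
        using bd[of "inverse (real (Suc n))"] by (simp add: ennreal_leI)
    qed
  qed simp
  finally show ?thesis
    by (intro integrableI_bounded) (auto simp: le_less_trans)
qed

text \<open>
  The limit of the truncated identity; all three integrands are dominated by their untruncated forms.
\<close>

lemma triangle_identity:
  fixes \<psi> :: "real \<Rightarrow> real"
  assumes \<beta>: "0 < \<beta>" and [measurable]: "\<psi> \<in> borel_measurable lebesgue"
    and supp: "\<And>x. x \<notin> {a<..<b} \<Longrightarrow> \<psi> x = 0"
    and left: "integrable lebesgue (\<lambda>x. \<psi> x * (x - a) powr -\<beta>)"
    and right: "integrable lebesgue (\<lambda>x. \<psi> x * (b - x) powr -\<beta>)"
    and dbl: "integrable LL (\<lambda>(x, y). (\<psi> x - \<psi> y) * tri \<beta> a b x y)"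
  shows "(LINT x|lebesgue. \<psi> x * (x - a) powr -\<beta>) + \<beta> * (\<integral>(x, y). (\<psi> x - \<psi> y) * tri \<beta> a b x y \<partial>LL)
      = (LINT x|lebesgue. \<psi> x * (b - x) powr -\<beta>)"
proof -
  define e where "e n = inverse (real (Suc n))" for n
  have e: "0 < e n" "e \<longlonglongrightarrow> 0" for n
    unfolding e_def using LIMSEQ_inverse_real_of_nat by auto
  have \<psi>: "integrable lebesgue \<psi>"
    using integrable_unweighted[OF \<beta> _ supp left] by simp
  have 1: "(\<lambda>n. LINT x|lebesgue. \<psi> x * max (e n) (h x) powr -\<beta>) \<longlonglongrightarrow> (LINT x|lebesgue. \<psi> x * h x powr -\<beta>)"
    if i: "integrable lebesgue (\<lambda>x. \<psi> x * h x powr -\<beta>)" and [measurable]: "h \<in> borel_measurable lebesgue"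
      and h: "\<And>x. x \<in> {a<..<b} \<Longrightarrow> 0 < h x" for h
  proof (rule integral_dominated_convergence[where w = "\<lambda>x. \<bar>\<psi> x * h x powr -\<beta>\<bar>"])
    show "AE x in lebesgue. (\<lambda>n. \<psi> x * max (e n) (h x) powr -\<beta>) \<longlonglongrightarrow> \<psi> x * h x powr -\<beta>"
    proof (intro AE_I2)
      fix x
      show "(\<lambda>n. \<psi> x * max (e n) (h x) powr -\<beta>) \<longlonglongrightarrow> \<psi> x * h x powr -\<beta>"
        using supp[of x] h[of x] unfolding e_def
        by (cases "x \<in> {a<..<b}") (auto simp del: of_nat_Suc intro!: tendsto_mult max_inverse_Suc_powr_tendsto)
    qed
    show "AE x in lebesgue. norm (\<psi> x * max (e n) (h x) powr -\<beta>) \<le> \<bar>\<psi> x * h x powr -\<beta>\<bar>" for n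
    proof (intro AE_I2)
      fix x
      show "norm (\<psi> x * max (e n) (h x) powr -\<beta>) \<le> \<bar>\<psi> x * h x powr -\<beta>\<bar>"
        using supp[of x] h[of x] \<beta> e(1)[of n]
        by (cases "x \<in> {a<..<b}") (auto simp: abs_mult intro!: mult_left_mono powr_mono2')
    qed
  qed (use i in auto)
  define k where "k n x y = (if a < y \<and> y + e n < x \<and> x < b then 1 / (x - y) powr (\<beta> + 1) else 0)" for n x y
  have [measurable]: "(\<lambda>p. k n (fst p) (snd p)) \<in> borel_measurable LL" for n
    unfolding k_def by measurable
  have 2: "(\<lambda>n. \<integral>(x, y). (\<psi> x - \<psi> y) * k n x y \<partial>LL) \<longlonglongrightarrow> (\<integral>(x, y). (\<psi> x - \<psi> y) * tri \<beta> a b x y \<partial>LL)"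
  proof (rule integral_dominated_convergence[where w = "\<lambda>p. \<bar>case p of (x, y) \<Rightarrow> (\<psi> x - \<psi> y) * tri \<beta> a b x y\<bar>"])
    show "integrable LL (\<lambda>p. \<bar>case p of (x, y) \<Rightarrow> (\<psi> x - \<psi> y) * tri \<beta> a b x y\<bar>)"
      using dbl by (rule integrable_abs)
    have "(\<lambda>n. k n x y) \<longlonglongrightarrow> tri \<beta> a b x y" for x y
    proof (cases "y < x")
      case True
      then have "\<forall>\<^sub>F n in sequentially. e n < x - y"
        using e(2) by (intro order_tendstoD(2)) auto
      then have "\<forall>\<^sub>F n in sequentially. k n x y = tri \<beta> a b x y"
        by eventually_elim (use True in \<open>auto simp: k_def tri_def\<close>)
      then show ?thesis by (rule tendsto_eventually)
    next
      case False
      then have "k n x y = tri \<beta> a b x y" for n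
        using e(1)[of n] by (auto simp: k_def tri_def)
      then show ?thesis by simp
    qed
    then show "AE p in LL. (\<lambda>n. case p of (x, y) \<Rightarrow> (\<psi> x - \<psi> y) * k n x y) \<longlonglongrightarrow> (case p of (x, y) \<Rightarrow> (\<psi> x - \<psi> y) * tri \<beta> a b x y)"
      by (intro AE_I2) (auto split: prod.split intro!: tendsto_mult)
    have "\<bar>k n x y\<bar> \<le> \<bar>tri \<beta> a b x y\<bar>" for n x y
      using e(1)[of n] by (auto simp: k_def tri_def)
    then show "AE p in LL. norm (case p of (x, y) \<Rightarrow> (\<psi> x - \<psi> y) * k n x y) \<le> \<bar>case p of (x, y) \<Rightarrow> (\<psi> x - \<psi> y) * tri \<beta> a b x y\<bar>" for n
      by (intro AE_I2) (auto split: prod.split simp: abs_mult intro!: mult_left_mono)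
  qed measurable
  have "(\<lambda>n. (LINT x|lebesgue. \<psi> x * max (e n) (x - a) powr -\<beta>) + \<beta> * (\<integral>(x, y). (\<psi> x - \<psi> y) * k n x y \<partial>LL))
     \<longlonglongrightarrow> (LINT x|lebesgue. \<psi> x * (x - a) powr -\<beta>) + \<beta> * (\<integral>(x, y). (\<psi> x - \<psi> y) * tri \<beta> a b x y \<partial>LL)"
    by (intro tendsto_add tendsto_mult tendsto_const 1 2 left) auto
  moreover have "(\<lambda>n. (LINT x|lebesgue. \<psi> x * max (e n) (x - a) powr -\<beta>) + \<beta> * (\<integral>(x, y). (\<psi> x - \<psi> y) * k n x y \<partial>LL))
    = (\<lambda>n. LINT x|lebesgue. \<psi> x * max (e n) (b - x) powr -\<beta>)"
    unfolding k_def using truncated_identity(2)[OF \<beta> e(1) \<psi> supp] by presburger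
  ultimately show ?thesis
    using 1[OF right] by (auto intro: LIMSEQ_unique)
qed

text \<open>
  The triangle identity for \<open>\<psi> = p q\<close>, with the increment of the product split as
  \<open>(p(x) - p(y)) q(x) - p(y) (q(y) - q(x))\<close>. The two halves are a left derivative of \<open>p\<close> paired
  with \<open>q\<close> and a right derivative of \<open>q\<close> paired with \<open>p\<close>.
\<close>

lemma triangle_product_rule:
  fixes p q :: "real \<Rightarrow> real"
  assumes \<beta>: "0 < \<beta>" and [measurable]: "p \<in> borel_measurable lebesgue" "q \<in> borel_measurable lebesgue"
    and supp: "\<And>x. x \<notin> {a<..<b} \<Longrightarrow> p x * q x = 0"
    and left: "integrable lebesgue (\<lambda>x. p x * q x * (x - a) powr -\<beta>)"
    and right: "integrable lebesgue (\<lambda>x. p x * q x * (b - x) powr -\<beta>)"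
    and dbl1: "integrable LL (\<lambda>(x, y). (p x - p y) * q x * tri \<beta> a b x y)"
    and dbl2: "integrable LL (\<lambda>(x, y). p y * (q y - q x) * tri \<beta> a b x y)"
  shows "(LINT x|lebesgue. p x * q x * (x - a) powr -\<beta>) + \<beta> * (\<integral>(x, y). (p x - p y) * q x * tri \<beta> a b x y \<partial>LL)
      = (LINT x|lebesgue. p x * q x * (b - x) powr -\<beta>) + \<beta> * (\<integral>(x, y). p y * (q y - q x) * tri \<beta> a b x y \<partial>LL)"
proof -
  have eq: "(\<lambda>(x, y). (p x * q x - p y * q y) * tri \<beta> a b x y)
     = (\<lambda>z. (case z of (x, y) \<Rightarrow> (p x - p y) * q x * tri \<beta> a b x y) - (case z of (x, y) \<Rightarrow> p y * (q y - q x) * tri \<beta> a b x y))"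
    by (auto simp: fun_eq_iff algebra_simps)
  have dbl: "integrable LL (\<lambda>(x, y). (p x * q x - p y * q y) * tri \<beta> a b x y)"
    unfolding eq by (rule Bochner_Integration.integrable_diff[OF dbl1 dbl2])
  have "(\<integral>(x, y). (p x * q x - p y * q y) * tri \<beta> a b x y \<partial>LL)
     = (\<integral>(x, y). (p x - p y) * q x * tri \<beta> a b x y \<partial>LL) - (\<integral>(x, y). p y * (q y - q x) * tri \<beta> a b x y \<partial>LL)"
    unfolding eq by (rule Bochner_Integration.integral_diff[OF dbl1 dbl2])
  then show ?thesis
    using triangle_identity[OF \<beta> _ supp left right dbl] by (simp add: right_diff_distrib)
qed

section \<open>Antiderivatives for the Weyl derivatives of powers\<close>

lemma ftc_shift:
  fixes G g :: "real \<Rightarrow> real"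
  assumes "0 \<le> c" "continuous_on {0..c} G"
    and d: "\<And>v. 0 < v \<Longrightarrow> v < c \<Longrightarrow> (G has_real_derivative g v) (at v)"
    and "\<And>v. 0 < v \<Longrightarrow> v < c \<Longrightarrow> 0 \<le> g v"
  shows "set_integrable lebesgue {y<..<y + c} (\<lambda>x. g (x - y))"
    "(LINT x:{y<..<y + c}|lebesgue. g (x - y)) = G c - G 0"
    "set_integrable lebesgue {y - c<..<y} (\<lambda>x. g (y - x))"
    "(LINT x:{y - c<..<y}|lebesgue. g (y - x)) = G c - G 0"
proof -
  have c1: "continuous_on {y..y + c} (\<lambda>x. G (x - y))"
    by (rule continuous_on_compose2[OF assms(2)]) (auto intro!: continuous_intros)
  have d1: "((\<lambda>x. G (x - y)) has_real_derivative g (x - y)) (at x)" if "y < x" "x < y + c" for x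
  proof -
    have *: "((\<lambda>x. x - y) has_real_derivative 1) (at x)" by (auto intro!: derivative_eq_intros)
    have "(G has_real_derivative g (x - y)) (at (x - y))" using that by (intro d) auto
    from DERIV_chain2[where g = "\<lambda>x. x - y", OF this *] show ?thesis by simp
  qed
  have c2: "continuous_on {y - c..y} (\<lambda>x. - G (y - x))"
    by (intro continuous_intros continuous_on_compose2[OF assms(2)]) auto
  have d2: "((\<lambda>x. - G (y - x)) has_real_derivative g (y - x)) (at x)" if "y - c < x" "x < y" for x
  proof -
    have *: "((\<lambda>x. y - x) has_real_derivative -1) (at x)" by (auto intro!: derivative_eq_intros)
    have "(G has_real_derivative g (y - x)) (at (y - x))" using that by (intro d) auto
    from DERIV_minus[OF DERIV_chain2[where g = "\<lambda>x. y - x", OF this *]] show ?thesis by simp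
  qed
  show "set_integrable lebesgue {y<..<y + c} (\<lambda>x. g (x - y))"
    "(LINT x:{y<..<y + c}|lebesgue. g (x - y)) = G c - G 0"
    using ftc_nonneg[OF _ c1 d1] assms by auto
  show "set_integrable lebesgue {y - c<..<y} (\<lambda>x. g (y - x))"
    "(LINT x:{y - c<..<y}|lebesgue. g (y - x)) = G c - G 0"
    using ftc_nonneg[OF _ c2 d2] assms by auto
qed

text \<open>
  Near \<open>0\<close> a function that vanishes there is \<open>O(v)\<close>, which beats the singularity \<open>v^(-\<beta>)\<close>.
\<close>

lemma continuous_on_powr_times_vanishing:
  fixes h :: "real \<Rightarrow> real"
  assumes "\<beta> < 1" "h 0 = 0" "(h has_real_derivative h') (at 0)" "continuous_on {0..c} h"
  shows "continuous_on {0..c} (\<lambda>v. v powr -\<beta> * h v)"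
  unfolding continuous_on_eq_continuous_within
proof
  fix v assume v: "v \<in> {0..c}"
  show "continuous (at v within {0..c}) (\<lambda>v. v powr -\<beta> * h v)"
  proof (cases "v = 0")
    case True
    have "((\<lambda>v. h v / v) \<longlongrightarrow> h') (at 0 within {0..c})"
      using assms(2,3) by (auto simp: has_field_derivative_iff intro: tendsto_within_subset)
    moreover have "((\<lambda>v. v powr (1 - \<beta>)) \<longlongrightarrow> 0 powr (1 - \<beta>)) (at 0 within {0..c})"
      using assms(1) by (intro tendsto_powr' tendsto_intros) (auto simp: eventually_at_filter)
    ultimately have "((\<lambda>v. v powr (1 - \<beta>) * (h v / v)) \<longlongrightarrow> 0) (at 0 within {0..c})"
      using assms(1) tendsto_mult by fastforce
    moreover have "\<forall>\<^sub>F v in at 0 within {0..c}. v powr (1 - \<beta>) * (h v / v) = v powr -\<beta> * h v"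
      by (auto simp: eventually_at_filter powr_diff powr_minus field_simps)
    ultimately show ?thesis
      using True assms(2) by (auto simp: continuous_within intro: Lim_transform_eventually)
  next
    case False
    then show ?thesis using v assms(4)
      by (intro continuous_intros) (auto simp: continuous_on_eq_continuous_within)
  qed
qed

text \<open>
  The integrand is the singular part of the Weyl derivative of order \<open>\<beta>\<close> of the power \<open>\<beta> - 1\<close>,
  as a function of the distance \<open>v\<close> from the point at which it is taken. It has an elementary
  antiderivative because \<open>v^(-\<beta>) (D-v)^\<beta>\<close> has derivative \<open>-\<beta> D v^(-\<beta>-1) (D-v)^(\<beta>-1)\<close>.
\<close>

lemma weyl_antiderivative_1:
  fixes \<beta> c D :: real
  assumes "0 < \<beta>" "\<beta> < 1" "0 < c" "c < D"
  defines "Q \<equiv> (\<lambda>v. v powr -\<beta> * (D powr (\<beta> - 1) - (D - v) powr \<beta> / D))"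
    and "q \<equiv> (\<lambda>v. \<beta> * ((D - v) powr (\<beta> - 1) - D powr (\<beta> - 1)) / v powr (\<beta> + 1))"
  shows "continuous_on {0..c} Q"
    "0 < v \<Longrightarrow> v < c \<Longrightarrow> (Q has_real_derivative q v) (at v)"
    "0 < v \<Longrightarrow> v < c \<Longrightarrow> 0 \<le> q v"
proof -
  show "continuous_on {0..c} Q"
    unfolding Q_def
  proof (rule continuous_on_powr_times_vanishing)
    show "((\<lambda>v. D powr (\<beta> - 1) - (D - v) powr \<beta> / D) has_real_derivative \<beta> * D powr (\<beta> - 1) / D) (at 0)"
      using assms by (auto intro!: derivative_eq_intros)
  qed (use assms in \<open>auto intro!: continuous_intros simp: powr_diff\<close>)
  show "0 \<le> q v" if "0 < v" "v < c"
    unfolding q_def using assms that by (intro divide_nonneg_nonneg mult_nonneg_nonneg) (auto intro!: powr_mono2')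
  show "(Q has_real_derivative q v) (at v)" if v: "0 < v" "v < c"
  proof -
    have e: "v powr -\<beta> = v powr (-\<beta> - 1) * v" "(D - v) powr \<beta> = (D - v) powr (\<beta> - 1) * (D - v)"
      "1 / v powr (\<beta> + 1) = v powr (-\<beta> - 1)"
    proof -
      show "v powr -\<beta> = v powr (-\<beta> - 1) * v"
        using powr_add[of v "-\<beta> - 1" 1] v by simp
      show "(D - v) powr \<beta> = (D - v) powr (\<beta> - 1) * (D - v)"
        using powr_add[of "D - v" "\<beta> - 1" 1] v assms by simp
      show "1 / v powr (\<beta> + 1) = v powr (-\<beta> - 1)"
        using powr_minus_divide[of v "\<beta> + 1"] by simp
    qed
    have d1: "((\<lambda>v. v powr -\<beta>) has_real_derivative - \<beta> * v powr (-\<beta> - 1)) (at v)"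
      using v by (auto intro!: derivative_eq_intros)
    have d2: "((\<lambda>v. D powr (\<beta> - 1) - (D - v) powr \<beta> / D) has_real_derivative \<beta> * (D - v) powr (\<beta> - 1) / D) (at v)"
      using v assms by (auto intro!: derivative_eq_intros)
    have "-\<beta> * V * (E - P * (D - v) / D) + \<beta> * P / D * (V * v) = \<beta> * (P - E) * V" for V E P
      using assms by (simp add: field_simps)
    from this[of "v powr (-\<beta> - 1)" "D powr (\<beta> - 1)" "(D - v) powr (\<beta> - 1)"]
    have "- \<beta> * v powr (-\<beta> - 1) * (D powr (\<beta> - 1) - (D - v) powr \<beta> / D)
       + \<beta> * (D - v) powr (\<beta> - 1) / D * v powr -\<beta> = q v"
      unfolding e(1,2) q_def by (simp only: divide_inverse e(3)[unfolded divide_inverse mult_1])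
    from DERIV_cong[OF DERIV_mult[OF d1 d2] this] show ?thesis unfolding Q_def .
  qed
qed

text \<open>
  The same for the power \<open>\<beta> - 2\<close>; up to a constant factor this antiderivative is the derivative of
  the previous one with respect to \<open>D\<close>.
\<close>

lemma weyl_antiderivative_2:
  fixes \<beta> c D :: real
  assumes "0 < \<beta>" "\<beta> < 1" "0 < c" "c < D"
  defines "Q \<equiv> (\<lambda>v. v powr -\<beta> * (D powr (\<beta> - 2) - (D - v) powr (\<beta> - 1) * ((1 - \<beta>) * D - v) / ((1 - \<beta>) * D\<^sup>2)))"
    and "q \<equiv> (\<lambda>v. \<beta> * ((D - v) powr (\<beta> - 2) - D powr (\<beta> - 2)) / v powr (\<beta> + 1))"
  shows "continuous_on {0..c} Q"
    "0 < v \<Longrightarrow> v < c \<Longrightarrow> (Q has_real_derivative q v) (at v)"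
    "0 < v \<Longrightarrow> v < c \<Longrightarrow> 0 \<le> q v"
proof -
  have D: "D powr (\<beta> - 2) = D powr (\<beta> - 1) / D" 
    using assms by (simp add: powr_diff power2_eq_square)
  show "continuous_on {0..c} Q"
    unfolding Q_def
  proof (rule continuous_on_powr_times_vanishing)
    show "((\<lambda>v. D powr (\<beta> - 2) - (D - v) powr (\<beta> - 1) * ((1 - \<beta>) * D - v) / ((1 - \<beta>) * D\<^sup>2)) has_real_derivative
       - ((- ((\<beta> - 1) * D powr (\<beta> - 2) * ((1 - \<beta>) * D)) - D powr (\<beta> - 1)) / ((1 - \<beta>) * D\<^sup>2))) (at 0)"
      using assms by (auto intro!: derivative_eq_intros)
    show "D powr (\<beta> - 2) - (D - 0) powr (\<beta> - 1) * ((1 - \<beta>) * D - 0) / ((1 - \<beta>) * D\<^sup>2) = 0"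
      using assms by (simp add: D power2_eq_square)
  qed (use assms in \<open>auto intro!: continuous_intros\<close>)
  show "0 \<le> q v" if "0 < v" "v < c"
    unfolding q_def using assms that by (intro divide_nonneg_nonneg mult_nonneg_nonneg) (auto intro!: powr_mono2')
  show "(Q has_real_derivative q v) (at v)" if v: "0 < v" "v < c"
  proof -
    have e: "v powr -\<beta> = v powr (-\<beta> - 1) * v" "(D - v) powr (\<beta> - 1) = (D - v) powr (\<beta> - 2) * (D - v)"
      "1 / v powr (\<beta> + 1) = v powr (-\<beta> - 1)"
    proof -
      show "v powr -\<beta> = v powr (-\<beta> - 1) * v"
        using powr_add[of v "-\<beta> - 1" 1] v by simp
      show "(D - v) powr (\<beta> - 1) = (D - v) powr (\<beta> - 2) * (D - v)"
        using powr_add[of "D - v" "\<beta> - 2" 1] v assms by simp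
      show "1 / v powr (\<beta> + 1) = v powr (-\<beta> - 1)"
        using powr_minus_divide[of v "\<beta> + 1"] by simp
    qed
    define \<kappa> where "\<kappa> = 1 / ((1 - \<beta>) * D\<^sup>2)"
    have \<kappa>: "\<kappa> * ((1 - \<beta>) * D\<^sup>2) = 1" using assms by (simp add: \<kappa>_def)
    have Q: "Q = (\<lambda>v. v powr -\<beta> * (D powr (\<beta> - 2) - \<kappa> * ((D - v) powr (\<beta> - 1) * ((1 - \<beta>) * D - v))))"
      by (simp add: Q_def \<kappa>_def)
    have d1: "((\<lambda>v. v powr -\<beta>) has_real_derivative - \<beta> * v powr (-\<beta> - 1)) (at v)"
      using v by (auto intro!: derivative_eq_intros)
    have d2: "((\<lambda>v. (D - v) powr (\<beta> - 1)) has_real_derivative (1 - \<beta>) * (D - v) powr (\<beta> - 2)) (at v)"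
      using v assms by (auto intro!: derivative_eq_intros simp: algebra_simps)
    have d3: "((\<lambda>v. (1 - \<beta>) * D - v) has_real_derivative - 1) (at v)"
      by (auto intro!: derivative_eq_intros)
    note d = DERIV_mult[OF d1 DERIV_diff[OF DERIV_const[of "D powr (\<beta> - 2)"] DERIV_cmult[OF DERIV_mult[OF d2 d3], of \<kappa>]]]
    have "-\<beta> * V * (E - \<kappa> * (P * (D - v) * ((1 - \<beta>) * D - v)))
        + (0 - \<kappa> * ((1 - \<beta>) * P * ((1 - \<beta>) * D - v) + - 1 * (P * (D - v)))) * (V * v) = \<beta> * (P - E) * V" for V E P
    proof -
      have "\<beta> * (D - v) * ((1 - \<beta>) * D - v) + v * ((\<beta> - 1) * ((1 - \<beta>) * D - v) + (D - v)) = \<beta> * ((1 - \<beta>) * D\<^sup>2)"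
        by (simp add: algebra_simps power2_eq_square)
      then have X: "\<kappa> * (\<beta> * (D - v) * ((1 - \<beta>) * D - v) + v * ((\<beta> - 1) * ((1 - \<beta>) * D - v) + (D - v))) = \<kappa> * (\<beta> * ((1 - \<beta>) * D\<^sup>2))"
        by (simp only:)
      have \<beta>: "\<kappa> * (\<beta> * ((1 - \<beta>) * D\<^sup>2)) = \<beta>"
        using \<kappa> by (simp only: mult.left_commute[of \<kappa> \<beta>] mult_1_right)
      have "-\<beta> * V * (E - \<kappa> * (P * (D - v) * ((1 - \<beta>) * D - v)))
        + (0 - \<kappa> * ((1 - \<beta>) * P * ((1 - \<beta>) * D - v) + - 1 * (P * (D - v)))) * (V * v)
        = \<kappa> * (\<beta> * (D - v) * ((1 - \<beta>) * D - v) + v * ((\<beta> - 1) * ((1 - \<beta>) * D - v) + (D - v))) * (P * V) - \<beta> * E * V"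
        by (simp add: algebra_simps)
      also have "\<dots> = \<beta> * (P - E) * V"
        unfolding X \<beta> by (simp add: algebra_simps)
      finally show ?thesis .
    qed
    from this[of "v powr (-\<beta> - 1)" "D powr (\<beta> - 2)" "(D - v) powr (\<beta> - 2)"]
    have "- \<beta> * v powr (-\<beta> - 1) * (D powr (\<beta> - 2) - \<kappa> * ((D - v) powr (\<beta> - 1) * ((1 - \<beta>) * D - v)))
       + (0 - \<kappa> * ((1 - \<beta>) * (D - v) powr (\<beta> - 2) * ((1 - \<beta>) * D - v) + - 1 * (D - v) powr (\<beta> - 1))) * v powr -\<beta>
       = q v"
      unfolding e(1,2) q_def by (simp only: divide_inverse e(3)[unfolded divide_inverse mult_1])
    from DERIV_cong[OF d this] show ?thesis unfolding Q .
  qed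
qed

section \<open>Fractional integration by parts\<close>

text \<open>
  The left and right Weyl derivatives of order \<open>\<beta>\<close> without the factor \<open>1 / \<Gamma>(1-\<beta>)\<close>, for a
  function that counts as zero outside the interval: the first term is the contribution of the
  jump at the base point.
\<close>

definition frac_left :: "real \<Rightarrow> real \<Rightarrow> (real \<Rightarrow> real) \<Rightarrow> real \<Rightarrow> real" where
  "frac_left \<beta> a f x = f x * (x - a) powr -\<beta> +
     \<beta> * (LINT y:{a<..<x}|lebesgue. (f x - f y) / (x - y) powr (\<beta> + 1))"

definition frac_right :: "real \<Rightarrow> real \<Rightarrow> (real \<Rightarrow> real) \<Rightarrow> real \<Rightarrow> real" where
  "frac_right \<beta> b f x = f x * (b - x) powr -\<beta> +
     \<beta> * (LINT y:{x<..<b}|lebesgue. (f x - f y) / (y - x) powr (\<beta> + 1))"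

lemma frac_left_tri:
  assumes "x \<in> {a<..<b}"
  shows "frac_left \<beta> a f x = f x * (x - a) powr -\<beta> + \<beta> * (LINT y|lebesgue. (f x - f y) * tri \<beta> a b x y)"
proof -
  have "indicator {a<..<x} y *\<^sub>R ((f x - f y) / (x - y) powr (\<beta> + 1)) = (f x - f y) * tri \<beta> a b x y" for y
    using assms by (auto simp: tri_def indicator_def)
  then show ?thesis by (simp add: frac_left_def set_lebesgue_integral_def)
qed

lemma frac_right_tri:
  assumes "y \<in> {a<..<b}"
  shows "frac_right \<beta> b f y = f y * (b - y) powr -\<beta> + \<beta> * (LINT x|lebesgue. (f y - f x) * tri \<beta> a b x y)"
proof -
  have "indicator {y<..<b} x *\<^sub>R ((f y - f x) / (x - y) powr (\<beta> + 1)) = (f y - f x) * tri \<beta> a b x y" for x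
    using assms by (auto simp: tri_def indicator_def)
  then show ?thesis by (simp add: frac_right_def set_lebesgue_integral_def)
qed

lemma tri_zero: "x \<notin> {a<..<b} \<Longrightarrow> tri \<beta> a b x y = 0" "y \<notin> {a<..<b} \<Longrightarrow> tri \<beta> a b x y = 0"
  by (auto simp: tri_def)

text \<open>
  This is the product rule on the triangle, read with the inner integrals as Weyl derivatives. The
  identity is symmetric in the roles of \<open>p\<close> and \<open>q\<close>, so it serves both for an integrand and for
  an integrator.
\<close>

lemma fractional_integration_by_parts:
  fixes p q :: "real \<Rightarrow> real"
  assumes \<beta>: "0 < \<beta>" and [measurable]: "p \<in> borel_measurable lebesgue" "q \<in> borel_measurable lebesgue"
    and left: "set_integrable lebesgue {a<..<b} (\<lambda>x. p x * q x * (x - a) powr -\<beta>)"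
    and right: "set_integrable lebesgue {a<..<b} (\<lambda>x. p x * q x * (b - x) powr -\<beta>)"
    and dbl1: "integrable LL (\<lambda>(x, y). (p x - p y) * q x * tri \<beta> a b x y)"
    and dbl2: "integrable LL (\<lambda>(x, y). p y * (q y - q x) * tri \<beta> a b x y)"
  shows "set_integrable lebesgue {a<..<b} (\<lambda>x. q x * frac_left \<beta> a p x)"
    "set_integrable lebesgue {a<..<b} (\<lambda>x. p x * frac_right \<beta> b q x)"
    "(LINT x:{a<..<b}|lebesgue. q x * frac_left \<beta> a p x) = (LINT x:{a<..<b}|lebesgue. p x * frac_right \<beta> b q x)"
proof -
  define I where "I = (indicator {a<..<b} :: real \<Rightarrow> real)"
  have I[measurable]: "I \<in> borel_measurable lebesgue" by (auto simp: I_def)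
  let ?p = "\<lambda>x. I x * p x" let ?q = "\<lambda>x. I x * q x"
  have II: "I x * I x = I x" for x by (simp add: I_def indicator_def)
  have l: "integrable lebesgue (\<lambda>x. ?p x * ?q x * (x - a) powr -\<beta>)"
    using left unfolding set_integrable_def I_def[symmetric]
    by (rule Bochner_Integration.integrable_cong[OF refl, THEN iffD1, rotated]) (simp add: I_def indicator_def)
  have r: "integrable lebesgue (\<lambda>x. ?p x * ?q x * (b - x) powr -\<beta>)"
    using right unfolding set_integrable_def I_def[symmetric]
    by (rule Bochner_Integration.integrable_cong[OF refl, THEN iffD1, rotated]) (simp add: I_def indicator_def)
  have e1: "(\<lambda>(x, y). (?p x - ?p y) * ?q x * tri \<beta> a b x y) = (\<lambda>(x, y). (p x - p y) * q x * tri \<beta> a b x y)"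
    by (auto simp: fun_eq_iff I_def indicator_def tri_def)
  have e2: "(\<lambda>(x, y). ?p y * (?q y - ?q x) * tri \<beta> a b x y) = (\<lambda>(x, y). p y * (q y - q x) * tri \<beta> a b x y)"
    by (auto simp: fun_eq_iff I_def indicator_def tri_def)
  have 1: "(\<lambda>x. I x *\<^sub>R (q x * frac_left \<beta> a p x))
      = (\<lambda>x. ?p x * ?q x * (x - a) powr -\<beta> + \<beta> * (LINT y|lebesgue. (p x - p y) * q x * tri \<beta> a b x y))"
  proof
    fix x
    show "I x *\<^sub>R (q x * frac_left \<beta> a p x)
      = ?p x * ?q x * (x - a) powr -\<beta> + \<beta> * (LINT y|lebesgue. (p x - p y) * q x * tri \<beta> a b x y)"
    proof (cases "x \<in> {a<..<b}")
      case True
      have "(LINT y|lebesgue. (p x - p y) * q x * tri \<beta> a b x y) = q x * (LINT y|lebesgue. (p x - p y) * tri \<beta> a b x y)"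
        by (simp flip: integral_mult_right_zero add: mult_ac)
      then show ?thesis using True by (simp add: I_def frac_left_tri[OF True] algebra_simps)
    qed (auto simp: I_def tri_zero)
  qed
  have 2: "(\<lambda>y. I y *\<^sub>R (p y * frac_right \<beta> b q y))
      = (\<lambda>y. ?p y * ?q y * (b - y) powr -\<beta> + \<beta> * (LINT x|lebesgue. p y * (q y - q x) * tri \<beta> a b x y))"
  proof
    fix y
    show "I y *\<^sub>R (p y * frac_right \<beta> b q y)
      = ?p y * ?q y * (b - y) powr -\<beta> + \<beta> * (LINT x|lebesgue. p y * (q y - q x) * tri \<beta> a b x y)"
    proof (cases "y \<in> {a<..<b}")
      case True
      have "(LINT x|lebesgue. p y * (q y - q x) * tri \<beta> a b x y) = p y * (LINT x|lebesgue. (q y - q x) * tri \<beta> a b x y)"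
        by (simp flip: integral_mult_right_zero add: mult_ac)
      then show ?thesis using True by (simp add: I_def frac_right_tri[OF True] algebra_simps)
    qed (auto simp: I_def tri_zero)
  qed
  have i1: "integrable lebesgue (\<lambda>x. LINT y|lebesgue. (p x - p y) * q x * tri \<beta> a b x y)"
    using leb.integrable_fst[OF dbl1] .
  have i2: "integrable lebesgue (\<lambda>y. LINT x|lebesgue. p y * (q y - q x) * tri \<beta> a b x y)"
    using leb.integrable_snd[OF dbl2] .
  show "set_integrable lebesgue {a<..<b} (\<lambda>x. q x * frac_left \<beta> a p x)"
    unfolding set_integrable_def I_def[symmetric] 1 using l i1 by auto
  show "set_integrable lebesgue {a<..<b} (\<lambda>x. p x * frac_right \<beta> b q x)"
    unfolding set_integrable_def I_def[symmetric] 2 using r i2 by auto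
  have "(LINT x:{a<..<b}|lebesgue. q x * frac_left \<beta> a p x)
     = (LINT x|lebesgue. ?p x * ?q x * (x - a) powr -\<beta>) + \<beta> * (\<integral>(x, y). (p x - p y) * q x * tri \<beta> a b x y \<partial>LL)"
    unfolding set_lebesgue_integral_def I_def[symmetric] 1 leb.integral_fst[OF dbl1, symmetric]
    by (subst Bochner_Integration.integral_add[OF l]) (use i1 in auto)
  also have "\<dots> = (LINT x|lebesgue. ?p x * ?q x * (b - x) powr -\<beta>) + \<beta> * (\<integral>(x, y). p y * (q y - q x) * tri \<beta> a b x y \<partial>LL)"
    using triangle_product_rule[OF \<beta>, of ?p ?q a b] l r dbl1 dbl2 unfolding e1 e2
    by (simp add: I_def)
  also have "\<dots> = (LINT x:{a<..<b}|lebesgue. p x * frac_right \<beta> b q x)"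
    unfolding set_lebesgue_integral_def I_def[symmetric] 2 leb.integral_snd[OF dbl2, symmetric]
    by (subst Bochner_Integration.integral_add[OF r]) (use i2 in auto)
  finally show "(LINT x:{a<..<b}|lebesgue. q x * frac_left \<beta> a p x) = (LINT x:{a<..<b}|lebesgue. p x * frac_right \<beta> b q x)" .
qed

section \<open>Weyl derivatives of power kernels\<close>

lemma antiderivative_remainder_bound:
  fixes \<beta> c D :: real
  assumes "0 < \<beta>" "\<beta> < 1" "0 < c" "c < D"
  shows "\<bar>(D - c) powr (\<beta> - 1) * ((1 - \<beta>) * D - c) / ((1 - \<beta>) * D\<^sup>2)\<bar> \<le> (D - c) powr (\<beta> - 2) / (1 - \<beta>)"
proof -
  have "\<bar>(1 - \<beta>) * D - c\<bar> \<le> D"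
  proof -
    have "0 \<le> \<beta> * D" "\<beta> * D \<le> D" using assms by (auto simp: mult_le_cancel_right1)
    then show ?thesis unfolding abs_le_iff left_diff_distrib using assms by linarith
  qed
  moreover have "(D - c) powr (\<beta> - 1) = (D - c) powr (\<beta> - 2) * (D - c)"
    using powr_add[of "D - c" "\<beta> - 2" 1] assms by simp
  ultimately have "\<bar>(D - c) powr (\<beta> - 1) * ((1 - \<beta>) * D - c)\<bar> \<le> (D - c) powr (\<beta> - 2) * D * D"
    using assms by (auto simp: abs_mult intro!: mult_mono)
  then have "\<bar>(D - c) powr (\<beta> - 1) * ((1 - \<beta>) * D - c)\<bar> / ((1 - \<beta>) * D\<^sup>2) \<le> (D - c) powr (\<beta> - 2) * D * D / ((1 - \<beta>) * D\<^sup>2)"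
    using assms by (intro divide_right_mono) auto
  also have "\<dots> = (D - c) powr (\<beta> - 2) / (1 - \<beta>)"
    using assms by (simp add: power2_eq_square)
  finally show ?thesis using assms by (simp add: abs_mult)
qed

context
  fixes \<beta> y s z :: real
  assumes \<beta>: "0 < \<beta>" "\<beta> < 1" and ys: "y < s" and sz: "s < z"
begin

text \<open>
  The last clause bounds the total mass of the increments by the weight \<open>(s-y)^(-\<beta>)\<close>, which the
  Hardy inequality makes integrable against a regular integrand.
\<close>

lemma frac_right_kernel_1:
  defines "k \<equiv> (\<lambda>x. (z - x) powr (\<beta> - 1))"
  shows "set_integrable lebesgue {y<..<s} (\<lambda>x. (k x - k y) / (x - y) powr (\<beta> + 1))"
    "frac_right \<beta> s k y = (z - s) powr \<beta> * (s - y) powr -\<beta> / (z - y)"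
    "(LINT x:{y<..<s}|lebesgue. \<bar>k x - k y\<bar> / (x - y) powr (\<beta> + 1)) \<le> (z - s) powr (\<beta> - 1) / \<beta> * (s - y) powr -\<beta>"
proof -
  note G = weyl_antiderivative_1[of \<beta> "s - y" "z - y"]
  note F = ftc_shift[OF _ G(1-3), of y]
  have g: "\<beta> * ((z - y - (x - y)) powr (\<beta> - 1) - (z - y) powr (\<beta> - 1)) / (x - y) powr (\<beta> + 1) = \<beta> * ((k x - k y) / (x - y) powr (\<beta> + 1))" for x
    by (simp add: k_def)
  have "set_integrable lebesgue {y<..<s} (\<lambda>x. \<beta> * ((k x - k y) / (x - y) powr (\<beta> + 1)))"
    using F(1) \<beta> ys sz unfolding g by simp
  then show i: "set_integrable lebesgue {y<..<s} (\<lambda>x. (k x - k y) / (x - y) powr (\<beta> + 1))"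
    by (rule set_integrable_mult_right_iff[THEN iffD1, rotated]) (use \<beta> in simp)
  have v: "\<beta> * (LINT x:{y<..<s}|lebesgue. (k x - k y) / (x - y) powr (\<beta> + 1)) =
      (s - y) powr -\<beta> * ((z - y) powr (\<beta> - 1) - (z - s) powr \<beta> / (z - y))"
    using F(2) \<beta> ys sz unfolding g by (simp del: times_divide_eq_right times_divide_eq_left)
  have n: "(LINT x:{y<..<s}|lebesgue. (k y - k x) / (x - y) powr (\<beta> + 1)) = - (LINT x:{y<..<s}|lebesgue. (k x - k y) / (x - y) powr (\<beta> + 1))"
    by (subst set_integral_uminus[OF i, symmetric]) (simp only: minus_divide_left minus_diff_eq)
  show "frac_right \<beta> s k y = (z - s) powr \<beta> * (s - y) powr -\<beta> / (z - y)"
    unfolding frac_right_def n using v by (simp add: k_def algebra_simps)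
  have "(LINT x:{y<..<s}|lebesgue. \<bar>k x - k y\<bar> / (x - y) powr (\<beta> + 1)) = (LINT x:{y<..<s}|lebesgue. (k x - k y) / (x - y) powr (\<beta> + 1))"
    using \<beta> sz by (intro set_lebesgue_integral_cong) (auto simp: k_def intro!: powr_mono2' abs_of_nonneg)
  also have "\<beta> * \<dots> \<le> (s - y) powr -\<beta> * (z - s) powr (\<beta> - 1)"
    unfolding v
  proof (intro mult_left_mono)
    have "(z - y) powr (\<beta> - 1) \<le> (z - s) powr (\<beta> - 1)"
      using \<beta> ys sz by (intro powr_mono2') auto
    moreover have "0 \<le> (z - s) powr \<beta> / (z - y)" using ys sz by simp
    ultimately show "(z - y) powr (\<beta> - 1) - (z - s) powr \<beta> / (z - y) \<le> (z - s) powr (\<beta> - 1)" by linarith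
  qed simp
  finally show "(LINT x:{y<..<s}|lebesgue. \<bar>k x - k y\<bar> / (x - y) powr (\<beta> + 1)) \<le> (z - s) powr (\<beta> - 1) / \<beta> * (s - y) powr -\<beta>"
    using \<beta> by (simp add: field_simps)
qed

lemma frac_right_kernel_2:
  defines "k \<equiv> (\<lambda>x. (z - x) powr (\<beta> - 2))"
  shows "set_integrable lebesgue {y<..<s} (\<lambda>x. (k x - k y) / (x - y) powr (\<beta> + 1))"
    "frac_right \<beta> s k y = (s - y) powr -\<beta> * ((z - s) powr (\<beta> - 1) * ((1 - \<beta>) * (z - y) - (s - y)) / ((1 - \<beta>) * (z - y)\<^sup>2))"
    "(LINT x:{y<..<s}|lebesgue. \<bar>k x - k y\<bar> / (x - y) powr (\<beta> + 1)) \<le> (z - s) powr (\<beta> - 2) * (1 + 1 / (1 - \<beta>)) / \<beta> * (s - y) powr -\<beta>"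
proof -
  note G = weyl_antiderivative_2[of \<beta> "s - y" "z - y"]
  note F = ftc_shift[OF _ G(1-3), of y]
  have g: "\<beta> * ((z - y - (x - y)) powr (\<beta> - 2) - (z - y) powr (\<beta> - 2)) / (x - y) powr (\<beta> + 1) = \<beta> * ((k x - k y) / (x - y) powr (\<beta> + 1))" for x
    by (simp add: k_def)
  have "set_integrable lebesgue {y<..<s} (\<lambda>x. \<beta> * ((k x - k y) / (x - y) powr (\<beta> + 1)))"
    using F(1) \<beta> ys sz unfolding g by simp
  then show i: "set_integrable lebesgue {y<..<s} (\<lambda>x. (k x - k y) / (x - y) powr (\<beta> + 1))"
    by (rule set_integrable_mult_right_iff[THEN iffD1, rotated]) (use \<beta> in simp)
  define R where "R = (z - s) powr (\<beta> - 1) * ((1 - \<beta>) * (z - y) - (s - y)) / ((1 - \<beta>) * (z - y)\<^sup>2)"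
  have v: "\<beta> * (LINT x:{y<..<s}|lebesgue. (k x - k y) / (x - y) powr (\<beta> + 1)) = (s - y) powr -\<beta> * ((z - y) powr (\<beta> - 2) - R)"
    using F(2) \<beta> ys sz unfolding g R_def by (simp del: times_divide_eq_right times_divide_eq_left)
  have n: "(LINT x:{y<..<s}|lebesgue. (k y - k x) / (x - y) powr (\<beta> + 1)) = - (LINT x:{y<..<s}|lebesgue. (k x - k y) / (x - y) powr (\<beta> + 1))"
    by (subst set_integral_uminus[OF i, symmetric]) (simp only: minus_divide_left minus_diff_eq)
  show "frac_right \<beta> s k y = (s - y) powr -\<beta> * ((z - s) powr (\<beta> - 1) * ((1 - \<beta>) * (z - y) - (s - y)) / ((1 - \<beta>) * (z - y)\<^sup>2))"
    unfolding frac_right_def n R_def[symmetric] using v by (simp add: k_def algebra_simps)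
  have "(LINT x:{y<..<s}|lebesgue. \<bar>k x - k y\<bar> / (x - y) powr (\<beta> + 1)) = (LINT x:{y<..<s}|lebesgue. (k x - k y) / (x - y) powr (\<beta> + 1))"
    using \<beta> sz by (intro set_lebesgue_integral_cong) (auto simp: k_def intro!: powr_mono2' abs_of_nonneg)
  also have "\<beta> * \<dots> \<le> (s - y) powr -\<beta> * ((z - s) powr (\<beta> - 2) * (1 + 1 / (1 - \<beta>)))"
    unfolding v
  proof (intro mult_left_mono)
    have "(z - y) powr (\<beta> - 2) \<le> (z - s) powr (\<beta> - 2)"
      using \<beta> ys sz by (intro powr_mono2') auto
    moreover have "\<bar>R\<bar> \<le> (z - s) powr (\<beta> - 2) / (1 - \<beta>)"
      using antiderivative_remainder_bound[of \<beta> "s - y" "z - y"] \<beta> ys sz by (simp add: R_def)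
    ultimately show "(z - y) powr (\<beta> - 2) - R \<le> (z - s) powr (\<beta> - 2) * (1 + 1 / (1 - \<beta>))"
      by (simp add: algebra_simps)
  qed simp
  finally show "(LINT x:{y<..<s}|lebesgue. \<bar>k x - k y\<bar> / (x - y) powr (\<beta> + 1)) \<le> (z - s) powr (\<beta> - 2) * (1 + 1 / (1 - \<beta>)) / \<beta> * (s - y) powr -\<beta>"
    using \<beta> by (simp add: pos_le_divide_eq mult_ac)
qed

text \<open>
  The mirror image of the previous lemma: the singularity of the power now lies to the left.
\<close>

lemma frac_left_kernel_2:
  defines "k \<equiv> (\<lambda>x. (x - y) powr (\<beta> - 2))"
  shows "set_integrable lebesgue {s<..<z} (\<lambda>x. (k x - k z) / (z - x) powr (\<beta> + 1))"
    "frac_left \<beta> s k z = (z - s) powr -\<beta> * ((s - y) powr (\<beta> - 1) * ((1 - \<beta>) * (z - y) - (z - s)) / ((1 - \<beta>) * (z - y)\<^sup>2))"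
    "(LINT x:{s<..<z}|lebesgue. \<bar>k x - k z\<bar> / (z - x) powr (\<beta> + 1)) \<le> (s - y) powr (\<beta> - 2) * (1 + 1 / (1 - \<beta>)) / \<beta> * (z - s) powr -\<beta>"
proof -
  note G = weyl_antiderivative_2[of \<beta> "z - s" "z - y"]
  note F = ftc_shift[OF _ G(1-3), of z]
  have g: "\<beta> * ((z - y - (z - x)) powr (\<beta> - 2) - (z - y) powr (\<beta> - 2)) / (z - x) powr (\<beta> + 1) = \<beta> * ((k x - k z) / (z - x) powr (\<beta> + 1))" for x
    by (simp add: k_def)
  have "set_integrable lebesgue {s<..<z} (\<lambda>x. \<beta> * ((k x - k z) / (z - x) powr (\<beta> + 1)))"
    using F(3) \<beta> ys sz unfolding g by simp
  then show i: "set_integrable lebesgue {s<..<z} (\<lambda>x. (k x - k z) / (z - x) powr (\<beta> + 1))"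
    by (rule set_integrable_mult_right_iff[THEN iffD1, rotated]) (use \<beta> in simp)
  define R where "R = (s - y) powr (\<beta> - 1) * ((1 - \<beta>) * (z - y) - (z - s)) / ((1 - \<beta>) * (z - y)\<^sup>2)"
  have v: "\<beta> * (LINT x:{s<..<z}|lebesgue. (k x - k z) / (z - x) powr (\<beta> + 1)) = (z - s) powr -\<beta> * ((z - y) powr (\<beta> - 2) - R)"
    using F(4) \<beta> ys sz unfolding g R_def by (simp del: times_divide_eq_right times_divide_eq_left)
  have n: "(LINT x:{s<..<z}|lebesgue. (k z - k x) / (z - x) powr (\<beta> + 1)) = - (LINT x:{s<..<z}|lebesgue. (k x - k z) / (z - x) powr (\<beta> + 1))"
    by (subst set_integral_uminus[OF i, symmetric]) (simp only: minus_divide_left minus_diff_eq)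
  show "frac_left \<beta> s k z = (z - s) powr -\<beta> * ((s - y) powr (\<beta> - 1) * ((1 - \<beta>) * (z - y) - (z - s)) / ((1 - \<beta>) * (z - y)\<^sup>2))"
    unfolding frac_left_def n R_def[symmetric] using v by (simp add: k_def algebra_simps)
  have "(LINT x:{s<..<z}|lebesgue. \<bar>k x - k z\<bar> / (z - x) powr (\<beta> + 1)) = (LINT x:{s<..<z}|lebesgue. (k x - k z) / (z - x) powr (\<beta> + 1))"
    using \<beta> ys by (intro set_lebesgue_integral_cong) (auto simp: k_def intro!: powr_mono2' abs_of_nonneg)
  also have "\<beta> * \<dots> \<le> (z - s) powr -\<beta> * ((s - y) powr (\<beta> - 2) * (1 + 1 / (1 - \<beta>)))"
    unfolding v
  proof (intro mult_left_mono)
    have "(z - y) powr (\<beta> - 2) \<le> (s - y) powr (\<beta> - 2)"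
      using \<beta> ys sz by (intro powr_mono2') auto
    moreover have "\<bar>R\<bar> \<le> (s - y) powr (\<beta> - 2) / (1 - \<beta>)"
      using antiderivative_remainder_bound[of \<beta> "z - s" "z - y"] \<beta> ys sz by (simp add: R_def)
    ultimately show "(z - y) powr (\<beta> - 2) - R \<le> (s - y) powr (\<beta> - 2) * (1 + 1 / (1 - \<beta>))"
      by (simp add: algebra_simps)
  qed simp
  finally show "(LINT x:{s<..<z}|lebesgue. \<bar>k x - k z\<bar> / (z - x) powr (\<beta> + 1)) \<le> (s - y) powr (\<beta> - 2) * (1 + 1 / (1 - \<beta>)) / \<beta> * (z - s) powr -\<beta>"
    using \<beta> by (simp add: pos_le_divide_eq mult_ac)
qed

end

lemma integrable_endpoint_powr:
  fixes \<beta> a b :: real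
  assumes "0 < \<beta>" "\<beta> < 1" "a \<le> b"
  shows "set_integrable lebesgue {a<..<b} (\<lambda>x. (x - a) powr -\<beta>)"
    "set_integrable lebesgue {a<..<b} (\<lambda>x. (b - x) powr -\<beta>)"
proof -
  have c: "continuous_on {0..b - a} (\<lambda>v. v powr (1 - \<beta>) / (1 - \<beta>))"
    using assms by (intro continuous_intros continuous_on_powr') auto
  have d: "((\<lambda>v. v powr (1 - \<beta>) / (1 - \<beta>)) has_real_derivative v powr -\<beta>) (at v)" if "0 < v" for v
    using assms that by (auto intro!: derivative_eq_intros)
  note F = ftc_shift[OF _ c d, simplified]
  show "set_integrable lebesgue {a<..<b} (\<lambda>x. (x - a) powr -\<beta>)"
    using F(1)[of a] assms by simp
  show "set_integrable lebesgue {a<..<b} (\<lambda>x. (b - x) powr -\<beta>)"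
    using F(3)[of b] assms by simp
qed

text \<open>
  \<open>exchange_kernel \<alpha> s y\<close> is the derivative of \<open>exchange_primitive \<alpha> s y\<close>. It is the kernel on
  \<open>y < s < z\<close> into which both sides of the additivity identity are transformed.
\<close>

definition exchange_primitive :: "real \<Rightarrow> real \<Rightarrow> real \<Rightarrow> real \<Rightarrow> real" where
  "exchange_primitive \<alpha> s y z = (z - s) powr \<alpha> * (s - y) powr -\<alpha> / (z - y)"

definition exchange_kernel :: "real \<Rightarrow> real \<Rightarrow> real \<Rightarrow> real \<Rightarrow> real" where
  "exchange_kernel \<alpha> s y z = (s - y) powr -\<alpha> * (z - s) powr (\<alpha> - 1) * (\<alpha> * (z - y) - (z - s)) / (z - y)\<^sup>2"

text \<open>
  Differentiating a power of \<open>z - y\<close> in \<open>y\<close> from the left of \<open>s\<close> by order \<open>\<alpha>\<close>, or in \<open>z\<close> from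
  the right of \<open>s\<close> by order \<open>1 - \<alpha>\<close>, gives the same kernel up to constants of opposite sign. This
  coincidence is what makes the integral additive.
\<close>

lemma exchange_kernel_eq:
  assumes "0 < \<alpha>" "\<alpha> < 1" "y < s" "s < z"
  shows "frac_right \<alpha> s (\<lambda>x. (z - x) powr (\<alpha> - 2)) y = - exchange_kernel \<alpha> s y z / (1 - \<alpha>)"
    "frac_left (1 - \<alpha>) s (\<lambda>x. (x - y) powr (-\<alpha> - 1)) z = exchange_kernel \<alpha> s y z / \<alpha>"
proof -
  have *: "(1 - \<alpha>) * (z - y) - (s - y) = - (\<alpha> * (z - y) - (z - s))" by (simp add: algebra_simps)
  show "frac_right \<alpha> s (\<lambda>x. (z - x) powr (\<alpha> - 2)) y = - exchange_kernel \<alpha> s y z / (1 - \<alpha>)"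
    unfolding frac_right_kernel_2(2)[OF assms] * exchange_kernel_def mult_minus_right by (simp add: mult_ac)
  have "1 - \<alpha> - 2 = - \<alpha> - 1" by simp
  show "frac_left (1 - \<alpha>) s (\<lambda>x. (x - y) powr (-\<alpha> - 1)) z = exchange_kernel \<alpha> s y z / \<alpha>"
    using frac_left_kernel_2(2)[of "1 - \<alpha>" y s z] assms unfolding exchange_kernel_def by (simp only: \<open>1 - \<alpha> - 2 = - \<alpha> - 1\<close>) (simp add: mult_ac)
qed

text \<open>
  The first bound separates the variables with the weights that the integrand (by Hardy) and the
  integrator (by assumption) can absorb; the second one is integrable in \<open>z\<close> up to \<open>s\<close>.
\<close>

lemma exchange_kernel_bound:
  assumes "0 < \<alpha>" "\<alpha> < 1" "y < s" "s < z"
  shows "\<bar>exchange_kernel \<alpha> s y z\<bar> \<le> (s - y) powr -\<alpha> * (z - s) powr (\<alpha> - 2)"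
    "\<bar>exchange_kernel \<alpha> s y z\<bar> \<le> (s - y) powr (-\<alpha> - 1) * (z - s) powr (\<alpha> - 1)"
proof -
  have "\<bar>\<alpha> * (z - y) - (z - s)\<bar> \<le> z - y"
  proof -
    have "0 \<le> \<alpha> * (z - y)" "\<alpha> * (z - y) \<le> z - y" using assms by (auto simp: mult_le_cancel_right1)
    then show ?thesis unfolding abs_le_iff using assms by linarith
  qed
  then have "\<bar>exchange_kernel \<alpha> s y z\<bar> \<le> (s - y) powr -\<alpha> * (z - s) powr (\<alpha> - 1) * (z - y) / (z - y)\<^sup>2"
    using assms unfolding exchange_kernel_def by (auto simp: abs_mult intro!: divide_right_mono mult_left_mono)
  also have "\<dots> = (s - y) powr -\<alpha> * (z - s) powr (\<alpha> - 1) / (z - y)"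
    using assms by (simp add: power2_eq_square)
  finally have *: "\<bar>exchange_kernel \<alpha> s y z\<bar> \<le> (s - y) powr -\<alpha> * (z - s) powr (\<alpha> - 1) / (z - y)" .
  also have "\<dots> \<le> (s - y) powr -\<alpha> * (z - s) powr (\<alpha> - 1) / (z - s)"
    using assms by (intro divide_left_mono) auto
  also have "\<dots> = (s - y) powr -\<alpha> * (z - s) powr (\<alpha> - 2)"
    using powr_add[of "z - s" "\<alpha> - 2" 1] assms by simp
  finally show "\<bar>exchange_kernel \<alpha> s y z\<bar> \<le> (s - y) powr -\<alpha> * (z - s) powr (\<alpha> - 2)" .
  note *
  also have "(s - y) powr -\<alpha> * (z - s) powr (\<alpha> - 1) / (z - y) \<le> (s - y) powr -\<alpha> * (z - s) powr (\<alpha> - 1) / (s - y)"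
    using assms by (intro divide_left_mono) auto
  also have "\<dots> = (s - y) powr (-\<alpha> - 1) * (z - s) powr (\<alpha> - 1)"
    using powr_add[of "s - y" "-\<alpha> - 1" 1] assms by simp
  finally show "\<bar>exchange_kernel \<alpha> s y z\<bar> \<le> (s - y) powr (-\<alpha> - 1) * (z - s) powr (\<alpha> - 1)" .
qed

lemma exchange_kernel_integral:
  assumes "0 < \<alpha>" "\<alpha> < 1" "y < s" "s < t"
  shows "set_integrable lebesgue {s<..<t} (exchange_kernel \<alpha> s y)"
    "(LINT z:{s<..<t}|lebesgue. exchange_kernel \<alpha> s y z) = exchange_primitive \<alpha> s y t"
proof -
  have [measurable]: "exchange_kernel \<alpha> s y \<in> borel_measurable lebesgue"
    unfolding exchange_kernel_def[abs_def] by measurable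
  show i: "set_integrable lebesgue {s<..<t} (exchange_kernel \<alpha> s y)"
    unfolding set_integrable_def
  proof (rule Bochner_Integration.integrable_bound)
    show "integrable lebesgue (\<lambda>z. (s - y) powr (-\<alpha> - 1) * (indicator {s<..<t} z *\<^sub>R (z - s) powr (- (1 - \<alpha>))))"
      using integrable_endpoint_powr(1)[of "1 - \<alpha>" s t] assms unfolding set_integrable_def by (intro integrable_mult_right) auto
    show "AE z in lebesgue. norm (indicator {s<..<t} z *\<^sub>R exchange_kernel \<alpha> s y z)
        \<le> norm ((s - y) powr (-\<alpha> - 1) * (indicator {s<..<t} z *\<^sub>R (z - s) powr (- (1 - \<alpha>))))"
      using exchange_kernel_bound(2)[of \<alpha> y s] assms by (auto simp: indicator_def)
  qed measurable
  have "(exchange_kernel \<alpha> s y has_integral (t - s) powr \<alpha> * (s - y) powr -\<alpha> / (t - y) - (s - s) powr \<alpha> * (s - y) powr -\<alpha> / (s - y)) {s..t}"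
  proof (intro fundamental_theorem_of_calculus_interior)
    show "continuous_on {s..t} (\<lambda>z. (z - s) powr \<alpha> * (s - y) powr -\<alpha> / (z - y))"
      using assms by (intro continuous_intros continuous_on_powr') auto
    fix z assume z: "z \<in> {s<..<t}"
    have p: "(z - s) powr \<alpha> = (z - s) powr (\<alpha> - 1) * (z - s)"
      using powr_add[of "z - s" "\<alpha> - 1" 1] z by simp
    have "((\<lambda>z. (z - s) powr \<alpha> * (s - y) powr -\<alpha> / (z - y)) has_real_derivative
      ((\<alpha> * (z - s) powr (\<alpha> - 1) * (s - y) powr -\<alpha>) * (z - y) - (z - s) powr \<alpha> * (s - y) powr -\<alpha>) / (z - y)\<^sup>2) (at z)"
      using z assms by (auto intro!: derivative_eq_intros simp: power2_eq_square)
    also have "((\<alpha> * (z - s) powr (\<alpha> - 1) * (s - y) powr -\<alpha>) * (z - y) - (z - s) powr \<alpha> * (s - y) powr -\<alpha>) / (z - y)\<^sup>2 = exchange_kernel \<alpha> s y z"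
      unfolding exchange_kernel_def p by (simp add: algebra_simps)
    finally show "((\<lambda>z. (z - s) powr \<alpha> * (s - y) powr -\<alpha> / (z - y)) has_vector_derivative exchange_kernel \<alpha> s y z) (at z)"
      by (simp add: has_real_derivative_iff_has_vector_derivative)
  qed (use assms in auto)
  then show "(LINT z:{s<..<t}|lebesgue. exchange_kernel \<alpha> s y z) = exchange_primitive \<alpha> s y t"
    using i assms by (simp add: exchange_primitive_def set_lebesgue_integral_eq_integral has_integral_Icc_iff_Ioo integral_unique)
qed

section \<open>Regular integrands\<close>

lemma integrable_LL_snd:
  fixes f :: "real \<Rightarrow> real \<Rightarrow> real"
  assumes [measurable]: "(\<lambda>(x, y). f x y) \<in> borel_measurable LL"
    and "AE y in lebesgue. integrable lebesgue (\<lambda>x. f x y)"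
    and "AE y in lebesgue. (LINT x|lebesgue. \<bar>f x y\<bar>) \<le> w y" "integrable lebesgue w"
  shows "integrable LL (\<lambda>(x, y). f x y)"
proof -
  have "integrable LL (\<lambda>(y, x). f x y)"
  proof (rule leb.Fubini_integrable)
    show "integrable lebesgue (\<lambda>x. LINT y|lebesgue. norm (case (x, y) of (y, x) \<Rightarrow> f x y))"
    proof (rule Bochner_Integration.integrable_bound[OF assms(4)])
      show "AE x in lebesgue. norm (LINT y|lebesgue. norm (case (x, y) of (y, x) \<Rightarrow> f x y)) \<le> norm (w x)"
        using assms(3) by eventually_elim (auto simp: integral_nonneg_AE)
    qed measurable
  qed (use assms in auto)
  then show ?thesis
    by (subst leb.integrable_product_swap_iff[symmetric]) (simp add: case_prod_unfold)
qed

lemma integrable_LL_fst: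
  fixes f :: "real \<Rightarrow> real \<Rightarrow> real"
  assumes [measurable]: "(\<lambda>(x, y). f x y) \<in> borel_measurable LL"
    and "AE x in lebesgue. integrable lebesgue (\<lambda>y. f x y)"
    and "AE x in lebesgue. (LINT y|lebesgue. \<bar>f x y\<bar>) \<le> w x" "integrable lebesgue w"
  shows "integrable LL (\<lambda>(x, y). f x y)"
proof (rule leb.Fubini_integrable)
  show "integrable lebesgue (\<lambda>x. LINT y|lebesgue. norm (case (x, y) of (x, y) \<Rightarrow> f x y))"
  proof (rule Bochner_Integration.integrable_bound[OF assms(4)])
    show "AE x in lebesgue. norm (LINT y|lebesgue. norm (case (x, y) of (x, y) \<Rightarrow> f x y)) \<le> norm (w x)"
      using assms(3) by eventually_elim (auto simp: integral_nonneg_AE)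
  qed measurable
qed (use assms in auto)

text \<open>
  Membership in \<open>W_0^(\<beta>,1)(a,b)\<close>, with the double integral over the triangle written as an
  integral over the plane.
\<close>

definition frac_regular :: "real \<Rightarrow> real \<Rightarrow> real \<Rightarrow> (real \<Rightarrow> real) \<Rightarrow> bool" where
  "frac_regular \<beta> a b \<phi> \<longleftrightarrow> \<phi> \<in> borel_measurable lebesgue \<and>
     set_integrable lebesgue {a<..<b} (\<lambda>x. \<phi> x * (x - a) powr -\<beta>) \<and>
     integrable LL (\<lambda>(x, y). (\<phi> x - \<phi> y) * tri \<beta> a b x y)"

lemma frac_regular_hardy:
  assumes "0 < \<beta>" "frac_regular \<beta> a b \<phi>"
  shows "set_integrable lebesgue {a<..<b} (\<lambda>x. \<phi> x * (b - x) powr -\<beta>)"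
proof -
  let ?I = "indicator {a<..<b} :: real \<Rightarrow> real"
  have [measurable]: "\<phi> \<in> borel_measurable lebesgue" using assms by (auto simp: frac_regular_def)
  have e: "(\<lambda>(x, y). (?I x * \<phi> x - ?I y * \<phi> y) * tri \<beta> a b x y) = (\<lambda>(x, y). (\<phi> x - \<phi> y) * tri \<beta> a b x y)"
    by (auto simp: fun_eq_iff indicator_def tri_def)
  have "integrable lebesgue (\<lambda>x. (?I x * \<phi> x) * (b - x) powr -\<beta>)"
  proof (rule fractional_hardy[OF assms(1)])
    show "integrable lebesgue (\<lambda>x. ?I x * \<phi> x * (x - a) powr -\<beta>)"
      using assms by (simp add: frac_regular_def set_integrable_def mult.assoc)
    show "integrable LL (\<lambda>(x, y). (?I x * \<phi> x - ?I y * \<phi> y) * tri \<beta> a b x y)"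
      unfolding e using assms by (simp add: frac_regular_def)
  qed auto
  then show ?thesis by (simp add: set_integrable_def mult.assoc)
qed

lemma set_integrable_bounded_mult:
  fixes f k :: "real \<Rightarrow> real"
  assumes "set_integrable lebesgue A f" and [measurable]: "k \<in> borel_measurable lebesgue" "A \<in> sets lebesgue"
    and "\<And>x. x \<in> A \<Longrightarrow> \<bar>k x\<bar> \<le> M"
  shows "set_integrable lebesgue A (\<lambda>x. k x * f x)"
  unfolding set_integrable_def
proof (rule Bochner_Integration.integrable_bound)
  show "integrable lebesgue (\<lambda>x. M * (indicator A x *\<^sub>R f x))"
    using assms(1) by (simp add: set_integrable_def)
  have "(\<lambda>x. indicator A x *\<^sub>R f x) \<in> borel_measurable lebesgue"
    using assms(1) by (auto simp: set_integrable_def)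
  then have "(\<lambda>x. k x * (indicator A x *\<^sub>R f x)) \<in> borel_measurable lebesgue" by measurable
  then show "(\<lambda>x. indicator A x *\<^sub>R (k x * f x)) \<in> borel_measurable lebesgue"
    by (simp add: mult_ac)
  show "AE x in lebesgue. norm (indicator A x *\<^sub>R (k x * f x)) \<le> norm (M * (indicator A x *\<^sub>R f x))"
    using assms(4) by (intro AE_I2) (force simp: indicator_def abs_mult intro!: mult_right_mono)
qed

lemma integrable_tri_bounded_mult:
  fixes f :: "real \<Rightarrow> real \<Rightarrow> real" and k :: "real \<Rightarrow> real \<Rightarrow> real"
  assumes "integrable LL (\<lambda>(x, y). f x y * tri \<beta> a b x y)"
    and "(\<lambda>(x, y). k x y) \<in> borel_measurable LL"
    and "\<And>x y. x \<in> {a<..<b} \<Longrightarrow> y \<in> {a<..<b} \<Longrightarrow> \<bar>k x y\<bar> \<le> M"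
  shows "integrable LL (\<lambda>(x, y). k x y * (f x y * tri \<beta> a b x y))"
proof (rule Bochner_Integration.integrable_bound)
  show "integrable LL (\<lambda>p. M * (case p of (x, y) \<Rightarrow> f x y * tri \<beta> a b x y))"
    using assms(1) by (rule integrable_mult_right)
  have "(\<lambda>p. (case p of (x, y) \<Rightarrow> k x y) * (case p of (x, y) \<Rightarrow> f x y * tri \<beta> a b x y)) \<in> borel_measurable LL"
    using assms(1,2) by (intro borel_measurable_times) auto
  then show "(\<lambda>(x, y). k x y * (f x y * tri \<beta> a b x y)) \<in> borel_measurable LL"
    by (simp add: case_prod_unfold)
  show "AE p in LL. norm (case p of (x, y) \<Rightarrow> k x y * (f x y * tri \<beta> a b x y))
      \<le> norm (M * (case p of (x, y) \<Rightarrow> f x y * tri \<beta> a b x y))"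
  proof (intro AE_I2, clarsimp simp: abs_mult)
    fix x y
    show "\<bar>k x y\<bar> * (\<bar>f x y\<bar> * \<bar>tri \<beta> a b x y\<bar>) \<le> \<bar>M\<bar> * (\<bar>f x y\<bar> * \<bar>tri \<beta> a b x y\<bar>)"
    proof (cases "x \<in> {a<..<b} \<and> y \<in> {a<..<b}")
      case True
      then have "\<bar>k x y\<bar> \<le> \<bar>M\<bar>" using assms(3)[of x y] by auto
      then show ?thesis by (intro mult_right_mono) auto
    qed (use tri_zero in auto)
  qed
qed

text \<open>
  Integration by parts for a regular function against a bounded kernel whose increments have total
  mass at most a multiple of \<open>(b-y)^(-\<beta>)\<close>: the Hardy inequality supplies both the boundary
  weight at \<open>b\<close> and the integrability of the transposed double integral.
\<close>

lemma parts_frac_regular: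
  fixes \<phi> k :: "real \<Rightarrow> real"
  assumes \<beta>: "0 < \<beta>" and \<phi>: "frac_regular \<beta> a b \<phi>" and [measurable]: "k \<in> borel_measurable lebesgue"
    and M: "\<And>x. x \<in> {a<..<b} \<Longrightarrow> \<bar>k x\<bar> \<le> M"
    and i: "\<And>y. y \<in> {a<..<b} \<Longrightarrow> set_integrable lebesgue {y<..<b} (\<lambda>x. (k x - k y) / (x - y) powr (\<beta> + 1))"
    and M': "\<And>y. y \<in> {a<..<b} \<Longrightarrow>
      (LINT x:{y<..<b}|lebesgue. \<bar>k x - k y\<bar> / (x - y) powr (\<beta> + 1)) \<le> M' * (b - y) powr -\<beta>"
  shows "set_integrable lebesgue {a<..<b} (\<lambda>x. k x * frac_left \<beta> a \<phi> x)"
    "set_integrable lebesgue {a<..<b} (\<lambda>x. \<phi> x * frac_right \<beta> b k x)"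
    "(LINT x:{a<..<b}|lebesgue. k x * frac_left \<beta> a \<phi> x) = (LINT x:{a<..<b}|lebesgue. \<phi> x * frac_right \<beta> b k x)"
proof -
  have m[measurable]: "\<phi> \<in> borel_measurable lebesgue"
    and l: "set_integrable lebesgue {a<..<b} (\<lambda>x. \<phi> x * (x - a) powr -\<beta>)"
    and d: "integrable LL (\<lambda>(x, y). (\<phi> x - \<phi> y) * tri \<beta> a b x y)"
    using \<phi> by (auto simp: frac_regular_def)
  note h = frac_regular_hardy[OF \<beta> \<phi>]
  have 1: "set_integrable lebesgue {a<..<b} (\<lambda>x. \<phi> x * k x * (x - a) powr -\<beta>)"
    using set_integrable_bounded_mult[OF l _ _ M] by (simp add: mult_ac)
  have 2: "set_integrable lebesgue {a<..<b} (\<lambda>x. \<phi> x * k x * (b - x) powr -\<beta>)"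
    using set_integrable_bounded_mult[OF h _ _ M] by (simp add: mult_ac)
  have 3: "integrable LL (\<lambda>(x, y). (\<phi> x - \<phi> y) * k x * tri \<beta> a b x y)"
    using integrable_tri_bounded_mult[OF d, of "\<lambda>x y. k x" M] M by (simp add: mult_ac)
  have "integrable LL (\<lambda>(x, y). \<phi> y * (k y - k x) * tri \<beta> a b x y)"
  proof (rule integrable_LL_snd)
    have e: "(k x - k y) * tri \<beta> a b x y = indicator {y<..<b} x *\<^sub>R ((k x - k y) / (x - y) powr (\<beta> + 1))" if "y \<in> {a<..<b}" for x y
      using that by (auto simp: tri_def indicator_def)
    have e': "\<bar>k x - k y\<bar> * tri \<beta> a b x y = indicator {y<..<b} x *\<^sub>R (\<bar>k x - k y\<bar> / (x - y) powr (\<beta> + 1))" if "y \<in> {a<..<b}" for x y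
      using that by (auto simp: tri_def indicator_def)
    have i': "integrable lebesgue (\<lambda>x. (k x - k y) * tri \<beta> a b x y)" for y
      using i[of y] by (cases "y \<in> {a<..<b}") (simp_all add: e set_integrable_def tri_zero)
    have "integrable lebesgue (\<lambda>x. - \<phi> y * ((k x - k y) * tri \<beta> a b x y))" for y
      using i'[of y] by (rule integrable_mult_right)
    moreover have "- \<phi> y * ((k x - k y) * tri \<beta> a b x y) = \<phi> y * (k y - k x) * tri \<beta> a b x y" for x y
      by (simp add: algebra_simps)
    ultimately show "AE y in lebesgue. integrable lebesgue (\<lambda>x. \<phi> y * (k y - k x) * tri \<beta> a b x y)"
      by (simp only: AE_I2)
    show "integrable lebesgue (\<lambda>y. M' * \<bar>indicator {a<..<b} y *\<^sub>R (\<phi> y * (b - y) powr -\<beta>)\<bar>)"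
      using h by (intro integrable_mult_right integrable_abs) (simp add: set_integrable_def)
    have "(LINT x|lebesgue. \<bar>\<phi> y * (k y - k x) * tri \<beta> a b x y\<bar>) \<le> M' * \<bar>indicator {a<..<b} y *\<^sub>R (\<phi> y * (b - y) powr -\<beta>)\<bar>" for y
    proof (cases "y \<in> {a<..<b}")
      case True
      have "(LINT x|lebesgue. \<bar>\<phi> y * (k y - k x) * tri \<beta> a b x y\<bar>) = (LINT x|lebesgue. \<bar>\<phi> y\<bar> * (\<bar>k x - k y\<bar> * tri \<beta> a b x y))"
        by (simp add: abs_mult tri_nonneg abs_minus_commute mult_ac)
      also have "\<dots> = \<bar>\<phi> y\<bar> * (LINT x:{y<..<b}|lebesgue. \<bar>k x - k y\<bar> / (x - y) powr (\<beta> + 1))"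
        unfolding set_lebesgue_integral_def e'[OF True] by (rule integral_mult_right_zero)
      also have "\<dots> \<le> \<bar>\<phi> y\<bar> * (M' * (b - y) powr -\<beta>)"
        using M'[OF True] by (intro mult_left_mono) auto
      finally show ?thesis using True by (simp add: abs_mult mult_ac)
    qed (simp add: tri_zero)
    then show "AE y in lebesgue. (LINT x|lebesgue. \<bar>\<phi> y * (k y - k x) * tri \<beta> a b x y\<bar>) \<le> M' * \<bar>indicator {a<..<b} y *\<^sub>R (\<phi> y * (b - y) powr -\<beta>)\<bar>"
      by simp
  qed measurable
  note F = fractional_integration_by_parts[OF \<beta> _ _ 1 2 3 this]
  show "set_integrable lebesgue {a<..<b} (\<lambda>x. k x * frac_left \<beta> a \<phi> x)"
    "set_integrable lebesgue {a<..<b} (\<lambda>x. \<phi> x * frac_right \<beta> b k x)"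
    "(LINT x:{a<..<b}|lebesgue. k x * frac_left \<beta> a \<phi> x) = (LINT x:{a<..<b}|lebesgue. \<phi> x * frac_right \<beta> b k x)"
    by (rule F; measurable)+
qed

text \<open>
  The reverse distribution of roles: here \<open>\<eta>\<close> is bounded with integrable increments, as an
  integrator is, and the kernel \<open>k\<close> is the function whose left derivative appears.
\<close>

lemma parts_bounded_increments:
  fixes \<eta> k :: "real \<Rightarrow> real"
  assumes \<beta>: "0 < \<beta>" and [measurable]: "\<eta> \<in> borel_measurable lebesgue" "k \<in> borel_measurable lebesgue"
    and l: "set_integrable lebesgue {a<..<b} (\<lambda>x. (x - a) powr -\<beta>)"
    and r: "set_integrable lebesgue {a<..<b} (\<lambda>x. (b - x) powr -\<beta>)"
    and \<eta>: "integrable LL (\<lambda>(x, y). (\<eta> y - \<eta> x) * tri \<beta> a b x y)"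
    and C: "\<And>x. x \<in> {a<..<b} \<Longrightarrow> \<bar>\<eta> x\<bar> \<le> C"
    and M: "\<And>x. x \<in> {a<..<b} \<Longrightarrow> \<bar>k x\<bar> \<le> M"
    and i: "\<And>x. x \<in> {a<..<b} \<Longrightarrow> set_integrable lebesgue {a<..<x} (\<lambda>y. (k y - k x) / (x - y) powr (\<beta> + 1))"
    and M': "\<And>x. x \<in> {a<..<b} \<Longrightarrow>
      (LINT y:{a<..<x}|lebesgue. \<bar>k y - k x\<bar> / (x - y) powr (\<beta> + 1)) \<le> M' * (x - a) powr -\<beta>"
  shows "set_integrable lebesgue {a<..<b} (\<lambda>x. \<eta> x * frac_left \<beta> a k x)"
    "(LINT x:{a<..<b}|lebesgue. \<eta> x * frac_left \<beta> a k x) = (LINT x:{a<..<b}|lebesgue. k x * frac_right \<beta> b \<eta> x)"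
proof -
  have kb: "\<bar>k x * \<eta> x\<bar> \<le> M * C" if "x \<in> {a<..<b}" for x
    using M[OF that] C[OF that] by (auto simp: abs_mult intro!: mult_mono)
  have 1: "set_integrable lebesgue {a<..<b} (\<lambda>x. k x * \<eta> x * (x - a) powr -\<beta>)"
    by (rule set_integrable_bounded_mult[OF l _ _ kb]) auto
  have 2: "set_integrable lebesgue {a<..<b} (\<lambda>x. k x * \<eta> x * (b - x) powr -\<beta>)"
    by (rule set_integrable_bounded_mult[OF r _ _ kb]) auto
  have 4: "integrable LL (\<lambda>(x, y). k y * (\<eta> y - \<eta> x) * tri \<beta> a b x y)"
    using integrable_tri_bounded_mult[OF \<eta>, of "\<lambda>x y. k y" M] M by (simp add: mult_ac)
  have 3: "integrable LL (\<lambda>(x, y). (k x - k y) * \<eta> x * tri \<beta> a b x y)"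
  proof (rule integrable_LL_fst)
    have e: "(k y - k x) * tri \<beta> a b x y = indicator {a<..<x} y *\<^sub>R ((k y - k x) / (x - y) powr (\<beta> + 1))" if "x \<in> {a<..<b}" for x y
      using that by (auto simp: tri_def indicator_def)
    have e': "\<bar>k y - k x\<bar> * tri \<beta> a b x y = indicator {a<..<x} y *\<^sub>R (\<bar>k y - k x\<bar> / (x - y) powr (\<beta> + 1))" if "x \<in> {a<..<b}" for x y
      using that by (auto simp: tri_def indicator_def)
    have i': "integrable lebesgue (\<lambda>y. (k y - k x) * tri \<beta> a b x y)" for x
      using i[of x] by (cases "x \<in> {a<..<b}") (simp_all add: e set_integrable_def tri_zero)
    have "integrable lebesgue (\<lambda>y. - \<eta> x * ((k y - k x) * tri \<beta> a b x y))" for x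
      using i'[of x] by (rule integrable_mult_right)
    moreover have "- \<eta> x * ((k y - k x) * tri \<beta> a b x y) = (k x - k y) * \<eta> x * tri \<beta> a b x y" for x y
      by (simp add: algebra_simps)
    ultimately show "AE x in lebesgue. integrable lebesgue (\<lambda>y. (k x - k y) * \<eta> x * tri \<beta> a b x y)"
      by (simp only: AE_I2)
    show "integrable lebesgue (\<lambda>x. C * M' * (indicator {a<..<b} x *\<^sub>R (x - a) powr -\<beta>))"
      using l by (intro integrable_mult_right) (simp add: set_integrable_def)
    have "(LINT y|lebesgue. \<bar>(k x - k y) * \<eta> x * tri \<beta> a b x y\<bar>) \<le> C * M' * (indicator {a<..<b} x *\<^sub>R (x - a) powr -\<beta>)" for x
    proof (cases "x \<in> {a<..<b}")
      case True
      have "(LINT y|lebesgue. \<bar>(k x - k y) * \<eta> x * tri \<beta> a b x y\<bar>) = (LINT y|lebesgue. \<bar>\<eta> x\<bar> * (\<bar>k y - k x\<bar> * tri \<beta> a b x y))"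
        by (simp add: abs_mult tri_nonneg abs_minus_commute mult_ac)
      also have "\<dots> = \<bar>\<eta> x\<bar> * (LINT y:{a<..<x}|lebesgue. \<bar>k y - k x\<bar> / (x - y) powr (\<beta> + 1))"
        unfolding set_lebesgue_integral_def e'[OF True] by (rule integral_mult_right_zero)
      also have "\<dots> \<le> C * (M' * (x - a) powr -\<beta>)"
      proof (rule mult_mono)
        show "0 \<le> C" using C[OF True] by linarith
        show "0 \<le> (LINT y:{a<..<x}|lebesgue. \<bar>k y - k x\<bar> / (x - y) powr (\<beta> + 1))"
          by (simp add: set_lebesgue_integral_def)
      qed (use C[OF True] M'[OF True] in auto)
      finally show ?thesis using True by (simp add: abs_mult mult_ac)
    qed (simp add: tri_zero)
    then show "AE x in lebesgue. (LINT y|lebesgue. \<bar>(k x - k y) * \<eta> x * tri \<beta> a b x y\<bar>) \<le> C * M' * (indicator {a<..<b} x *\<^sub>R (x - a) powr -\<beta>)"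
      by simp
  qed measurable
  note F = fractional_integration_by_parts[OF \<beta> _ _ 1 2 3 4]
  show "set_integrable lebesgue {a<..<b} (\<lambda>x. \<eta> x * frac_left \<beta> a k x)"
    "(LINT x:{a<..<b}|lebesgue. \<eta> x * frac_left \<beta> a k x) = (LINT x:{a<..<b}|lebesgue. k x * frac_right \<beta> b \<eta> x)"
    by (rule F; measurable)+
qed

lemma Fubini_set:
  fixes f :: "real \<Rightarrow> real \<Rightarrow> real"
  assumes i: "integrable LL (\<lambda>(x, z). indicator A x * (indicator B z * f x z))"
  shows "set_integrable lebesgue A (\<lambda>x. LINT z:B|lebesgue. f x z)"
    "set_integrable lebesgue B (\<lambda>z. LINT x:A|lebesgue. f x z)"
    "(LINT x:A|lebesgue. LINT z:B|lebesgue. f x z) = (LINT z:B|lebesgue. LINT x:A|lebesgue. f x z)"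
proof -
  have 1: "(LINT z|lebesgue. indicator A x * (indicator B z * f x z)) = indicator A x *\<^sub>R (LINT z:B|lebesgue. f x z)" for x
    by (simp add: set_lebesgue_integral_def)
  have 2: "(LINT x|lebesgue. indicator A x * (indicator B z * f x z)) = indicator B z *\<^sub>R (LINT x:A|lebesgue. f x z)" for z
  proof -
    have "indicator A x * (indicator B z * f x z) = indicator B z * (indicator A x * f x z)" for x
      by simp
    then show ?thesis by (simp only: set_lebesgue_integral_def real_scaleR_def integral_mult_right_zero)
  qed
  show "set_integrable lebesgue A (\<lambda>x. LINT z:B|lebesgue. f x z)"
    using leb.integrable_fst[OF i] unfolding 1 by (simp add: set_integrable_def)
  show "set_integrable lebesgue B (\<lambda>z. LINT x:A|lebesgue. f x z)"
    using leb.integrable_snd[OF i] unfolding 2 by (simp add: set_integrable_def)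
  show "(LINT x:A|lebesgue. LINT z:B|lebesgue. f x z) = (LINT z:B|lebesgue. LINT x:A|lebesgue. f x z)"
    using leb.Fubini_integral[OF i] unfolding 1 2 by (simp add: set_lebesgue_integral_def)
qed

lemma integrable_product_bound:
  fixes f :: "real \<Rightarrow> real \<Rightarrow> real"
  assumes u: "set_integrable lebesgue A u" and v: "set_integrable lebesgue B v"
    and m: "(\<lambda>(x, z). indicator A x * (indicator B z * f x z)) \<in> borel_measurable LL"
    and b: "\<And>x z. x \<in> A \<Longrightarrow> z \<in> B \<Longrightarrow> \<bar>f x z\<bar> \<le> \<bar>u x\<bar> * \<bar>v z\<bar>"
  shows "integrable LL (\<lambda>(x, z). indicator A x * (indicator B z * f x z))"
proof (rule Bochner_Integration.integrable_bound)
  show "integrable LL (\<lambda>(x, z). (indicator A x *\<^sub>R u x) * (indicator B z *\<^sub>R v z))"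
    using u v by (intro integrable_tensor) (auto simp: set_integrable_def)
  show "AE p in LL. norm (case p of (x, z) \<Rightarrow> indicator A x * (indicator B z * f x z))
     \<le> norm (case p of (x, z) \<Rightarrow> (indicator A x *\<^sub>R u x) * (indicator B z *\<^sub>R v z))"
    using b by (intro AE_I2) (auto simp: indicator_def abs_mult)
qed fact

lemma set_integrable_mult_bounded_on:
  fixes f k :: "real \<Rightarrow> real"
  assumes "set_integrable lebesgue A f" and "(\<lambda>x. indicator A x * k x) \<in> borel_measurable lebesgue"
    and A: "A \<in> sets lebesgue" and "\<And>x. x \<in> A \<Longrightarrow> \<bar>k x\<bar> \<le> M"
  shows "set_integrable lebesgue A (\<lambda>x. f x * k x)"
proof -
  have "set_integrable lebesgue A (\<lambda>x. (indicator A x * k x) * f x)"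
    using assms by (intro set_integrable_bounded_mult[where M = M]) auto
  moreover have "(\<lambda>x. indicator A x *\<^sub>R ((indicator A x * k x) * f x)) = (\<lambda>x. indicator A x *\<^sub>R (f x * k x))"
    by (auto simp: indicator_def)
  ultimately show ?thesis by (simp add: set_integrable_def)
qed

lemma frac_regular_mono:
  assumes "frac_regular \<beta> a b \<phi>" "c \<le> b"
  shows "frac_regular \<beta> a c \<phi>"
  unfolding frac_regular_def
proof (intro conjI)
  have r[measurable]: "\<phi> \<in> borel_measurable lebesgue"
    "set_integrable lebesgue {a<..<b} (\<lambda>x. \<phi> x * (x - a) powr -\<beta>)"
    "integrable LL (\<lambda>(x, y). (\<phi> x - \<phi> y) * tri \<beta> a b x y)"
    using assms by (auto simp: frac_regular_def)
  show "\<phi> \<in> borel_measurable lebesgue" by fact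
  show "set_integrable lebesgue {a<..<c} (\<lambda>x. \<phi> x * (x - a) powr -\<beta>)"
    using assms(2) by (intro set_integrable_subset[OF r(2)]) auto
  show "integrable LL (\<lambda>(x, y). (\<phi> x - \<phi> y) * tri \<beta> a c x y)"
  proof (rule Bochner_Integration.integrable_bound[OF r(3)])
    have "tri \<beta> a c x y \<le> tri \<beta> a b x y" for x y
      using assms(2) by (auto simp: tri_def)
    then show "AE p in LL. norm (case p of (x, y) \<Rightarrow> (\<phi> x - \<phi> y) * tri \<beta> a c x y)
      \<le> norm (case p of (x, y) \<Rightarrow> (\<phi> x - \<phi> y) * tri \<beta> a b x y)"
      by (intro AE_I2) (auto simp: abs_mult tri_nonneg intro!: mult_left_mono)
  qed measurable
qed

lemma frac_regular_frac_left:
  assumes "0 < \<beta>" "frac_regular \<beta> a b \<phi>"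
  shows "set_integrable lebesgue {a<..<b} (frac_left \<beta> a \<phi>)"
  using parts_frac_regular(1)[OF assms, of "\<lambda>_. 1" 1 0] by (simp add: set_integrable_def set_lebesgue_integral_def)

lemma measurable_frac_right:
  assumes [measurable]: "f \<in> borel_measurable lebesgue"
  shows "(\<lambda>x. indicator {a<..<b} x * frac_right \<beta> b f x) \<in> borel_measurable lebesgue"
proof -
  have "(\<lambda>x. indicator {a<..<b} x * frac_right \<beta> b f x)
     = (\<lambda>y. indicator {a<..<b} y * (f y * (b - y) powr -\<beta> + \<beta> * (LINT x|lebesgue. (f y - f x) * tri \<beta> a b x y)))"
    by (auto simp: fun_eq_iff indicator_def frac_right_tri)
  also have "\<dots> \<in> borel_measurable lebesgue" by measurable
  finally show ?thesis .
qed

lemma AE_lebesgue_neq: "AE x in lebesgue. x \<noteq> (c::real)"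
  by (rule AE_I'[of "{c}"]) auto

lemma set_integral_split_at:
  fixes f :: "real \<Rightarrow> real"
  assumes "a \<le> s" "s \<le> b" "set_integrable lebesgue {a<..<b} f"
  shows "(LINT x:{a<..<b}|lebesgue. f x) = (LINT x:{a<..<s}|lebesgue. f x) + (LINT x:{s<..<b}|lebesgue. f x)"
proof -
  have i: "set_integrable lebesgue {a<..<s} f" "set_integrable lebesgue {s<..<b} f"
    using assms by (auto intro!: set_integrable_subset[OF assms(3)])
  have "(LINT x:{a<..<b}|lebesgue. f x) = (LINT x|lebesgue. indicator {a<..<s} x *\<^sub>R f x + indicator {s<..<b} x *\<^sub>R f x)"
    unfolding set_lebesgue_integral_def
  proof (rule integral_cong_AE)
    show "AE x in lebesgue. indicator {a<..<b} x *\<^sub>R f x = indicator {a<..<s} x *\<^sub>R f x + indicator {s<..<b} x *\<^sub>R f x"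
      using AE_lebesgue_neq[of s] by eventually_elim (use assms in \<open>auto simp: indicator_def\<close>)
  qed (use assms(3) i in \<open>auto simp: set_integrable_def intro!: borel_measurable_add\<close>)
  then show ?thesis using i by (simp add: set_lebesgue_integral_def set_integrable_def)
qed

text \<open>
  Moving the base point from \<open>a\<close> to \<open>s\<close> drops the part of the increment integral over \<open>(a,s)\<close>;
  there the constant \<open>\<phi>(x)\<close> integrates exactly to the difference of the two boundary weights. The
  identity holds wherever the inner integral converges, hence almost everywhere.
\<close>

lemma frac_left_change_base:
  assumes \<alpha>: "0 < \<alpha>" and reg: "frac_regular \<alpha> a t \<phi>" and s: "a \<le> s" "s < t"
  shows "AE x in lebesgue. x \<in> {s<..<t} \<longrightarrow>
     frac_left \<alpha> s \<phi> x = frac_left \<alpha> a \<phi> x + \<alpha> * (LINT y:{a<..<s}|lebesgue. \<phi> y / (x - y) powr (\<alpha> + 1))"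
proof -
  have "integrable LL (\<lambda>(x, y). (\<phi> x - \<phi> y) * tri \<alpha> a t x y)"
    using reg by (simp add: frac_regular_def)
  from leb.AE_integrable_fst[OF this] show ?thesis
  proof eventually_elim
    fix x assume i: "integrable lebesgue (\<lambda>y. (\<phi> x - \<phi> y) * tri \<alpha> a t x y)"
    show "x \<in> {s<..<t} \<longrightarrow>
     frac_left \<alpha> s \<phi> x = frac_left \<alpha> a \<phi> x + \<alpha> * (LINT y:{a<..<s}|lebesgue. \<phi> y / (x - y) powr (\<alpha> + 1))"
    proof
      assume x: "x \<in> {s<..<t}"
      have "(\<phi> x - \<phi> y) * tri \<alpha> a t x y = indicator {a<..<x} y *\<^sub>R ((\<phi> x - \<phi> y) / (x - y) powr (\<alpha> + 1))" for y
        using x s by (auto simp: tri_def indicator_def)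
      then have D: "set_integrable lebesgue {a<..<x} (\<lambda>y. (\<phi> x - \<phi> y) / (x - y) powr (\<alpha> + 1))"
        using i by (simp add: set_integrable_def)
      then have D': "set_integrable lebesgue {a<..<s} (\<lambda>y. (\<phi> x - \<phi> y) / (x - y) powr (\<alpha> + 1))"
        by (rule set_integrable_subset) (use x in auto)
      have K: "set_integrable lebesgue {a<..<s} (\<lambda>y. \<phi> x * (1 / (x - y) powr (\<alpha> + 1)))"
        "(LINT y:{a<..<s}|lebesgue. \<phi> x * (1 / (x - y) powr (\<alpha> + 1))) = \<phi> x * (((x - s) powr -\<alpha> - (x - a) powr -\<alpha>) / \<alpha>)"
        using integral_power_kernel_left[of \<alpha> a s x] \<alpha> s x by (auto simp del: times_divide_eq_right)
      have "(LINT y:{a<..<s}|lebesgue. \<phi> y / (x - y) powr (\<alpha> + 1))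
        = (LINT y:{a<..<s}|lebesgue. \<phi> x * (1 / (x - y) powr (\<alpha> + 1)) - (\<phi> x - \<phi> y) / (x - y) powr (\<alpha> + 1))"
        by (simp add: diff_divide_distrib)
      also have "\<dots> = \<phi> x * (((x - s) powr -\<alpha> - (x - a) powr -\<alpha>) / \<alpha>) - (LINT y:{a<..<s}|lebesgue. (\<phi> x - \<phi> y) / (x - y) powr (\<alpha> + 1))"
        unfolding set_integral_diff(2)[OF K(1) D'] K(2) ..
      finally have P: "\<alpha> * (LINT y:{a<..<s}|lebesgue. \<phi> y / (x - y) powr (\<alpha> + 1)) = \<phi> x * ((x - s) powr -\<alpha> - (x - a) powr -\<alpha>)
         - \<alpha> * (LINT y:{a<..<s}|lebesgue. (\<phi> x - \<phi> y) / (x - y) powr (\<alpha> + 1))"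
        using \<alpha> by (simp add: field_simps)
      show "frac_left \<alpha> s \<phi> x = frac_left \<alpha> a \<phi> x + \<alpha> * (LINT y:{a<..<s}|lebesgue. \<phi> y / (x - y) powr (\<alpha> + 1))"
        unfolding P frac_left_def using x s by (subst set_integral_split_at[OF _ _ D, of s]) (auto simp: algebra_simps)
    qed
  qed
qed

section \<open>Additivity of the integral\<close>

text \<open>
  An integrator on \<open>(0,t]\<close>: the norm of \<open>W_T^(1-\<alpha>,\<infinity>)\<close> bounds its increments and their singular
  integrals. The end point \<open>t\<close> is included, so \<open>h t\<close> stands for the left limit that the right
  Weyl derivative refers to.
\<close>

locale frac_integrator =
  fixes \<alpha> t C :: real and h :: "real \<Rightarrow> real"
  assumes \<alpha>: "0 < \<alpha>" "\<alpha> < 1" and C: "0 \<le> C"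
    and measurable_h [measurable]: "h \<in> borel_measurable lebesgue"
    and holder: "\<And>x y. 0 < x \<Longrightarrow> x < y \<Longrightarrow> y \<le> t \<Longrightarrow> \<bar>h y - h x\<bar> \<le> C * (y - x) powr (1 - \<alpha>)"
    and singular: "\<And>x y. 0 < x \<Longrightarrow> x < y \<Longrightarrow> y \<le> t \<Longrightarrow>
      (\<integral>\<^sup>+ z\<in>{x<..<y}. ennreal (\<bar>h z - h x\<bar> / (z - x) powr (2 - \<alpha>)) \<partial>lebesgue) \<le> ennreal C"
begin

definition rho :: "real \<Rightarrow> real \<Rightarrow> real" where
  "rho y x = frac_right (1 - \<alpha>) y (\<lambda>z. h z - h y) x"

lemma singular_integrable:
  assumes "0 < x" "x < y" "y \<le> t"
  shows "set_integrable lebesgue {x<..<y} (\<lambda>z. (h z - h x) / (z - x) powr (2 - \<alpha>))"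
    "(LINT z:{x<..<y}|lebesgue. \<bar>h z - h x\<bar> / (z - x) powr (2 - \<alpha>)) \<le> C"
proof -
  have e: "(\<integral>\<^sup>+z. ennreal (norm (indicator {x<..<y} z *\<^sub>R ((h z - h x) / (z - x) powr (2 - \<alpha>)))) \<partial>lebesgue)
    = (\<integral>\<^sup>+ z\<in>{x<..<y}. ennreal (\<bar>h z - h x\<bar> / (z - x) powr (2 - \<alpha>)) \<partial>lebesgue)"
    by (intro nn_integral_cong) (auto simp: indicator_def)
  show i: "set_integrable lebesgue {x<..<y} (\<lambda>z. (h z - h x) / (z - x) powr (2 - \<alpha>))"
    unfolding set_integrable_def
  proof (rule integrableI_bounded)
    show "(\<integral>\<^sup>+z. ennreal (norm (indicator {x<..<y} z *\<^sub>R ((h z - h x) / (z - x) powr (2 - \<alpha>)))) \<partial>lebesgue) < \<infinity>"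
      unfolding e using singular[OF assms] by (rule le_less_trans) simp
  qed measurable
  have "ennreal (LINT z|lebesgue. norm (indicator {x<..<y} z *\<^sub>R ((h z - h x) / (z - x) powr (2 - \<alpha>)))) \<le> ennreal C"
    using singular[OF assms] e nn_integral_eq_integral[OF integrable_norm[OF i[unfolded set_integrable_def]]] by simp
  then have "(LINT z|lebesgue. norm (indicator {x<..<y} z *\<^sub>R ((h z - h x) / (z - x) powr (2 - \<alpha>)))) \<le> C"
    using C by (simp add: ennreal_le_iff)
  also have "(\<lambda>z. norm (indicator {x<..<y} z *\<^sub>R ((h z - h x) / (z - x) powr (2 - \<alpha>))))
     = (\<lambda>z. indicator {x<..<y} z *\<^sub>R (\<bar>h z - h x\<bar> / (z - x) powr (2 - \<alpha>)))"
    by (auto simp: indicator_def)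
  finally show "(LINT z:{x<..<y}|lebesgue. \<bar>h z - h x\<bar> / (z - x) powr (2 - \<alpha>)) \<le> C"
    by (simp add: set_lebesgue_integral_def)
qed

lemma rho_eq:
  assumes "x < y"
  shows "rho y x = (h x - h y) / (y - x) powr (1 - \<alpha>)
    + (1 - \<alpha>) * (LINT z:{x<..<y}|lebesgue. (h x - h z) / (z - x) powr (2 - \<alpha>))"
proof -
  have "1 - \<alpha> + 1 = 2 - \<alpha>" by simp
  moreover have "(y - x) powr - (1 - \<alpha>) = 1 / (y - x) powr (1 - \<alpha>)"
    by (rule powr_minus_divide)
  ultimately show ?thesis unfolding rho_def frac_right_def by simp
qed

lemma rho_bound:
  assumes "0 < x" "x < y" "y \<le> t"
  shows "\<bar>rho y x\<bar> \<le> 2 * C"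
proof -
  have "\<bar>h x - h y\<bar> / (y - x) powr (1 - \<alpha>) \<le> C"
    using holder[OF assms] assms by (simp add: abs_minus_commute divide_le_eq)
  moreover have "\<bar>LINT z:{x<..<y}|lebesgue. (h x - h z) / (z - x) powr (2 - \<alpha>)\<bar> \<le> C"
  proof -
    have "\<bar>LINT z:{x<..<y}|lebesgue. (h x - h z) / (z - x) powr (2 - \<alpha>)\<bar>
      \<le> (LINT z|lebesgue. norm (indicator {x<..<y} z *\<^sub>R ((h x - h z) / (z - x) powr (2 - \<alpha>))))"
      unfolding set_lebesgue_integral_def using integral_norm_bound[of lebesgue "\<lambda>z. indicator {x<..<y} z *\<^sub>R ((h x - h z) / (z - x) powr (2 - \<alpha>))"] by simp
    also have "(\<lambda>z. norm (indicator {x<..<y} z *\<^sub>R ((h x - h z) / (z - x) powr (2 - \<alpha>))))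
      = (\<lambda>z. indicator {x<..<y} z *\<^sub>R (\<bar>h z - h x\<bar> / (z - x) powr (2 - \<alpha>)))"
      by (auto simp: indicator_def abs_minus_commute)
    finally show ?thesis using singular_integrable(2)[OF assms] by (simp add: set_lebesgue_integral_def)
  qed
  then have "(1 - \<alpha>) * \<bar>LINT z:{x<..<y}|lebesgue. (h x - h z) / (z - x) powr (2 - \<alpha>)\<bar> \<le> 1 * C"
    using \<alpha> by (intro mult_mono) auto
  ultimately have "\<bar>h x - h y\<bar> / (y - x) powr (1 - \<alpha>)
    + (1 - \<alpha>) * \<bar>LINT z:{x<..<y}|lebesgue. (h x - h z) / (z - x) powr (2 - \<alpha>)\<bar> \<le> 2 * C"
    by linarith
  then show ?thesis unfolding rho_eq[OF assms(2)] using \<alpha>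
    by (intro order_trans[OF abs_triangle_ineq]) (simp add: abs_mult)
qed

lemma measurable_rho: "(\<lambda>x. indicator {a<..<y} x * rho y x) \<in> borel_measurable lebesgue"
  unfolding rho_def by (rule measurable_frac_right) measurable

lemma integrable_increments:
  assumes "0 \<le> a" "b \<le> t"
  shows "integrable LL (\<lambda>(x, y). (h y - h x) * tri (1 - \<alpha>) a b x y)"
proof (rule integrable_LL_snd)
  have p: "1 - \<alpha> + 1 = 2 - \<alpha>" by simp
  have e: "(h y - h x) * tri (1 - \<alpha>) a b x y = - (indicator {y<..<b} x *\<^sub>R ((h x - h y) / (x - y) powr (2 - \<alpha>)))" if "y \<in> {a<..<b}" for x y
  proof -
    have "(h y - h x) / q = - ((h x - h y) / q)" for q by (simp only: minus_divide_left minus_diff_eq)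
    then show ?thesis using that unfolding tri_def p by (auto simp: indicator_def)
  qed
  have e': "\<bar>(h y - h x) * tri (1 - \<alpha>) a b x y\<bar> = indicator {y<..<b} x *\<^sub>R (\<bar>h x - h y\<bar> / (x - y) powr (2 - \<alpha>))" if "y \<in> {a<..<b}" for x y
    using that unfolding tri_def p by (auto simp: indicator_def)
  have "integrable lebesgue (\<lambda>x. (h y - h x) * tri (1 - \<alpha>) a b x y)" for y
  proof (cases "y \<in> {a<..<b}")
    case True
    then show ?thesis using singular_integrable(1)[of y b] assms unfolding e[OF True] by (simp add: set_integrable_def)
  qed (simp add: tri_zero)
  then show "AE y in lebesgue. integrable lebesgue (\<lambda>x. (h y - h x) * tri (1 - \<alpha>) a b x y)" by simp
  have "(LINT x|lebesgue. \<bar>(h y - h x) * tri (1 - \<alpha>) a b x y\<bar>) \<le> indicator {a<..<b} y * C" for y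
  proof (cases "y \<in> {a<..<b}")
    case True
    then show ?thesis using singular_integrable(2)[of y b] assms unfolding e'[OF True] by (simp add: set_lebesgue_integral_def)
  qed (simp add: tri_zero)
  then show "AE y in lebesgue. (LINT x|lebesgue. \<bar>(h y - h x) * tri (1 - \<alpha>) a b x y\<bar>) \<le> indicator {a<..<b} y * C" by simp
  show "integrable lebesgue (\<lambda>y. indicator {a<..<b} y * C)"
    using lmeasurable_box[of a b] by (intro integrable_mult_left) (simp add: lmeasurable_iff_integrable)
qed measurable

text \<open>
  Splitting the increment integral of \<open>\<rho>_t\<close> at \<open>s\<close> leaves \<open>h(x) - h(z)\<close> on \<open>(s,t)\<close>; replacing
  \<open>h(x)\<close> by \<open>h(s)\<close> there changes the boundary terms only, because the power has an explicit integral.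
\<close>

lemma rho_difference:
  assumes "0 < x" "x < s" "s < t"
  shows "rho s x - rho t x = (h t - h s) * (t - x) powr (\<alpha> - 1)
    + (1 - \<alpha>) * (LINT z:{s<..<t}|lebesgue. (h z - h s) * (z - x) powr (\<alpha> - 2))"
proof -
  have p: "1 - \<alpha> + 1 = 2 - \<alpha>" by simp
  have D: "set_integrable lebesgue {x<..<t} (\<lambda>z. (h x - h z) / (z - x) powr (2 - \<alpha>))"
  proof -
    have "set_integrable lebesgue {x<..<t} (\<lambda>z. - ((h z - h x) / (z - x) powr (2 - \<alpha>)))"
      using singular_integrable(1)[of x t] assms by (simp add: set_integrable_def)
    then show ?thesis by (simp only: minus_divide_left minus_diff_eq)
  qed
  then have D': "set_integrable lebesgue {s<..<t} (\<lambda>z. (h x - h z) / (z - x) powr (2 - \<alpha>))"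
    by (rule set_integrable_subset) (use assms in auto)
  have K: "set_integrable lebesgue {s<..<t} (\<lambda>z. (h x - h s) * (1 / (z - x) powr (2 - \<alpha>)))"
    "(LINT z:{s<..<t}|lebesgue. (h x - h s) * (1 / (z - x) powr (2 - \<alpha>)))
      = (h x - h s) * (((s - x) powr (\<alpha> - 1) - (t - x) powr (\<alpha> - 1)) / (1 - \<alpha>))"
    using integral_power_kernel_right[of "1 - \<alpha>" s t x, unfolded p] \<alpha> assms by (auto simp del: times_divide_eq_right)
  have "(z - x) powr (\<alpha> - 2) = 1 / (z - x) powr (2 - \<alpha>)" for z
    using powr_minus_divide[of "z - x" "2 - \<alpha>"] by simp
  then have e: "(h z - h s) * (z - x) powr (\<alpha> - 2) = (h x - h s) * (1 / (z - x) powr (2 - \<alpha>)) - (h x - h z) / (z - x) powr (2 - \<alpha>)" for z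
    by (simp add: diff_divide_distrib[symmetric])
  have "(1 - \<alpha>) * (LINT z:{s<..<t}|lebesgue. (h z - h s) * (z - x) powr (\<alpha> - 2))
      = (h x - h s) * ((s - x) powr (\<alpha> - 1) - (t - x) powr (\<alpha> - 1))
        - (1 - \<alpha>) * (LINT z:{s<..<t}|lebesgue. (h x - h z) / (z - x) powr (2 - \<alpha>))"
    unfolding e set_integral_diff(2)[OF K(1) D'] K(2) using \<alpha> by (simp add: field_simps)
  moreover have "rho s x = (h x - h s) * (s - x) powr (\<alpha> - 1) + (1 - \<alpha>) * (LINT z:{x<..<s}|lebesgue. (h x - h z) / (z - x) powr (2 - \<alpha>))"
    using powr_minus_divide[of "s - x" "1 - \<alpha>"] assms by (simp add: rho_eq)
  moreover have "rho t x = (h x - h t) * (t - x) powr (\<alpha> - 1) + (1 - \<alpha>) * (LINT z:{x<..<t}|lebesgue. (h x - h z) / (z - x) powr (2 - \<alpha>))"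
    using powr_minus_divide[of "t - x" "1 - \<alpha>"] assms by (simp add: rho_eq)
  moreover have "(LINT z:{x<..<t}|lebesgue. (h x - h z) / (z - x) powr (2 - \<alpha>)) =
     (LINT z:{x<..<s}|lebesgue. (h x - h z) / (z - x) powr (2 - \<alpha>)) + (LINT z:{s<..<t}|lebesgue. (h x - h z) / (z - x) powr (2 - \<alpha>))"
    using D assms by (intro set_integral_split_at) auto
  ultimately show ?thesis by (simp add: algebra_simps)
qed

text \<open>
  Integration by parts moves the right derivative of order \<open>1 - \<alpha>\<close> from \<open>h\<close> onto the power
  \<open>(x-y)^(-\<alpha>-1)\<close>. The result involves \<open>h - h(t)\<close>; passing to \<open>h - h(s)\<close> costs the integral of the
  exchange kernel, which is its primitive.
\<close>

lemma rho_kernel_pairing: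
  assumes "y < s" "0 < s" "s < t"
  shows "(LINT x:{s<..<t}|lebesgue. rho t x * (x - y) powr (-\<alpha> - 1))
    = ((LINT z:{s<..<t}|lebesgue. (h z - h s) * exchange_kernel \<alpha> s y z) - (h t - h s) * exchange_primitive \<alpha> s y t) / \<alpha>"
proof -
  let ?k = "\<lambda>x. (x - y) powr (1 - \<alpha> - 2)" let ?\<eta> = "\<lambda>x. h x - h t"
  have b: "0 < 1 - \<alpha>" "1 - \<alpha> < 1" using \<alpha> by auto
  \<comment> \<open>a power of order \<open>\<beta> - 2\<close> for \<open>\<beta> = 1 - \<alpha>\<close>\<close>
  have ex: "1 - \<alpha> - 2 = - \<alpha> - 1" by simp
  have hb: "\<bar>h x - h t\<bar> \<le> C * (t - s) powr (1 - \<alpha>)" if "x \<in> {s<..<t}" for x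
  proof -
    have "\<bar>h x - h t\<bar> \<le> C * (t - x) powr (1 - \<alpha>)"
      using holder[of x t] that assms by (simp add: abs_minus_commute)
    also have "\<dots> \<le> C * (t - s) powr (1 - \<alpha>)"
      using that C \<alpha> by (intro mult_left_mono powr_mono2) auto
    finally show ?thesis .
  qed
  have P: "set_integrable lebesgue {s<..<t} (\<lambda>x. ?\<eta> x * frac_left (1 - \<alpha>) s ?k x)"
    "(LINT x:{s<..<t}|lebesgue. ?\<eta> x * frac_left (1 - \<alpha>) s ?k x) = (LINT x:{s<..<t}|lebesgue. ?k x * frac_right (1 - \<alpha>) t ?\<eta> x)"
  proof -
    have m: "\<bar>?k x\<bar> \<le> (s - y) powr (1 - \<alpha> - 2)" if "x \<in> {s<..<t}" for x
      using that assms \<alpha> by (auto intro!: powr_mono2')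
    have i: "set_integrable lebesgue {s<..<x} (\<lambda>y'. (?k y' - ?k x) / (x - y') powr (1 - \<alpha> + 1))" if "x \<in> {s<..<t}" for x
      using frac_left_kernel_2(1)[OF b assms(1), of x] that by auto
    have m': "(LINT y':{s<..<x}|lebesgue. \<bar>?k y' - ?k x\<bar> / (x - y') powr (1 - \<alpha> + 1))
      \<le> (s - y) powr (1 - \<alpha> - 2) * (1 + 1 / (1 - (1 - \<alpha>))) / (1 - \<alpha>) * (x - s) powr - (1 - \<alpha>)" if "x \<in> {s<..<t}" for x
      using frac_left_kernel_2(3)[OF b assms(1), of x] that by auto
    have inc: "integrable LL (\<lambda>(x, y). (?\<eta> y - ?\<eta> x) * tri (1 - \<alpha>) s t x y)"
      using integrable_increments[of s t] assms by simp
    note I = integrable_endpoint_powr[OF b less_imp_le[OF assms(3)]]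
    note B = parts_bounded_increments[OF b(1) _ _ I inc hb m i m']
    show "set_integrable lebesgue {s<..<t} (\<lambda>x. ?\<eta> x * frac_left (1 - \<alpha>) s ?k x)"
      "(LINT x:{s<..<t}|lebesgue. ?\<eta> x * frac_left (1 - \<alpha>) s ?k x) = (LINT x:{s<..<t}|lebesgue. ?k x * frac_right (1 - \<alpha>) t ?\<eta> x)"
      by (rule B; (assumption | measurable))+
  qed
  have D: "frac_left (1 - \<alpha>) s ?k x = exchange_kernel \<alpha> s y x / \<alpha>" if "x \<in> {s<..<t}" for x
    unfolding ex using exchange_kernel_eq(2)[OF \<alpha> assms(1), of x] that by auto
  have N: "set_integrable lebesgue {s<..<t} (\<lambda>z. (h t - h s) * exchange_kernel \<alpha> s y z)"
    "(LINT z:{s<..<t}|lebesgue. (h t - h s) * exchange_kernel \<alpha> s y z) = (h t - h s) * exchange_primitive \<alpha> s y t"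
    using exchange_kernel_integral[OF \<alpha> assms(1,3)] by auto
  have c: "indicator {s<..<t} x *\<^sub>R (?\<eta> x * frac_left (1 - \<alpha>) s ?k x) = indicator {s<..<t} x *\<^sub>R (?\<eta> x * (exchange_kernel \<alpha> s y x / \<alpha>))" for x
    using D[of x] by (auto simp: indicator_def)
  have M: "set_integrable lebesgue {s<..<t} (\<lambda>x. ?\<eta> x * exchange_kernel \<alpha> s y x)"
  proof -
    have "set_integrable lebesgue {s<..<t} (\<lambda>x. \<alpha> * (?\<eta> x * frac_left (1 - \<alpha>) s ?k x))"
      using P(1) by simp
    then show ?thesis
      by (rule set_integrable_cong[THEN iffD1, rotated -1]) (use D \<alpha> in auto)
  qed
  have "(LINT x:{s<..<t}|lebesgue. rho t x * (x - y) powr (-\<alpha> - 1)) = (LINT x:{s<..<t}|lebesgue. ?\<eta> x * frac_left (1 - \<alpha>) s ?k x)"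
    unfolding P(2) rho_def unfolding ex by (simp add: mult.commute)
  also have "\<dots> = (LINT x:{s<..<t}|lebesgue. ?\<eta> x * exchange_kernel \<alpha> s y x) / \<alpha>"
    unfolding set_lebesgue_integral_def c by simp
  also have "(LINT x:{s<..<t}|lebesgue. ?\<eta> x * exchange_kernel \<alpha> s y x)
    = (LINT z:{s<..<t}|lebesgue. (h z - h s) * exchange_kernel \<alpha> s y z) - (h t - h s) * exchange_primitive \<alpha> s y t"
  proof -
    have "(LINT z:{s<..<t}|lebesgue. (h z - h s) * exchange_kernel \<alpha> s y z) = (LINT z:{s<..<t}|lebesgue. ?\<eta> z * exchange_kernel \<alpha> s y z + (h t - h s) * exchange_kernel \<alpha> s y z)"
      by (simp add: algebra_simps)
    also have "\<dots> = (LINT z:{s<..<t}|lebesgue. ?\<eta> z * exchange_kernel \<alpha> s y z) + (LINT z:{s<..<t}|lebesgue. (h t - h s) * exchange_kernel \<alpha> s y z)"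
      by (rule set_integral_add(2)[OF M N(1)])
    finally show ?thesis unfolding N(2) by simp
  qed
  finally show ?thesis .
qed

end

lemma measurable_frac_left:
  assumes [measurable]: "f \<in> borel_measurable lebesgue"
  shows "(\<lambda>x. indicator {a<..<b} x * frac_left \<beta> a f x) \<in> borel_measurable lebesgue"
proof -
  have "(\<lambda>x. indicator {a<..<b} x * frac_left \<beta> a f x)
     = (\<lambda>x. indicator {a<..<b} x * (f x * (x - a) powr -\<beta> + \<beta> * (LINT y|lebesgue. (f x - f y) * tri \<beta> a b x y)))"
    by (auto simp: fun_eq_iff indicator_def frac_left_tri)
  also have "\<dots> \<in> borel_measurable lebesgue" by measurable
  finally show ?thesis .
qed

context frac_integrator
begin

text \<open>
  Fubini's theorem reduces the integral of \<open>D_0 \<phi>\<close> against \<open>\<rho>_s - \<rho>_t\<close> to the pairing of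
  \<open>D_0 \<phi>\<close> with single powers, to which integration by parts applies. Absolute integrability comes from
  \<open>(z-x)^(\<alpha>-2) \<le> (z-s)^(\<alpha>-2)\<close> and from the first bound on the exchange kernel.
\<close>

lemma kernel_exchange_left:
  assumes reg: "frac_regular \<alpha> 0 s \<phi>" and st: "0 < s" "s < t"
  shows "(LINT x:{0<..<s}|lebesgue. frac_left \<alpha> 0 \<phi> x * (rho s x - rho t x))
     = (h t - h s) * (LINT y:{0<..<s}|lebesgue. \<phi> y * exchange_primitive \<alpha> s y t)
       - (LINT y:{0<..<s}|lebesgue. \<phi> y * (LINT z:{s<..<t}|lebesgue. (h z - h s) * exchange_kernel \<alpha> s y z))"
    "set_integrable lebesgue {0<..<s} (\<lambda>y. \<phi> y * exchange_primitive \<alpha> s y t)"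
    "set_integrable lebesgue {0<..<s} (\<lambda>y. \<phi> y * (LINT z:{s<..<t}|lebesgue. (h z - h s) * exchange_kernel \<alpha> s y z))"
proof -
  let ?A = "{0<..<s}" let ?B = "{s<..<t}"
  let ?d = "frac_left \<alpha> 0 \<phi>" let ?g = "\<lambda>z. h z - h s"
  have [measurable]: "\<phi> \<in> borel_measurable lebesgue" using reg by (simp add: frac_regular_def)
  note d = frac_regular_frac_left[OF \<alpha>(1) reg]
  note hardy = frac_regular_hardy[OF \<alpha>(1) reg]
  have [measurable]: "(\<lambda>x. indicator ?A x * ?d x) \<in> borel_measurable lebesgue"
    using d by (auto simp: set_integrable_def)
  have pm: "(z - s) powr (\<alpha> - 2) = 1 / (z - s) powr (2 - \<alpha>)" for z
    using powr_minus_divide[of "z - s" "2 - \<alpha>"] by simp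
  have g: "set_integrable lebesgue ?B (\<lambda>z. ?g z * (z - s) powr (\<alpha> - 2))"
    using singular_integrable(1)[of s t] st by (simp add: pm)

  have F1: "integrable LL (\<lambda>(x, z). indicator ?A x * (indicator ?B z * (?d x * (?g z * (z - x) powr (\<alpha> - 2)))))"
  proof (rule integrable_product_bound[OF d g])
    have "(\<lambda>(x, z). indicator ?A x * (indicator ?B z * (?d x * (?g z * (z - x) powr (\<alpha> - 2)))))
       = (\<lambda>(x, z). (indicator ?A x * ?d x) * (indicator ?B z * (?g z * (z - x) powr (\<alpha> - 2))))"
      by (auto simp: fun_eq_iff)
    also have "\<dots> \<in> borel_measurable LL" by measurable
    finally show "(\<lambda>(x, z). indicator ?A x * (indicator ?B z * (?d x * (?g z * (z - x) powr (\<alpha> - 2))))) \<in> borel_measurable LL" .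
    fix x z assume xz: "x \<in> ?A" "z \<in> ?B"
    then have "(z - x) powr (\<alpha> - 2) \<le> (z - s) powr (\<alpha> - 2)"
      using \<alpha> by (intro powr_mono2') auto
    then show "\<bar>?d x * (?g z * (z - x) powr (\<alpha> - 2))\<bar> \<le> \<bar>?d x\<bar> * \<bar>?g z * (z - s) powr (\<alpha> - 2)\<bar>"
      by (auto simp: abs_mult intro!: mult_left_mono)
  qed
  have F2: "integrable LL (\<lambda>(y, z). indicator ?A y * (indicator ?B z * (\<phi> y * (?g z * exchange_kernel \<alpha> s y z))))"
  proof (rule integrable_product_bound[OF hardy g])
    show "(\<lambda>(y, z). indicator ?A y * (indicator ?B z * (\<phi> y * (?g z * exchange_kernel \<alpha> s y z)))) \<in> borel_measurable LL"
      unfolding exchange_kernel_def by measurable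
    fix y z assume "y \<in> ?A" "z \<in> ?B"
    then have "\<bar>exchange_kernel \<alpha> s y z\<bar> \<le> (s - y) powr -\<alpha> * (z - s) powr (\<alpha> - 2)"
      using exchange_kernel_bound(1)[OF \<alpha>, of y s z] by auto
    then have "\<bar>\<phi> y\<bar> * \<bar>?g z\<bar> * \<bar>exchange_kernel \<alpha> s y z\<bar> \<le> \<bar>\<phi> y\<bar> * \<bar>?g z\<bar> * ((s - y) powr -\<alpha> * (z - s) powr (\<alpha> - 2))"
      by (intro mult_left_mono) auto
    then show "\<bar>\<phi> y * (?g z * exchange_kernel \<alpha> s y z)\<bar> \<le> \<bar>\<phi> y * (s - y) powr -\<alpha>\<bar> * \<bar>?g z * (z - s) powr (\<alpha> - 2)\<bar>"
      by (simp add: abs_mult mult_ac)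
  qed

  have K1: "set_integrable lebesgue ?A (\<lambda>x. (t - x) powr (\<alpha> - 1) * ?d x)"
    "set_integrable lebesgue ?A (\<lambda>y. \<phi> y * frac_right \<alpha> s (\<lambda>x. (t - x) powr (\<alpha> - 1)) y)"
    "(LINT x:?A|lebesgue. (t - x) powr (\<alpha> - 1) * ?d x) = (LINT y:?A|lebesgue. \<phi> y * frac_right \<alpha> s (\<lambda>x. (t - x) powr (\<alpha> - 1)) y)"
  proof -
    let ?k = "\<lambda>x. (t - x) powr (\<alpha> - 1)"
    have m: "\<bar>?k x\<bar> \<le> (t - s) powr (\<alpha> - 1)" if "x \<in> ?A" for x
      using that st \<alpha> by (auto intro!: powr_mono2')
    have i: "set_integrable lebesgue {y<..<s} (\<lambda>x. (?k x - ?k y) / (x - y) powr (\<alpha> + 1))" if "y \<in> ?A" for y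
      using frac_right_kernel_1(1)[OF \<alpha>, of y s t] that st by auto
    have m': "(LINT x:{y<..<s}|lebesgue. \<bar>?k x - ?k y\<bar> / (x - y) powr (\<alpha> + 1)) \<le> (t - s) powr (\<alpha> - 1) / \<alpha> * (s - y) powr -\<alpha>" if "y \<in> ?A" for y
      using frac_right_kernel_1(3)[OF \<alpha>, of y s t] that st by auto
    note P = parts_frac_regular[OF \<alpha>(1) reg _ m i m']
    show "set_integrable lebesgue ?A (\<lambda>x. ?k x * ?d x)" "set_integrable lebesgue ?A (\<lambda>y. \<phi> y * frac_right \<alpha> s ?k y)"
      "(LINT x:?A|lebesgue. ?k x * ?d x) = (LINT y:?A|lebesgue. \<phi> y * frac_right \<alpha> s ?k y)"
      by (rule P; (assumption | measurable))+
  qed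
  have E: "frac_right \<alpha> s (\<lambda>x. (t - x) powr (\<alpha> - 1)) y = exchange_primitive \<alpha> s y t" if "y \<in> ?A" for y
    using frac_right_kernel_1(2)[OF \<alpha>, of y s t] that st by (auto simp: exchange_primitive_def)
  show E_int: "set_integrable lebesgue ?A (\<lambda>y. \<phi> y * exchange_primitive \<alpha> s y t)"
    using K1(2) by (rule set_integrable_cong[THEN iffD1, rotated -1]) (use E in auto)
  have K1': "(LINT x:?A|lebesgue. (t - x) powr (\<alpha> - 1) * ?d x) = (LINT y:?A|lebesgue. \<phi> y * exchange_primitive \<alpha> s y t)"
    unfolding K1(3) using E by (intro set_lebesgue_integral_cong) auto
  have K2: "(1 - \<alpha>) * (LINT x:?A|lebesgue. ?d x * (?g z * (z - x) powr (\<alpha> - 2))) = - (LINT y:?A|lebesgue. \<phi> y * (?g z * exchange_kernel \<alpha> s y z))"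
    if z: "z \<in> ?B" for z
  proof -
    let ?k = "\<lambda>x. (z - x) powr (\<alpha> - 2)"
    have m: "\<bar>?k x\<bar> \<le> (z - s) powr (\<alpha> - 2)" if "x \<in> ?A" for x
      using that st \<alpha> z by (auto intro!: powr_mono2')
    have i: "set_integrable lebesgue {y<..<s} (\<lambda>x. (?k x - ?k y) / (x - y) powr (\<alpha> + 1))" if "y \<in> ?A" for y
      using frac_right_kernel_2(1)[OF \<alpha>, of y s z] that st z by auto
    have m': "(LINT x:{y<..<s}|lebesgue. \<bar>?k x - ?k y\<bar> / (x - y) powr (\<alpha> + 1)) \<le> (z - s) powr (\<alpha> - 2) * (1 + 1 / (1 - \<alpha>)) / \<alpha> * (s - y) powr -\<alpha>" if "y \<in> ?A" for y
      using frac_right_kernel_2(3)[OF \<alpha>, of y s z] that st z by auto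
    have P: "(LINT x:?A|lebesgue. ?k x * ?d x) = (LINT y:?A|lebesgue. \<phi> y * frac_right \<alpha> s ?k y)"
      by (rule parts_frac_regular(3)[OF \<alpha>(1) reg _ m i m']; (assumption | measurable))
    have "(LINT x:?A|lebesgue. ?d x * (?g z * ?k x)) = (LINT x:?A|lebesgue. ?g z * (?k x * ?d x))"
      by (simp add: mult_ac)
    then have "(LINT x:?A|lebesgue. ?d x * (?g z * ?k x)) = ?g z * (LINT y:?A|lebesgue. \<phi> y * frac_right \<alpha> s ?k y)"
      unfolding P[symmetric] set_integral_mult_right .
    then have "(1 - \<alpha>) * (LINT x:?A|lebesgue. ?d x * (?g z * ?k x)) = (LINT y:?A|lebesgue. (1 - \<alpha>) * ?g z * (\<phi> y * frac_right \<alpha> s ?k y))"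
      by (simp only: mult.assoc set_integral_mult_right)
    also have "\<dots> = (LINT y:?A|lebesgue. - 1 * (\<phi> y * (?g z * exchange_kernel \<alpha> s y z)))"
    proof (rule set_lebesgue_integral_cong)
      show "\<forall>y. y \<in> ?A \<longrightarrow> (1 - \<alpha>) * ?g z * (\<phi> y * frac_right \<alpha> s ?k y) = - 1 * (\<phi> y * (?g z * exchange_kernel \<alpha> s y z))"
      proof (intro allI impI)
        fix y assume y: "y \<in> ?A"
        have "(1 - \<alpha>) * g * (p * (- N / (1 - \<alpha>))) = - 1 * (p * (g * N))" for g p N
          using \<alpha> by simp
        moreover have "frac_right \<alpha> s ?k y = - exchange_kernel \<alpha> s y z / (1 - \<alpha>)"
          using exchange_kernel_eq(1)[OF \<alpha>, of y s z] y z by simp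
        ultimately show "(1 - \<alpha>) * ?g z * (\<phi> y * frac_right \<alpha> s ?k y) = - 1 * (\<phi> y * (?g z * exchange_kernel \<alpha> s y z))"
          by (simp only:)
      qed
    qed simp
    also have "\<dots> = - (LINT y:?A|lebesgue. \<phi> y * (?g z * exchange_kernel \<alpha> s y z))"
      by (rule trans[OF set_integral_mult_right]) simp
    finally show ?thesis .
  qed
  show "set_integrable lebesgue ?A (\<lambda>y. \<phi> y * (LINT z:?B|lebesgue. ?g z * exchange_kernel \<alpha> s y z))"
    using Fubini_set(1)[OF F2] by simp
  have "(LINT x:?A|lebesgue. ?d x * (rho s x - rho t x))
     = (LINT x:?A|lebesgue. (h t - h s) * ((t - x) powr (\<alpha> - 1) * ?d x) + (1 - \<alpha>) * (LINT z:?B|lebesgue. ?d x * (?g z * (z - x) powr (\<alpha> - 2))))"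
  proof (rule set_lebesgue_integral_cong)
    have *: "D * (a * p + b * I) = a * (p * D) + b * (D * I)" for D a p b I :: real
      by (simp add: algebra_simps)
    show "\<forall>x. x \<in> ?A \<longrightarrow> ?d x * (rho s x - rho t x)
      = (h t - h s) * ((t - x) powr (\<alpha> - 1) * ?d x) + (1 - \<alpha>) * (LINT z:?B|lebesgue. ?d x * (?g z * (z - x) powr (\<alpha> - 2)))"
    proof (intro allI impI)
      fix x assume "x \<in> ?A"
      then have x: "0 < x" "x < s" by auto
      show "?d x * (rho s x - rho t x)
        = (h t - h s) * ((t - x) powr (\<alpha> - 1) * ?d x) + (1 - \<alpha>) * (LINT z:?B|lebesgue. ?d x * (?g z * (z - x) powr (\<alpha> - 2)))"
        unfolding rho_difference[OF x st(2)] set_integral_mult_right by (rule *)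
    qed
  qed simp
  also have "\<dots> = (h t - h s) * (LINT x:?A|lebesgue. (t - x) powr (\<alpha> - 1) * ?d x)
     + (1 - \<alpha>) * (LINT x:?A|lebesgue. LINT z:?B|lebesgue. ?d x * (?g z * (z - x) powr (\<alpha> - 2)))"
  proof (subst set_integral_add(2))
    show "set_integrable lebesgue ?A (\<lambda>x. (h t - h s) * ((t - x) powr (\<alpha> - 1) * ?d x))"
      using K1(1) by (rule set_integrable_mult_right)
    show "set_integrable lebesgue ?A (\<lambda>x. (1 - \<alpha>) * (LINT z:?B|lebesgue. ?d x * (?g z * (z - x) powr (\<alpha> - 2))))"
      using Fubini_set(1)[OF F1] by (rule set_integrable_mult_right)
  qed (simp only: set_integral_mult_right)
  finally have 1: "(LINT x:?A|lebesgue. ?d x * (rho s x - rho t x)) = (h t - h s) * (LINT x:?A|lebesgue. (t - x) powr (\<alpha> - 1) * ?d x)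
     + (1 - \<alpha>) * (LINT x:?A|lebesgue. LINT z:?B|lebesgue. ?d x * (?g z * (z - x) powr (\<alpha> - 2)))" .
  have "(1 - \<alpha>) * (LINT x:?A|lebesgue. LINT z:?B|lebesgue. ?d x * (?g z * (z - x) powr (\<alpha> - 2)))
     = (LINT z:?B|lebesgue. (1 - \<alpha>) * (LINT x:?A|lebesgue. ?d x * (?g z * (z - x) powr (\<alpha> - 2))))"
    unfolding Fubini_set(3)[OF F1] by (rule set_integral_mult_right[symmetric])
  also have "\<dots> = (LINT z:?B|lebesgue. - 1 * (LINT y:?A|lebesgue. \<phi> y * (?g z * exchange_kernel \<alpha> s y z)))"
    using K2 by (intro set_lebesgue_integral_cong) auto
  also have "\<dots> = - (LINT z:?B|lebesgue. LINT y:?A|lebesgue. \<phi> y * (?g z * exchange_kernel \<alpha> s y z))"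
    by (rule trans[OF set_integral_mult_right]) simp
  also have "\<dots> = - (LINT y:?A|lebesgue. LINT z:?B|lebesgue. \<phi> y * (?g z * exchange_kernel \<alpha> s y z))"
    by (simp only: Fubini_set(3)[OF F2])
  also have "\<dots> = - (LINT y:?A|lebesgue. \<phi> y * (LINT z:?B|lebesgue. ?g z * exchange_kernel \<alpha> s y z))"
    by (simp only: set_integral_mult_right)
  finally show "(LINT x:?A|lebesgue. ?d x * (rho s x - rho t x))
     = (h t - h s) * (LINT y:?A|lebesgue. \<phi> y * exchange_primitive \<alpha> s y t)
       - (LINT y:?A|lebesgue. \<phi> y * (LINT z:?B|lebesgue. ?g z * exchange_kernel \<alpha> s y z))"
    unfolding 1 K1' by simp
qed

text \<open>
  The counterpart on \<open>(s,t)\<close>, for the term created by the change of base point. Here a product bound is not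
  available; integrability follows by integrating over \<open>x\<close> first, which leaves the Hardy weight
  \<open>(s-y)^(-\<alpha>)\<close>.
\<close>

lemma kernel_exchange_right:
  assumes reg: "frac_regular \<alpha> 0 s \<phi>" and st: "0 < s" "s < t"
  shows "set_integrable lebesgue {s<..<t} (\<lambda>x. LINT y:{0<..<s}|lebesgue. rho t x * (\<phi> y / (x - y) powr (\<alpha> + 1)))"
    "\<alpha> * (LINT x:{s<..<t}|lebesgue. LINT y:{0<..<s}|lebesgue. rho t x * (\<phi> y / (x - y) powr (\<alpha> + 1)))
     = (LINT y:{0<..<s}|lebesgue. \<phi> y * (LINT z:{s<..<t}|lebesgue. (h z - h s) * exchange_kernel \<alpha> s y z))
       - (h t - h s) * (LINT y:{0<..<s}|lebesgue. \<phi> y * exchange_primitive \<alpha> s y t)"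
proof -
  let ?A = "{0<..<s}" let ?B = "{s<..<t}" let ?g = "\<lambda>z. h z - h s"
  have [measurable]: "\<phi> \<in> borel_measurable lebesgue" using reg by (simp add: frac_regular_def)
  note hardy = frac_regular_hardy[OF \<alpha>(1) reg]
  have [measurable]: "(\<lambda>x. indicator ?B x * rho t x) \<in> borel_measurable lebesgue"
    by (rule measurable_rho)
  have k: "set_integrable lebesgue ?B (\<lambda>x. 1 / (x - y) powr (\<alpha> + 1) * rho t x)"
    "(LINT x:?B|lebesgue. \<bar>1 / (x - y) powr (\<alpha> + 1) * rho t x\<bar>) \<le> 2 * C / \<alpha> * (s - y) powr -\<alpha>" if y: "y \<in> ?A" for y
  proof -
    note K = integral_power_kernel_right[of \<alpha> s t y]
    have k0: "set_integrable lebesgue ?B (\<lambda>x. 1 / (x - y) powr (\<alpha> + 1))"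
      using K(1) \<alpha> st y by auto
    show i: "set_integrable lebesgue ?B (\<lambda>x. 1 / (x - y) powr (\<alpha> + 1) * rho t x)"
      using st rho_bound by (intro set_integrable_mult_bounded_on[OF k0 _ _ rho_bound]) auto
    have "(LINT x:?B|lebesgue. \<bar>1 / (x - y) powr (\<alpha> + 1) * rho t x\<bar>) \<le> (LINT x:?B|lebesgue. 2 * C * (1 / (x - y) powr (\<alpha> + 1)))"
    proof (rule set_integral_mono)
      show "set_integrable lebesgue ?B (\<lambda>x. \<bar>1 / (x - y) powr (\<alpha> + 1) * rho t x\<bar>)"
        using i by (rule set_integrable_abs)
      show "set_integrable lebesgue ?B (\<lambda>x. 2 * C * (1 / (x - y) powr (\<alpha> + 1)))"
        using k0 by (rule set_integrable_mult_right)
      fix x assume "x \<in> ?B"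
      then have "\<bar>rho t x\<bar> \<le> 2 * C" using st by (intro rho_bound) auto
      then show "\<bar>1 / (x - y) powr (\<alpha> + 1) * rho t x\<bar> \<le> 2 * C * (1 / (x - y) powr (\<alpha> + 1))"
        by (simp add: abs_mult divide_right_mono)
    qed
    also have "\<dots> = 2 * C * (((s - y) powr -\<alpha> - (t - y) powr -\<alpha>) / \<alpha>)"
      using K(2) \<alpha> st y by (subst set_integral_mult_right) auto
    also have "\<dots> \<le> 2 * C * ((s - y) powr -\<alpha> / \<alpha>)"
      using C \<alpha> by (intro mult_left_mono divide_right_mono) auto
    finally show "(LINT x:?B|lebesgue. \<bar>1 / (x - y) powr (\<alpha> + 1) * rho t x\<bar>) \<le> 2 * C / \<alpha> * (s - y) powr -\<alpha>"
      by simp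
  qed
  have F3: "integrable LL (\<lambda>(x, y). indicator ?B x * (indicator ?A y * (rho t x * (\<phi> y / (x - y) powr (\<alpha> + 1)))))"
  proof (rule integrable_LL_snd)
    have "(\<lambda>(x, y). indicator ?B x * (indicator ?A y * (rho t x * (\<phi> y / (x - y) powr (\<alpha> + 1)))))
      = (\<lambda>(x, y). (indicator ?B x * rho t x) * (indicator ?A y * (\<phi> y / (x - y) powr (\<alpha> + 1))))"
      by (auto simp: fun_eq_iff)
    also have "\<dots> \<in> borel_measurable LL" by measurable
    finally show "(\<lambda>(x, y). indicator ?B x * (indicator ?A y * (rho t x * (\<phi> y / (x - y) powr (\<alpha> + 1))))) \<in> borel_measurable LL" .
    have e: "indicator ?B x * (indicator ?A y * (rho t x * (\<phi> y / (x - y) powr (\<alpha> + 1))))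
       = (indicator ?A y * \<phi> y) * (indicator ?B x *\<^sub>R (1 / (x - y) powr (\<alpha> + 1) * rho t x))" for x y
      by simp
    have "integrable lebesgue (\<lambda>x. (indicator ?A y * \<phi> y) * (indicator ?B x *\<^sub>R (1 / (x - y) powr (\<alpha> + 1) * rho t x)))" for y
    proof (cases "y \<in> ?A")
      case True
      then show ?thesis using k(1)[OF True] unfolding set_integrable_def by (intro integrable_mult_right)
    qed simp
    then show "AE y in lebesgue. integrable lebesgue (\<lambda>x. indicator ?B x * (indicator ?A y * (rho t x * (\<phi> y / (x - y) powr (\<alpha> + 1)))))"
      unfolding e by (rule AE_I2)
    show "integrable lebesgue (\<lambda>y. 2 * C / \<alpha> * \<bar>indicator ?A y *\<^sub>R (\<phi> y * (s - y) powr -\<alpha>)\<bar>)"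
      using hardy by (intro integrable_mult_right integrable_abs) (simp add: set_integrable_def)
    have "(LINT x|lebesgue. \<bar>(indicator ?A y * \<phi> y) * (indicator ?B x *\<^sub>R (1 / (x - y) powr (\<alpha> + 1) * rho t x))\<bar>)
      \<le> 2 * C / \<alpha> * \<bar>indicator ?A y *\<^sub>R (\<phi> y * (s - y) powr -\<alpha>)\<bar>" for y
    proof (cases "y \<in> ?A")
      case True
      have "(LINT x|lebesgue. \<bar>(indicator ?A y * \<phi> y) * (indicator ?B x *\<^sub>R (1 / (x - y) powr (\<alpha> + 1) * rho t x))\<bar>)
        = (LINT x|lebesgue. \<bar>\<phi> y\<bar> * (indicator ?B x *\<^sub>R \<bar>1 / (x - y) powr (\<alpha> + 1) * rho t x\<bar>))"
        using True by (simp add: abs_mult)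
      also have "\<dots> = \<bar>\<phi> y\<bar> * (LINT x:?B|lebesgue. \<bar>1 / (x - y) powr (\<alpha> + 1) * rho t x\<bar>)"
        unfolding set_lebesgue_integral_def by (rule integral_mult_right_zero)
      also have "\<dots> \<le> \<bar>\<phi> y\<bar> * (2 * C / \<alpha> * (s - y) powr -\<alpha>)"
        using k(2)[OF True] by (intro mult_left_mono) auto
      finally show ?thesis using True by (simp add: abs_mult mult_ac)
    qed simp
    then show "AE y in lebesgue. (LINT x|lebesgue. \<bar>indicator ?B x * (indicator ?A y * (rho t x * (\<phi> y / (x - y) powr (\<alpha> + 1))))\<bar>)
      \<le> 2 * C / \<alpha> * \<bar>indicator ?A y *\<^sub>R (\<phi> y * (s - y) powr -\<alpha>)\<bar>"
      unfolding e by (rule AE_I2)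
  qed
  show "set_integrable lebesgue ?B (\<lambda>x. LINT y:?A|lebesgue. rho t x * (\<phi> y / (x - y) powr (\<alpha> + 1)))"
    by (rule Fubini_set(1)[OF F3])
  have pm: "\<phi> y * (rho t x * (x - y) powr (- \<alpha> - 1)) = rho t x * (\<phi> y / (x - y) powr (\<alpha> + 1))" for x y
    using powr_minus_divide[of "x - y" "\<alpha> + 1"] by simp
  have "\<alpha> * (LINT x:?B|lebesgue. LINT y:?A|lebesgue. rho t x * (\<phi> y / (x - y) powr (\<alpha> + 1)))
     = \<alpha> * (LINT y:?A|lebesgue. LINT x:?B|lebesgue. rho t x * (\<phi> y / (x - y) powr (\<alpha> + 1)))"
    by (simp only: Fubini_set(3)[OF F3])
  also have "\<dots> = (LINT y:?A|lebesgue. \<alpha> * (\<phi> y * (LINT x:?B|lebesgue. rho t x * (x - y) powr (- \<alpha> - 1))))"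
    by (simp only: pm set_integral_mult_right[symmetric])
  also have "\<dots> = (LINT y:?A|lebesgue. \<phi> y * (LINT z:?B|lebesgue. ?g z * exchange_kernel \<alpha> s y z) - (h t - h s) * (\<phi> y * exchange_primitive \<alpha> s y t))"
  proof (rule set_lebesgue_integral_cong)
    have *: "\<alpha> * (p * ((X - c * E) / \<alpha>)) = p * X - c * (p * E)" for p X c E
      using \<alpha> by (simp add: field_simps)
    show "\<forall>y. y \<in> ?A \<longrightarrow> \<alpha> * (\<phi> y * (LINT x:?B|lebesgue. rho t x * (x - y) powr (- \<alpha> - 1)))
      = \<phi> y * (LINT z:?B|lebesgue. ?g z * exchange_kernel \<alpha> s y z) - (h t - h s) * (\<phi> y * exchange_primitive \<alpha> s y t)"
    proof (intro allI impI)
      fix y assume "y \<in> ?A"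
      then have "y < s" by simp
      show "\<alpha> * (\<phi> y * (LINT x:?B|lebesgue. rho t x * (x - y) powr (- \<alpha> - 1)))
      = \<phi> y * (LINT z:?B|lebesgue. ?g z * exchange_kernel \<alpha> s y z) - (h t - h s) * (\<phi> y * exchange_primitive \<alpha> s y t)"
        unfolding rho_kernel_pairing[OF \<open>y < s\<close> st] by (rule *)
    qed
  qed simp
  also have "\<dots> = (LINT y:?A|lebesgue. \<phi> y * (LINT z:?B|lebesgue. ?g z * exchange_kernel \<alpha> s y z))
       - (h t - h s) * (LINT y:?A|lebesgue. \<phi> y * exchange_primitive \<alpha> s y t)"
    using kernel_exchange_left(2,3)[OF reg st]
    by (subst set_integral_diff(2)) (auto simp only: set_integral_mult_right intro!: set_integrable_mult_right)
  finally show "\<alpha> * (LINT x:?B|lebesgue. LINT y:?A|lebesgue. rho t x * (\<phi> y / (x - y) powr (\<alpha> + 1)))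
     = (LINT y:?A|lebesgue. \<phi> y * (LINT z:?B|lebesgue. ?g z * exchange_kernel \<alpha> s y z))
       - (h t - h s) * (LINT y:?A|lebesgue. \<phi> y * exchange_primitive \<alpha> s y t)" .
qed

lemma integrable_frac_left_rho:
  assumes "frac_regular \<alpha> 0 y \<phi>" "y \<le> z" "z \<le> t"
  shows "set_integrable lebesgue {0<..<y} (\<lambda>x. frac_left \<alpha> 0 \<phi> x * rho z x)"
proof (cases "0 < y")
  case True
  show ?thesis
  proof (rule set_integrable_mult_bounded_on[OF frac_regular_frac_left[OF \<alpha>(1) assms(1)]])
    have "(\<lambda>x. indicator {0<..<y} x * rho z x) = (\<lambda>x. indicator {0<..<y} x * (indicator {0<..<z} x * rho z x))"
      using assms by (auto simp: fun_eq_iff indicator_def)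
    also have "\<dots> \<in> borel_measurable lebesgue"
      using measurable_rho[of 0 z] by measurable
    finally show "(\<lambda>x. indicator {0<..<y} x * rho z x) \<in> borel_measurable lebesgue" .
    show "\<bar>rho z x\<bar> \<le> 2 * C" if "x \<in> {0<..<y}" for x
      using that assms by (intro rho_bound) auto
  qed simp
qed (simp add: set_integrable_def)

text \<open>
  Replacing \<open>\<rho>_t\<close> by \<open>\<rho>_s\<close> on \<open>(0,s)\<close> and \<open>D_0\<close> by \<open>D_s\<close> on \<open>(s,t)\<close> produces two error terms,
  which cancel by the two exchange lemmas.
\<close>

lemma stieltjes_additive:
  assumes reg: "frac_regular \<alpha> 0 t \<phi>" and st: "0 < s" "s < t"
  shows "(LINT x:{0<..<t}|lebesgue. frac_left \<alpha> 0 \<phi> x * rho t x)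
    = (LINT x:{0<..<s}|lebesgue. frac_left \<alpha> 0 \<phi> x * rho s x) + (LINT x:{s<..<t}|lebesgue. frac_left \<alpha> s \<phi> x * rho t x)"
proof -
  let ?A = "{0<..<s}" let ?B = "{s<..<t}" let ?d = "frac_left \<alpha> 0 \<phi>"
  have reg': "frac_regular \<alpha> 0 s \<phi>" using reg by (rule frac_regular_mono) (use st in simp)
  note it = integrable_frac_left_rho[OF reg, of t]
  have itA: "set_integrable lebesgue ?A (\<lambda>x. ?d x * rho t x)" and isA: "set_integrable lebesgue ?A (\<lambda>x. ?d x * rho s x)"
    using st by (auto intro!: integrable_frac_left_rho[OF reg'])
  have itB: "set_integrable lebesgue ?B (\<lambda>x. ?d x * rho t x)"
    using it by (rule set_integrable_subset) (use st in auto)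
  define Q where "Q x = (LINT y:?A|lebesgue. rho t x * (\<phi> y / (x - y) powr (\<alpha> + 1)))" for x
  note R = kernel_exchange_right[OF reg' st, folded Q_def]
  have s1: "set_integrable lebesgue ?B (\<lambda>x. ?d x * rho t x + \<alpha> * Q x)"
    using itB R(1) by (intro set_integral_add(1) set_integrable_mult_right)
  have ae: "AE x in lebesgue. x \<in> ?B \<longrightarrow> frac_left \<alpha> s \<phi> x * rho t x = ?d x * rho t x + \<alpha> * Q x"
    using frac_left_change_base[OF \<alpha>(1) reg less_imp_le[OF st(1)] st(2)]
  proof eventually_elim
    fix x assume *: "x \<in> ?B \<longrightarrow> frac_left \<alpha> s \<phi> x = frac_left \<alpha> 0 \<phi> x + \<alpha> * (LINT y:?A|lebesgue. \<phi> y / (x - y) powr (\<alpha> + 1))"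
    show "x \<in> ?B \<longrightarrow> frac_left \<alpha> s \<phi> x * rho t x = ?d x * rho t x + \<alpha> * Q x"
      using * unfolding Q_def set_integral_mult_right by (auto simp: algebra_simps)
  qed
  have a: "(LINT x:?B|lebesgue. ?d x * rho t x + \<alpha> * Q x) = (LINT x:?B|lebesgue. ?d x * rho t x) + \<alpha> * (LINT x:?B|lebesgue. Q x)"
    using itB R(1) by (subst set_integral_add(2)) (auto simp only: set_integral_mult_right intro!: set_integrable_mult_right)
  have "(LINT x:?B|lebesgue. ?d x * rho t x + \<alpha> * Q x) = (LINT x:?B|lebesgue. frac_left \<alpha> s \<phi> x * rho t x)"
    unfolding set_lebesgue_integral_def
  proof (rule integral_cong_AE)
    have [measurable]: "\<phi> \<in> borel_measurable lebesgue" using reg by (simp add: frac_regular_def)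
    have "(\<lambda>x. (indicator ?B x * frac_left \<alpha> s \<phi> x) * (indicator ?B x * rho t x)) \<in> borel_measurable lebesgue"
      by (rule borel_measurable_times[OF measurable_frac_left measurable_rho]) measurable
    moreover have "(indicator ?B x * frac_left \<alpha> s \<phi> x) * (indicator ?B x * rho t x) = indicator ?B x *\<^sub>R (frac_left \<alpha> s \<phi> x * rho t x)" for x
      by (simp add: indicator_def)
    ultimately show "(\<lambda>x. indicator ?B x *\<^sub>R (frac_left \<alpha> s \<phi> x * rho t x)) \<in> borel_measurable lebesgue"
      by simp
    show "AE x in lebesgue. indicator ?B x *\<^sub>R (?d x * rho t x + \<alpha> * Q x) = indicator ?B x *\<^sub>R (frac_left \<alpha> s \<phi> x * rho t x)"
      using ae by eventually_elim (auto simp: indicator_def)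
    show "(\<lambda>x. indicator ?B x *\<^sub>R (?d x * rho t x + \<alpha> * Q x)) \<in> borel_measurable lebesgue"
      using s1 by (auto simp: set_integrable_def)
  qed
  with a have 1: "(LINT x:?B|lebesgue. frac_left \<alpha> s \<phi> x * rho t x) = (LINT x:?B|lebesgue. ?d x * rho t x) + \<alpha> * (LINT x:?B|lebesgue. Q x)"
    by simp
  have "(LINT x:?A|lebesgue. ?d x * (rho s x - rho t x)) = (LINT x:?A|lebesgue. ?d x * rho s x) - (LINT x:?A|lebesgue. ?d x * rho t x)"
    by (simp only: right_diff_distrib set_integral_diff(2)[OF isA itA])
  then have 2: "\<alpha> * (LINT x:?B|lebesgue. Q x) = (LINT x:?A|lebesgue. ?d x * rho t x) - (LINT x:?A|lebesgue. ?d x * rho s x)"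
    using R(2) kernel_exchange_left(1)[OF reg' st] by linarith
  have "(LINT x:{0<..<t}|lebesgue. ?d x * rho t x) = (LINT x:?A|lebesgue. ?d x * rho t x) + (LINT x:?B|lebesgue. ?d x * rho t x)"
    using st it by (intro set_integral_split_at) auto
  then show ?thesis using 1 2 by linarith
qed

end

section \<open>Increments of the integral of a real integrand\<close>

lemma ennreal_abs_set_integral_le:
  fixes f :: "real \<Rightarrow> real"
  shows "ennreal \<bar>LINT x:A|lebesgue. f x\<bar> \<le> (\<integral>\<^sup>+x\<in>A. ennreal \<bar>f x\<bar> \<partial>lebesgue)"
proof (cases "integrable lebesgue (\<lambda>x. indicator A x *\<^sub>R f x)")
  case True
  have "ennreal \<bar>LINT x:A|lebesgue. f x\<bar> \<le> (\<integral>\<^sup>+x. ennreal (norm (indicator A x *\<^sub>R f x)) \<partial>lebesgue)"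
    using integral_norm_bound_ennreal[OF True] by (simp add: set_lebesgue_integral_def)
  also have "\<dots> = (\<integral>\<^sup>+x\<in>A. ennreal \<bar>f x\<bar> \<partial>lebesgue)"
    by (intro nn_integral_cong) (auto simp: indicator_def)
  finally show ?thesis .
qed (simp add: set_lebesgue_integral_def not_integrable_integral_eq)

text \<open>
  Linearity of the derivative holds only where both inner integrals converge.
\<close>

lemma frac_regular_linear:
  assumes p: "frac_regular \<beta> a b p" and q: "frac_regular \<beta> a b q"
  shows "frac_regular \<beta> a b (\<lambda>x. c * p x + q x)"
    "AE x in lebesgue. x \<in> {a<..<b} \<longrightarrow> frac_left \<beta> a (\<lambda>x. c * p x + q x) x = c * frac_left \<beta> a p x + frac_left \<beta> a q x"
proof -
  have [measurable]: "p \<in> borel_measurable lebesgue" "q \<in> borel_measurable lebesgue"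
    and l: "set_integrable lebesgue {a<..<b} (\<lambda>x. p x * (x - a) powr -\<beta>)" "set_integrable lebesgue {a<..<b} (\<lambda>x. q x * (x - a) powr -\<beta>)"
    and d: "integrable LL (\<lambda>(x, y). (p x - p y) * tri \<beta> a b x y)" "integrable LL (\<lambda>(x, y). (q x - q y) * tri \<beta> a b x y)"
    using p q by (auto simp: frac_regular_def)
  have e: "((c * p x + q x) - (c * p y + q y)) * tri \<beta> a b x y = c * ((p x - p y) * tri \<beta> a b x y) + (q x - q y) * tri \<beta> a b x y" for x y
    by (simp add: algebra_simps)
  show "frac_regular \<beta> a b (\<lambda>x. c * p x + q x)"
    unfolding frac_regular_def
  proof (intro conjI)
    have "set_integrable lebesgue {a<..<b} (\<lambda>x. c * (p x * (x - a) powr -\<beta>) + q x * (x - a) powr -\<beta>)"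
      using l by (intro set_integral_add(1) set_integrable_mult_right)
    then show "set_integrable lebesgue {a<..<b} (\<lambda>x. (c * p x + q x) * (x - a) powr -\<beta>)"
      by (simp add: algebra_simps)
    have "integrable LL (\<lambda>z. c * (case z of (x, y) \<Rightarrow> (p x - p y) * tri \<beta> a b x y) + (case z of (x, y) \<Rightarrow> (q x - q y) * tri \<beta> a b x y))"
      using d by (intro Bochner_Integration.integrable_add integrable_mult_right)
    then show "integrable LL (\<lambda>(x, y). ((c * p x + q x) - (c * p y + q y)) * tri \<beta> a b x y)"
      unfolding e by (simp add: case_prod_unfold)
  qed measurable
  show "AE x in lebesgue. x \<in> {a<..<b} \<longrightarrow> frac_left \<beta> a (\<lambda>x. c * p x + q x) x = c * frac_left \<beta> a p x + frac_left \<beta> a q x"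
    using leb.AE_integrable_fst[OF d(1)] leb.AE_integrable_fst[OF d(2)]
  proof eventually_elim
    fix x assume i: "integrable lebesgue (\<lambda>y. (p x - p y) * tri \<beta> a b x y)" "integrable lebesgue (\<lambda>y. (q x - q y) * tri \<beta> a b x y)"
    have I: "(LINT y|lebesgue. c * ((p x - p y) * tri \<beta> a b x y) + (q x - q y) * tri \<beta> a b x y)
       = c * (LINT y|lebesgue. (p x - p y) * tri \<beta> a b x y) + (LINT y|lebesgue. (q x - q y) * tri \<beta> a b x y)"
      using i by (subst Bochner_Integration.integral_add) auto
    show "x \<in> {a<..<b} \<longrightarrow> frac_left \<beta> a (\<lambda>x. c * p x + q x) x = c * frac_left \<beta> a p x + frac_left \<beta> a q x"
    proof
      assume x: "x \<in> {a<..<b}"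
      show "frac_left \<beta> a (\<lambda>x. c * p x + q x) x = c * frac_left \<beta> a p x + frac_left \<beta> a q x"
        unfolding frac_left_tri[OF x] e I by (simp add: algebra_simps)
    qed
  qed
qed

lemma frac_left_bound:
  assumes "0 < \<alpha>" "s < x"
  shows "ennreal \<bar>frac_left \<alpha> s \<phi> x\<bar> \<le> ennreal (\<bar>\<phi> x\<bar> / (x - s) powr \<alpha>)
    + ennreal \<alpha> * (\<integral>\<^sup>+y\<in>{s<..<x}. ennreal (\<bar>\<phi> x - \<phi> y\<bar> / (x - y) powr (\<alpha> + 1)) \<partial>lebesgue)"
proof -
  let ?I = "LINT y:{s<..<x}|lebesgue. (\<phi> x - \<phi> y) / (x - y) powr (\<alpha> + 1)"
  have "\<bar>frac_left \<alpha> s \<phi> x\<bar> \<le> \<bar>\<phi> x\<bar> / (x - s) powr \<alpha> + \<alpha> * \<bar>?I\<bar>"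
    unfolding frac_left_def using assms
    by (intro order_trans[OF abs_triangle_ineq]) (simp add: abs_mult powr_minus_divide)
  then have "ennreal \<bar>frac_left \<alpha> s \<phi> x\<bar> \<le> ennreal (\<bar>\<phi> x\<bar> / (x - s) powr \<alpha> + \<alpha> * \<bar>?I\<bar>)"
    by (rule ennreal_leI)
  also have "\<dots> = ennreal (\<bar>\<phi> x\<bar> / (x - s) powr \<alpha>) + ennreal \<alpha> * ennreal \<bar>?I\<bar>"
    using assms by (simp add: ennreal_plus ennreal_mult)
  also have "ennreal \<bar>?I\<bar> \<le> (\<integral>\<^sup>+y\<in>{s<..<x}. ennreal \<bar>(\<phi> x - \<phi> y) / (x - y) powr (\<alpha> + 1)\<bar> \<partial>lebesgue)"
    by (rule ennreal_abs_set_integral_le)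
  finally show ?thesis by (simp add: mult_left_mono add_left_mono)
qed

context frac_integrator
begin

text \<open>
  Up to a negative constant this is the generalised Stieltjes integral of \<open>\<phi>\<close> over \<open>(0,y)\<close>.
\<close>

definition pairing :: "(real \<Rightarrow> real) \<Rightarrow> real \<Rightarrow> real" where
  "pairing \<phi> y = (LINT x:{0<..<y}|lebesgue. frac_left \<alpha> 0 \<phi> x * rho y x)"

lemma pairing_linear:
  assumes p: "frac_regular \<alpha> 0 y p" and q: "frac_regular \<alpha> 0 y q" and y: "y \<le> t"
  shows "pairing (\<lambda>x. c * p x + q x) y = c * pairing p y + pairing q y"
proof -
  note L = frac_regular_linear[OF p q, of c]
  note i = integrable_frac_left_rho[OF p order.refl y] integrable_frac_left_rho[OF q order.refl y] integrable_frac_left_rho[OF L(1) order.refl y]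
  have cp: "set_integrable lebesgue {0<..<y} (\<lambda>x. c * (frac_left \<alpha> 0 p x * rho y x))"
    using i(1) by (rule set_integrable_mult_right)
  have "pairing (\<lambda>x. c * p x + q x) y = (LINT x:{0<..<y}|lebesgue. c * (frac_left \<alpha> 0 p x * rho y x) + frac_left \<alpha> 0 q x * rho y x)"
    unfolding pairing_def set_lebesgue_integral_def
  proof (rule integral_cong_AE)
    show "(\<lambda>x. indicator {0<..<y} x *\<^sub>R (frac_left \<alpha> 0 (\<lambda>x. c * p x + q x) x * rho y x)) \<in> borel_measurable lebesgue"
      using i(3) by (auto simp: set_integrable_def)
    show "(\<lambda>x. indicator {0<..<y} x *\<^sub>R (c * (frac_left \<alpha> 0 p x * rho y x) + frac_left \<alpha> 0 q x * rho y x)) \<in> borel_measurable lebesgue"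
      using set_integral_add(1)[OF cp i(2)] by (auto simp: set_integrable_def)
    show "AE x in lebesgue. indicator {0<..<y} x *\<^sub>R (frac_left \<alpha> 0 (\<lambda>x. c * p x + q x) x * rho y x)
       = indicator {0<..<y} x *\<^sub>R (c * (frac_left \<alpha> 0 p x * rho y x) + frac_left \<alpha> 0 q x * rho y x)"
      using L(2) by eventually_elim (auto simp: indicator_def algebra_simps)
  qed
  also have "\<dots> = c * pairing p y + pairing q y"
    unfolding pairing_def set_integral_add(2)[OF cp i(2)] set_integral_mult_right ..
  finally show ?thesis .
qed

lemma pairing_sum:
  assumes "finite I" "\<And>i. i \<in> I \<Longrightarrow> frac_regular \<alpha> 0 y (p i)" "y \<le> t"
  shows "frac_regular \<alpha> 0 y (\<lambda>x. \<Sum>i\<in>I. w i * p i x) \<and> pairing (\<lambda>x. \<Sum>i\<in>I. w i * p i x) y = (\<Sum>i\<in>I. w i * pairing (p i) y)"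
  using assms(1,2)
proof (induction I rule: finite_induct)
  case empty
  then show ?case by (simp add: frac_regular_def pairing_def frac_left_def set_integrable_def set_lebesgue_integral_def case_prod_unfold)
next
  case (insert i I)
  then show ?case
    using frac_regular_linear(1)[of \<alpha> 0 y "p i" "\<lambda>x. \<Sum>i\<in>I. w i * p i x" "w i"]
      pairing_linear[of y "p i" "\<lambda>x. \<Sum>i\<in>I. w i * p i x" "w i"] assms(3) by simp
qed

lemma integral_frac_left_rho_bound:
  assumes [measurable]: "\<phi> \<in> borel_measurable lebesgue" and c: "0 \<le> c" and s: "0 \<le> s" "y \<le> t"
    and L: "\<And>x. s < x \<Longrightarrow> x < y \<Longrightarrow> c * \<bar>rho y x\<bar> \<le> L"
  shows "ennreal \<bar>c * (LINT x:{s<..<y}|lebesgue. frac_left \<alpha> s \<phi> x * rho y x)\<bar>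
    \<le> ennreal L * ((\<integral>\<^sup>+x\<in>{s<..<y}. ennreal (\<bar>\<phi> x\<bar> / (x - s) powr \<alpha>) \<partial>lebesgue)
      + ennreal \<alpha> * (\<integral>\<^sup>+x\<in>{s<..<y}. (\<integral>\<^sup>+z\<in>{s<..<x}. ennreal (\<bar>\<phi> x - \<phi> z\<bar> / (x - z) powr (\<alpha> + 1)) \<partial>lebesgue) \<partial>lebesgue))"
proof -
  let ?a = "\<lambda>x. ennreal (\<bar>\<phi> x\<bar> / (x - s) powr \<alpha>)"
  let ?b = "\<lambda>x. \<integral>\<^sup>+z\<in>{s<..<x}. ennreal (\<bar>\<phi> x - \<phi> z\<bar> / (x - z) powr (\<alpha> + 1)) \<partial>lebesgue"
  have b: "?b = (\<lambda>x. \<integral>\<^sup>+z. ennreal (\<bar>\<phi> x - \<phi> z\<bar> / (x - z) powr (\<alpha> + 1)) * (if s < z \<and> z < x then 1 else 0) \<partial>lebesgue)"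
    by (auto simp: fun_eq_iff indicator_def intro!: nn_integral_cong)
  have bm: "?b \<in> borel_measurable lebesgue"
    unfolding b by measurable
  have "ennreal \<bar>c * (LINT x:{s<..<y}|lebesgue. frac_left \<alpha> s \<phi> x * rho y x)\<bar>
     = ennreal \<bar>LINT x:{s<..<y}|lebesgue. c * (frac_left \<alpha> s \<phi> x * rho y x)\<bar>"
    by (simp only: set_integral_mult_right)
  also have "\<dots> \<le> (\<integral>\<^sup>+x\<in>{s<..<y}. ennreal \<bar>c * (frac_left \<alpha> s \<phi> x * rho y x)\<bar> \<partial>lebesgue)"
    by (rule ennreal_abs_set_integral_le)
  also have "\<dots> \<le> (\<integral>\<^sup>+x. ennreal L * (?a x * indicator {s<..<y} x + ennreal \<alpha> * (?b x * indicator {s<..<y} x)) \<partial>lebesgue)"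
  proof (rule nn_integral_mono)
    fix x
    show "ennreal \<bar>c * (frac_left \<alpha> s \<phi> x * rho y x)\<bar> * indicator {s<..<y} x
      \<le> ennreal L * (?a x * indicator {s<..<y} x + ennreal \<alpha> * (?b x * indicator {s<..<y} x))"
    proof (cases "x \<in> {s<..<y}")
      case True
      have "\<bar>c * (frac_left \<alpha> s \<phi> x * rho y x)\<bar> = (c * \<bar>rho y x\<bar>) * \<bar>frac_left \<alpha> s \<phi> x\<bar>"
        using c by (simp add: abs_mult)
      also have "\<dots> \<le> L * \<bar>frac_left \<alpha> s \<phi> x\<bar>"
        using L True by (intro mult_right_mono) auto
      finally have "ennreal \<bar>c * (frac_left \<alpha> s \<phi> x * rho y x)\<bar> \<le> ennreal (L * \<bar>frac_left \<alpha> s \<phi> x\<bar>)"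
        by (rule ennreal_leI)
      also have "\<dots> = ennreal L * ennreal \<bar>frac_left \<alpha> s \<phi> x\<bar>"
        by (rule ennreal_mult'') simp
      also have "\<dots> \<le> ennreal L * (?a x + ennreal \<alpha> * ?b x)"
        using frac_left_bound[OF \<alpha>(1), of s x \<phi>] True by (intro mult_left_mono) auto
      finally show ?thesis using True by simp
    qed simp
  qed
  also have "\<dots> = ennreal L * ((\<integral>\<^sup>+x\<in>{s<..<y}. ?a x \<partial>lebesgue) + ennreal \<alpha> * (\<integral>\<^sup>+x\<in>{s<..<y}. ?b x \<partial>lebesgue))"
  proof -
    have a: "(\<lambda>x. ?a x * indicator {s<..<y} x) \<in> borel_measurable lebesgue" by measurable
    have b: "(\<lambda>x. ?b x * indicator {s<..<y} x) \<in> borel_measurable lebesgue"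
      using bm by (rule borel_measurable_times_ennreal) simp
    have ab: "(\<lambda>x. ennreal \<alpha> * (?b x * indicator {s<..<y} x)) \<in> borel_measurable lebesgue"
      using b by (rule borel_measurable_times_ennreal[OF borel_measurable_const])
    show ?thesis
      unfolding nn_integral_cmult[OF borel_measurable_add[OF a ab]] nn_integral_add[OF a ab] nn_integral_cmult[OF b] ..
  qed
  finally show ?thesis .
qed

text \<open>
  By additivity the increment is the integral of \<open>p - q\<close> over \<open>(0,s)\<close> plus that of \<open>p\<close> over \<open>(s,u)\<close>;
  each is estimated with \<open>|\<rho>| \<le> L / c\<close>.
\<close>

lemma increment_bound:
  assumes p: "frac_regular \<alpha> 0 t p" and q: "frac_regular \<alpha> 0 t q" and c: "0 \<le> c" and s: "0 \<le> s" "s < u" "u \<le> t"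
    and L: "\<And>x y. 0 < x \<Longrightarrow> x < y \<Longrightarrow> y \<le> t \<Longrightarrow> c * \<bar>rho y x\<bar> \<le> L"
  shows "ennreal \<bar>c * (pairing p u - pairing q s)\<bar> \<le> ennreal L *
     ((\<integral>\<^sup>+x\<in>{0<..<s}. ennreal (\<bar>p x - q x\<bar> / x powr \<alpha>) \<partial>lebesgue)
      + (\<integral>\<^sup>+x\<in>{s<..<u}. ennreal (\<bar>p x\<bar> / (x - s) powr \<alpha>) \<partial>lebesgue)
      + ennreal \<alpha> * (\<integral>\<^sup>+x\<in>{0<..<s}. (\<integral>\<^sup>+z\<in>{0<..<x}. ennreal (\<bar>p x - q x - p z + q z\<bar> / (x - z) powr (\<alpha> + 1)) \<partial>lebesgue) \<partial>lebesgue)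
      + ennreal \<alpha> * (\<integral>\<^sup>+x\<in>{s<..<u}. (\<integral>\<^sup>+z\<in>{s<..<x}. ennreal (\<bar>p x - p z\<bar> / (x - z) powr (\<alpha> + 1)) \<partial>lebesgue) \<partial>lebesgue))"
proof -
  interpret u: frac_integrator \<alpha> u C h
    using \<alpha> C holder singular s(3) by unfold_locales auto
  have [measurable]: "p \<in> borel_measurable lebesgue" "q \<in> borel_measurable lebesgue"
    using p q by (auto simp: frac_regular_def)
  have pu: "frac_regular \<alpha> 0 u p" and ps: "frac_regular \<alpha> 0 s p" and qs: "frac_regular \<alpha> 0 s q"
    using p q s by (auto intro: frac_regular_mono)
  define r where "r x = p x - q x" for x
  have [measurable]: "r \<in> borel_measurable lebesgue" unfolding r_def by measurable
  define A where "A = (LINT x:{0<..<s}|lebesgue. frac_left \<alpha> 0 r x * rho s x)"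
  define B where "B = (LINT x:{s<..<u}|lebesgue. frac_left \<alpha> s p x * rho u x)"
  have "pairing p u = pairing p s + B"
  proof (cases "s = 0")
    case True
    then show ?thesis by (simp add: pairing_def B_def set_lebesgue_integral_def)
  next
    case False
    then have "0 < s" using s by simp
    from u.stieltjes_additive[OF pu this s(2)]
    show ?thesis unfolding pairing_def B_def .
  qed
  moreover have "A = pairing p s - pairing q s"
  proof -
    have "pairing (\<lambda>x. - 1 * q x + p x) s = - 1 * pairing q s + pairing p s"
      using s by (intro pairing_linear[OF qs ps]) auto
    moreover have "(\<lambda>x. - 1 * q x + p x) = r" by (auto simp: r_def)
    ultimately show ?thesis by (simp add: A_def pairing_def)
  qed
  ultimately have "c * (pairing p u - pairing q s) = c * A + c * B"
    by (simp add: right_diff_distrib distrib_left)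
  then have "\<bar>c * (pairing p u - pairing q s)\<bar> \<le> \<bar>c * A\<bar> + \<bar>c * B\<bar>"
    by (simp only: abs_triangle_ineq)
  then have base: "ennreal \<bar>c * (pairing p u - pairing q s)\<bar> \<le> ennreal \<bar>c * A\<bar> + ennreal \<bar>c * B\<bar>"
    by (simp add: ennreal_plus[symmetric] ennreal_leI del: ennreal_plus)
  have hA: "ennreal \<bar>c * A\<bar> \<le> ennreal L * ((\<integral>\<^sup>+x\<in>{0<..<s}. ennreal (\<bar>r x\<bar> / (x - 0) powr \<alpha>) \<partial>lebesgue)
      + ennreal \<alpha> * (\<integral>\<^sup>+x\<in>{0<..<s}. (\<integral>\<^sup>+z\<in>{0<..<x}. ennreal (\<bar>r x - r z\<bar> / (x - z) powr (\<alpha> + 1)) \<partial>lebesgue) \<partial>lebesgue))"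
    unfolding A_def using c s L by (intro integral_frac_left_rho_bound) auto
  have hB: "ennreal \<bar>c * B\<bar> \<le> ennreal L * ((\<integral>\<^sup>+x\<in>{s<..<u}. ennreal (\<bar>p x\<bar> / (x - s) powr \<alpha>) \<partial>lebesgue)
      + ennreal \<alpha> * (\<integral>\<^sup>+x\<in>{s<..<u}. (\<integral>\<^sup>+z\<in>{s<..<x}. ennreal (\<bar>p x - p z\<bar> / (x - z) powr (\<alpha> + 1)) \<partial>lebesgue) \<partial>lebesgue))"
    unfolding B_def using c s L by (intro integral_frac_left_rho_bound) auto
  have e: "p x - q x - p z + q z = r x - r z" "p x - q x = r x" for x z by (simp_all add: r_def)
  show ?thesis
    unfolding e(1) unfolding e(2) using order_trans[OF base add_mono[OF hA hB]]
    by (simp only: distrib_left add_ac diff_zero)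
qed

end

section \<open>From the function spaces to integrators\<close>

lemma approach_right_end:
  fixes x t :: real
  assumes "x < t"
  obtains y :: "nat \<Rightarrow> real" where "\<And>n. x < y n" "\<And>n. y n < t" "y \<longlonglongrightarrow> t"
proof -
  \<comment> \<open>\<open>n + 2\<close> rather than \<open>n + 1\<close> keeps the first point strictly to the right of \<open>x\<close>\<close>
  define y where "y n = t - (t - x) / (real n + 2)" for n
  have "x < y n \<and> y n < t" for n
  proof -
    have "0 < (t - x) / (real n + 2)" "(t - x) / (real n + 2) < t - x"
      using assms by (auto simp: divide_less_eq)
    then show ?thesis by (auto simp: y_def)
  qed
  moreover have "y \<longlonglongrightarrow> t"
  proof -
    have "(\<lambda>n. (t - x) / (real n + 2)) \<longlonglongrightarrow> 0"
      by (intro real_tendsto_divide_at_top[OF tendsto_const] filterlim_tendsto_add_at_top[OF tendsto_const] filterlim_real_sequentially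
          | subst add.commute)+
    from tendsto_diff[OF tendsto_const[of t] this] show ?thesis by (simp add: y_def[abs_def])
  qed
  ultimately show ?thesis by (intro that[of y]) auto
qed

lemma indicator_approach:
  fixes y :: "nat \<Rightarrow> real"
  assumes "\<And>n. y n < t" "y \<longlonglongrightarrow> t"
  shows "\<forall>\<^sub>F n in sequentially. indicator {x<..<y n} z = (indicator {x<..<t} z :: 'a :: zero_neq_one)"
proof (cases "z < t")
  case True
  then have "\<forall>\<^sub>F n in sequentially. z < y n" using assms(2) by (intro order_tendstoD(1)) auto
  then show ?thesis by eventually_elim (use True in \<open>auto simp: indicator_def\<close>)
next
  case False
  then have "indicator {x<..<y n} z = (indicator {x<..<t} z :: 'a)" for n
    using assms(1)[of n] by (auto simp: indicator_def)
  then show ?thesis by simp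
qed

context frac_integrator
begin

text \<open>
  The supremum in \<open>\<Lambda>_\<alpha>(g)\<close> runs over \<open>y < t\<close> only; \<open>\<rho>_y(x)\<close> is left-continuous in \<open>y\<close>, so its
  bounds extend to the right end point.
\<close>

lemma rho_bound_at_end:
  assumes x: "0 < x" "x < t" and R: "\<And>y. x < y \<Longrightarrow> y < t \<Longrightarrow> \<bar>rho y x\<bar> \<le> R"
  shows "\<bar>rho t x\<bar> \<le> R"
proof -
  obtain y where y: "\<And>n. x < y n" "\<And>n. y n < t" "y \<longlonglongrightarrow> t"
    using approach_right_end[OF x(2)] by blast
  have hy: "(\<lambda>n. h (y n)) \<longlonglongrightarrow> h t"
  proof (rule LIM_zero_cancel, rule Lim_null_comparison)
    show "\<forall>\<^sub>F n in sequentially. norm (h (y n) - h t) \<le> C * (t - y n) powr (1 - \<alpha>)"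
    proof (intro always_eventually allI)
      fix n
      have "0 < y n" using y(1)[of n] x by linarith
      then show "norm (h (y n) - h t) \<le> C * (t - y n) powr (1 - \<alpha>)"
        using holder[of "y n" t] y(2)[of n] by (simp add: abs_minus_commute)
    qed
    have "(\<lambda>n. (t - y n) powr (1 - \<alpha>)) \<longlonglongrightarrow> (t - t) powr (1 - \<alpha>)"
      using \<alpha> y(2) by (intro tendsto_powr' tendsto_intros y(3)) (auto intro!: always_eventually less_imp_le)
    from tendsto_mult_left[OF this, of C]
    show "(\<lambda>n. C * (t - y n) powr (1 - \<alpha>)) \<longlonglongrightarrow> 0" by simp
  qed
  let ?F = "\<lambda>z. (h x - h z) / (z - x) powr (2 - \<alpha>)"
  have "set_integrable lebesgue {x<..<t} (\<lambda>z. - 1 * ((h z - h x) / (z - x) powr (2 - \<alpha>)))"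
    using singular_integrable(1)[of x t] x by (intro set_integrable_mult_right) auto
  then have F: "integrable lebesgue (\<lambda>z. indicator {x<..<t} z *\<^sub>R ?F z)"
    unfolding set_integrable_def by (rule Bochner_Integration.integrable_cong[OF refl, THEN iffD1, rotated]) (simp add: diff_divide_distrib)
  have "(\<lambda>n. LINT z|lebesgue. indicator {x<..<y n} z *\<^sub>R ?F z) \<longlonglongrightarrow> (LINT z|lebesgue. indicator {x<..<t} z *\<^sub>R ?F z)"
  proof (rule integral_dominated_convergence[where w = "\<lambda>z. \<bar>indicator {x<..<t} z *\<^sub>R ?F z\<bar>"])
    show "integrable lebesgue (\<lambda>z. \<bar>indicator {x<..<t} z *\<^sub>R ?F z\<bar>)" using F by (rule integrable_abs)
    show "AE z in lebesgue. (\<lambda>n. indicator {x<..<y n} z *\<^sub>R ?F z) \<longlonglongrightarrow> indicator {x<..<t} z *\<^sub>R ?F z"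
    proof (intro AE_I2 tendsto_eventually)
      fix z
      show "\<forall>\<^sub>F n in sequentially. indicator {x<..<y n} z *\<^sub>R ?F z = indicator {x<..<t} z *\<^sub>R ?F z"
        using indicator_approach[OF y(2,3), of x z, where 'a = real] by eventually_elim simp
    qed
    show "AE z in lebesgue. norm (indicator {x<..<y n} z *\<^sub>R ?F z) \<le> \<bar>indicator {x<..<t} z *\<^sub>R ?F z\<bar>" for n
      using y(2)[of n] by (intro AE_I2) (auto simp: indicator_def)
  qed measurable
  then have I: "(\<lambda>n. LINT z:{x<..<y n}|lebesgue. ?F z) \<longlonglongrightarrow> (LINT z:{x<..<t}|lebesgue. ?F z)"
    by (simp add: set_lebesgue_integral_def)
  have "(\<lambda>n. (h x - h (y n)) / (y n - x) powr (1 - \<alpha>) + (1 - \<alpha>) * (LINT z:{x<..<y n}|lebesgue. ?F z)) \<longlonglongrightarrow>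
      (h x - h t) / (t - x) powr (1 - \<alpha>) + (1 - \<alpha>) * (LINT z:{x<..<t}|lebesgue. ?F z)"
    using x by (intro tendsto_intros hy I y(3)) auto
  then have "(\<lambda>n. rho (y n) x) \<longlonglongrightarrow> rho t x"
    using y(1) x(2) by (simp only: rho_eq)
  then have "(\<lambda>n. \<bar>rho (y n) x\<bar>) \<longlonglongrightarrow> \<bar>rho t x\<bar>" by (rule tendsto_rabs)
  then show ?thesis by (rule LIMSEQ_le_const2) (use y R in auto)
qed

end

text \<open>
  A function that is Hoelder continuous on the open interval is uniformly continuous, hence extends
  continuously to the closed one, and the extension carries all left limits.
\<close>

lemma left_continuous_extension:
  assumes \<alpha>: "\<alpha> < 1" and C: "0 \<le> C" and T: "0 < T"
    and hol: "\<And>s t. 0 < s \<Longrightarrow> s < t \<Longrightarrow> t < T \<Longrightarrow> \<bar>g t - g s\<bar> \<le> C * (t - s) powr (1 - \<alpha>)"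
  obtains h :: "real \<Rightarrow> real" where "\<And>y. 0 < y \<Longrightarrow> y < T \<Longrightarrow> h y = g y" "continuous_on {0..T} h"
    "\<And>y. 0 < y \<Longrightarrow> y \<le> T \<Longrightarrow> Lim (at_left y) g = h y"
proof -
  have "uniformly_continuous_on {0<..<T} g"
    unfolding uniformly_continuous_on_def
  proof (intro allI impI)
    fix e :: real assume e: "0 < e"
    \<comment> \<open>chosen so that \<open>C d^(1-\<alpha>) < e\<close>; the \<open>+ 1\<close> covers \<open>C = 0\<close>\<close>
    define d where "d = (e / (C + 1)) powr (1 / (1 - \<alpha>))"
    have d: "0 < d" "d powr (1 - \<alpha>) = e / (C + 1)"
      using e C \<alpha> by (auto simp: d_def powr_powr)
    have *: "\<bar>g t - g s\<bar> < e" if "0 < s" "s < t" "t < T" "t - s < d" for s t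
    proof -
      have "\<bar>g t - g s\<bar> \<le> C * (t - s) powr (1 - \<alpha>)" using hol that by blast
      also have "\<dots> \<le> C * (e / (C + 1))"
        unfolding d(2)[symmetric] using that C \<alpha> by (intro mult_left_mono powr_mono2) auto
      also have "\<dots> < e" using e C by (simp add: field_simps)
      finally show ?thesis .
    qed
    have "dist (g x') (g x) < e" if "x \<in> {0<..<T}" "x' \<in> {0<..<T}" "dist x' x < d" for x x'
      using *[of x x'] *[of x' x] that e by (cases x x' rule: linorder_cases) (auto simp: dist_real_def abs_minus_commute)
    then show "\<exists>d>0. \<forall>x\<in>{0<..<T}. \<forall>x'\<in>{0<..<T}. dist x' x < d \<longrightarrow> dist (g x') (g x) < e"
      using d(1) by blast
  qed
  then obtain h where h: "uniformly_continuous_on (closure {0<..<T}) h" "\<And>x. x \<in> {0<..<T} \<Longrightarrow> g x = h x"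
    using uniformly_continuous_on_extension_on_closure by metis
  have c: "continuous_on {0..T} h"
    using uniformly_continuous_imp_continuous[OF h(1)] T by simp
  show ?thesis
  proof (rule that[of h])
    show "continuous_on {0..T} h" by fact
    show "h y = g y" if "0 < y" "y < T" for y using h(2) that by auto
    fix y assume y: "0 < y" "y \<le> T"
    have "(h \<longlongrightarrow> h y) (at y within {0..T})"
      using c y by (auto simp: continuous_on_def)
    then have "(h \<longlongrightarrow> h y) (at y within {0..y})"
      by (rule tendsto_within_subset) (use y in auto)
    then have "(h \<longlongrightarrow> h y) (at_left y)"
      using y by (simp add: at_within_Icc_at_left)
    moreover have "\<forall>\<^sub>F x in at_left y. h x = g x"
      using eventually_at_left_real[OF y(1)] by eventually_elim (use h(2) y in auto)
    ultimately have "(g \<longlongrightarrow> h y) (at_left y)"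
      by (rule Lim_transform_eventually)
    then show "Lim (at_left y) g = h y"
      by (intro tendsto_Lim) auto
  qed
qed

text \<open>
  Both bounds hold on \<open>(0,T)\<close> by definition of the norm and pass to the end point \<open>T\<close> by continuity
  and by Fatou's lemma.
\<close>

lemma frac_integrator_of_W_T_inf:
  assumes \<alpha>: "0 < \<alpha>" "\<alpha> < 1" and T: "0 < T" and g: "g \<in> W_T_inf \<alpha> T"
  obtains h C where "frac_integrator \<alpha> T C h" "\<And>y. 0 < y \<Longrightarrow> y < T \<Longrightarrow> h y = g y"
    "\<And>y. 0 < y \<Longrightarrow> y \<le> T \<Longrightarrow> Lim (at_left y) g = h y"
proof -
  define S where "S = (SUP s\<in>{0<..<T}. SUP t\<in>{s<..<T}.
        ennreal (\<bar>g t - g s\<bar> / (t - s) powr (1 - \<alpha>)) +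
        (\<integral>\<^sup>+ y\<in>{s<..<t}. ennreal (\<bar>g y - g s\<bar> / (y - s) powr (2 - \<alpha>)) \<partial>lebesgue))"
  have "S < \<infinity>" using g by (simp add: W_T_inf_def S_def)
  define C where "C = enn2real S"
  have S: "S = ennreal C" using \<open>S < \<infinity>\<close> by (simp add: C_def)
  have C: "0 \<le> C" by (simp add: C_def)
  have le: "ennreal (\<bar>g t - g s\<bar> / (t - s) powr (1 - \<alpha>)) +
        (\<integral>\<^sup>+ y\<in>{s<..<t}. ennreal (\<bar>g y - g s\<bar> / (y - s) powr (2 - \<alpha>)) \<partial>lebesgue) \<le> ennreal C"
    if "0 < s" "s < t" "t < T" for s t
    unfolding S[symmetric] S_def using that
    by (intro SUP_upper2[of s] SUP_upper2[of t]) auto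
  have hol: "\<bar>g t - g s\<bar> \<le> C * (t - s) powr (1 - \<alpha>)" if "0 < s" "s < t" "t < T" for s t
  proof -
    have "ennreal (\<bar>g t - g s\<bar> / (t - s) powr (1 - \<alpha>)) \<le> ennreal C"
      using le[OF that] by (rule order_trans[rotated]) simp
    then show ?thesis using that C by (simp add: ennreal_le_iff divide_le_eq)
  qed
  have sing: "(\<integral>\<^sup>+ y\<in>{s<..<t}. ennreal (\<bar>g y - g s\<bar> / (y - s) powr (2 - \<alpha>)) \<partial>lebesgue) \<le> ennreal C"
    if "0 < s" "s < t" "t < T" for s t
    using le[OF that] by (rule order_trans[rotated]) simp
  obtain h0 where h0: "\<And>y. 0 < y \<Longrightarrow> y < T \<Longrightarrow> h0 y = g y" "continuous_on {0..T} h0"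
    "\<And>y. 0 < y \<Longrightarrow> y \<le> T \<Longrightarrow> Lim (at_left y) g = h0 y"
    using left_continuous_extension[OF \<alpha>(2) C T hol] by blast
  define h where "h x = indicator {0..T} x *\<^sub>R h0 x" for x
  have h: "h y = h0 y" if "0 < y" "y \<le> T" for y using that by (simp add: h_def)
  have m[measurable]: "h \<in> borel_measurable lebesgue"
    unfolding h_def[abs_def] using borel_measurable_continuous_on_indicator[OF _ h0(2)]
    by (intro measurable_completion) auto
  have "frac_integrator \<alpha> T C h"
  proof
    show "0 < \<alpha>" "\<alpha> < 1" "0 \<le> C" "h \<in> borel_measurable lebesgue" by fact+
    show "\<bar>h y - h x\<bar> \<le> C * (y - x) powr (1 - \<alpha>)" if xy: "0 < x" "x < y" "y \<le> T" for x y
    proof (cases "y < T")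
      case True
      then show ?thesis using hol[of x y] xy by (simp add: h h0(1))
    next
      case False
      then have y: "y = T" using xy by simp
      obtain z where z: "\<And>n. x < z n" "\<And>n. z n < T" "z \<longlonglongrightarrow> T"
        using approach_right_end xy y by metis
      have zr: "\<And>n. z n \<in> {0..T}"
        using z(1,2) xy(1) by (metis atLeastAtMost_iff less_eq_real_def less_trans)
      have "(\<lambda>n. h0 (z n)) \<longlonglongrightarrow> h0 T"
        by (rule continuous_on_tendsto_compose[OF h0(2) z(3)]) (use zr T in auto)
      then have "(\<lambda>n. \<bar>h0 (z n) - h0 x\<bar>) \<longlonglongrightarrow> \<bar>h0 T - h0 x\<bar>"
        by (intro tendsto_intros)
      moreover have "(\<lambda>n. C * (z n - x) powr (1 - \<alpha>)) \<longlonglongrightarrow> C * (T - x) powr (1 - \<alpha>)"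
        using xy y by (intro tendsto_intros z(3)) auto
      moreover have "\<bar>h0 (z n) - h0 x\<bar> \<le> C * (z n - x) powr (1 - \<alpha>)" for n
        using hol[of x "z n"] h0(1)[of x] h0(1)[of "z n"] z(1)[of n] z(2)[of n] xy y by auto
      ultimately have "\<bar>h0 T - h0 x\<bar> \<le> C * (T - x) powr (1 - \<alpha>)"
        by (intro LIMSEQ_le) auto
      then show ?thesis using xy y by (simp add: h)
    qed
    show "(\<integral>\<^sup>+ z\<in>{x<..<y}. ennreal (\<bar>h z - h x\<bar> / (z - x) powr (2 - \<alpha>)) \<partial>lebesgue) \<le> ennreal C"
      if xy: "0 < x" "x < y" "y \<le> T" for x y
    proof -
      have *: "(\<integral>\<^sup>+ z\<in>{x<..<y}. ennreal (\<bar>h z - h x\<bar> / (z - x) powr (2 - \<alpha>)) \<partial>lebesgue) \<le> ennreal C"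
        if xy: "0 < x" "x < y" "y < T" for y
      proof -
        have "(\<integral>\<^sup>+ z\<in>{x<..<y}. ennreal (\<bar>h z - h x\<bar> / (z - x) powr (2 - \<alpha>)) \<partial>lebesgue)
          = (\<integral>\<^sup>+ z\<in>{x<..<y}. ennreal (\<bar>g z - g x\<bar> / (z - x) powr (2 - \<alpha>)) \<partial>lebesgue)"
          using xy by (intro nn_integral_cong) (auto simp: indicator_def h h0(1))
        then show ?thesis using sing[OF xy] by simp
      qed
      show ?thesis
      proof (cases "y < T")
        case False
        then have y: "y = T" using xy by simp
        obtain z where z: "\<And>n. x < z n" "\<And>n. z n < T" "z \<longlonglongrightarrow> T"
          using approach_right_end xy y by metis
        have "(\<integral>\<^sup>+ w\<in>{x<..<T}. ennreal (\<bar>h w - h x\<bar> / (w - x) powr (2 - \<alpha>)) \<partial>lebesgue)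
          = (\<integral>\<^sup>+ w. liminf (\<lambda>n. ennreal (\<bar>h w - h x\<bar> / (w - x) powr (2 - \<alpha>)) * indicator {x<..<z n} w) \<partial>lebesgue)"
        proof (intro nn_integral_cong)
          fix w
          have "\<forall>\<^sub>F n in sequentially. ennreal (\<bar>h w - h x\<bar> / (w - x) powr (2 - \<alpha>)) * indicator {x<..<z n} w
             = ennreal (\<bar>h w - h x\<bar> / (w - x) powr (2 - \<alpha>)) * indicator {x<..<T} w"
            using indicator_approach[OF z(2,3), of x w, where 'a = ennreal] by eventually_elim simp
          from lim_imp_Liminf[OF _ tendsto_eventually[OF this]]
          show "ennreal (\<bar>h w - h x\<bar> / (w - x) powr (2 - \<alpha>)) * indicator {x<..<T} w
            = liminf (\<lambda>n. ennreal (\<bar>h w - h x\<bar> / (w - x) powr (2 - \<alpha>)) * indicator {x<..<z n} w)" by simp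
        qed
        also have "\<dots> \<le> liminf (\<lambda>n. \<integral>\<^sup>+ w\<in>{x<..<z n}. ennreal (\<bar>h w - h x\<bar> / (w - x) powr (2 - \<alpha>)) \<partial>lebesgue)"
          by (rule nn_integral_liminf) measurable
        also have "\<dots> \<le> ennreal C"
          using *[OF xy(1)] z by (intro Liminf_le always_eventually) auto
        finally show ?thesis by (simp add: y)
      qed (use * xy in auto)
    qed
  qed
  then show ?thesis using that[of C h] h h0 by auto
qed

lemma frac_regular_of_W_0_one:
  assumes \<alpha>: "0 < \<alpha>" and f: "f \<in> W_0_one \<alpha> T"
  shows "frac_regular \<alpha> 0 T (\<lambda>x. if x \<in> {0..T} then f x else 0)"
proof -
  define F where "F = (\<lambda>x. if x \<in> {0..T} then f x else 0)"
  have [measurable]: "F \<in> borel_measurable lebesgue"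
    unfolding F_def using f borel_measurable_if[of "{0..T}" f] by (simp add: W_0_one_def)
  have n1: "(\<integral>\<^sup>+ s\<in>{0<..<T}. ennreal (\<bar>f s\<bar> / s powr \<alpha>) \<partial>lebesgue) < \<infinity>"
    and n2: "(\<integral>\<^sup>+ s\<in>{0<..<T}. (\<integral>\<^sup>+ y\<in>{0<..<s}. ennreal (\<bar>f s - f y\<bar> / (s - y) powr (\<alpha> + 1)) \<partial>lebesgue) \<partial>lebesgue) < \<infinity>"
    using f by (auto simp: W_0_one_def)
  show ?thesis
    unfolding frac_regular_def F_def[symmetric]
  proof (intro conjI)
    show "set_integrable lebesgue {0<..<T} (\<lambda>x. F x * (x - 0) powr -\<alpha>)"
      unfolding set_integrable_def
    proof (rule integrableI_bounded)
      have "(\<integral>\<^sup>+ x. ennreal (norm (indicator {0<..<T} x *\<^sub>R (F x * (x - 0) powr -\<alpha>))) \<partial>lebesgue)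
        = (\<integral>\<^sup>+ s\<in>{0<..<T}. ennreal (\<bar>f s\<bar> / s powr \<alpha>) \<partial>lebesgue)"
        by (intro nn_integral_cong) (auto simp: F_def indicator_def abs_mult powr_minus_divide)
      then show "(\<integral>\<^sup>+ x. ennreal (norm (indicator {0<..<T} x *\<^sub>R (F x * (x - 0) powr -\<alpha>))) \<partial>lebesgue) < \<infinity>"
        using n1 by simp
    qed measurable
    show "integrable LL (\<lambda>(x, y). (F x - F y) * tri \<alpha> 0 T x y)"
    proof (rule integrableI_bounded)
      have "(\<integral>\<^sup>+ p. ennreal (norm (case p of (x, y) \<Rightarrow> (F x - F y) * tri \<alpha> 0 T x y)) \<partial>LL)
        = (\<integral>\<^sup>+ x. \<integral>\<^sup>+ y. ennreal (norm ((F x - F y) * tri \<alpha> 0 T x y)) \<partial>lebesgue \<partial>lebesgue)"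
      proof -
        have "(\<lambda>(x, y). (F x - F y) * tri \<alpha> 0 T x y) \<in> borel_measurable LL" by measurable
        from measurable_compose[OF measurable_compose[OF this borel_measurable_norm] measurable_ennreal]
        have "(\<lambda>p. ennreal (norm (case p of (x, y) \<Rightarrow> (F x - F y) * tri \<alpha> 0 T x y))) \<in> borel_measurable LL"
          by simp
        from sigma_finite_measure.nn_integral_fst[OF sigma_finite_lebesgue this] show ?thesis by simp
      qed
      also have "\<dots> = (\<integral>\<^sup>+ s\<in>{0<..<T}. (\<integral>\<^sup>+ y\<in>{0<..<s}. ennreal (\<bar>f s - f y\<bar> / (s - y) powr (\<alpha> + 1)) \<partial>lebesgue) \<partial>lebesgue)"
      proof (intro nn_integral_cong)
        fix x
        show "(\<integral>\<^sup>+ y. ennreal (norm ((F x - F y) * tri \<alpha> 0 T x y)) \<partial>lebesgue)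
          = (\<integral>\<^sup>+ y\<in>{0<..<x}. ennreal (\<bar>f x - f y\<bar> / (x - y) powr (\<alpha> + 1)) \<partial>lebesgue) * indicator {0<..<T} x"
        proof (cases "x \<in> {0<..<T}")
          case True
          then show ?thesis by (auto intro!: nn_integral_cong simp: F_def tri_def indicator_def)
        qed (auto simp: tri_zero)
      qed
      finally show "(\<integral>\<^sup>+ p. ennreal (norm (case p of (x, y) \<Rightarrow> (F x - F y) * tri \<alpha> 0 T x y)) \<partial>LL) < \<infinity>"
        using n2 by simp
    qed measurable
  qed fact
qed

section \<open>Integration against the weight in time\<close>

text \<open>
  For arbitrary \<open>f\<close> the integral is a lower integral, and multiplication by a
  positive constant is a bijection between the simple functions below \<open>f\<close> and below \<open>c f\<close>.
\<close>

lemma nn_integral_cmult_any: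
  assumes "0 < c"
  shows "(\<integral>\<^sup>+x. ennreal c * f x \<partial>M) = ennreal c * (\<integral>\<^sup>+x. f x \<partial>M)"
proof -
  have le: "(\<integral>\<^sup>+x. ennreal c * f x \<partial>M) \<le> ennreal c * (\<integral>\<^sup>+x. f x \<partial>M)" if c: "0 < c" for c f
    unfolding nn_integral_def[of M "\<lambda>x. ennreal c * f x"]
  proof (rule SUP_least)
    fix g assume "g \<in> {g. simple_function M g \<and> g \<le> (\<lambda>x. ennreal c * f x)}"
    then have g: "simple_function M g" "\<And>x. g x \<le> ennreal c * f x" by (auto simp: le_fun_def)
    have [measurable]: "g \<in> borel_measurable M" using g(1) by (rule borel_measurable_simple_function)
    have cc: "ennreal c * (ennreal (1 / c) * z) = z" for z
      using c by (simp add: mult.assoc[symmetric] ennreal_mult[symmetric])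
    have "ennreal (1 / c) * g x \<le> f x" for x
    proof -
      have "ennreal (1 / c) * g x \<le> ennreal (1 / c) * (ennreal c * f x)"
        using g(2) by (intro mult_left_mono) auto
      also have "\<dots> = f x" using c by (simp add: mult.assoc[symmetric] ennreal_mult[symmetric])
      finally show ?thesis .
    qed
    then have "(\<integral>\<^sup>+x. ennreal (1 / c) * g x \<partial>M) \<le> (\<integral>\<^sup>+x. f x \<partial>M)" by (intro nn_integral_mono)
    then have "ennreal c * (\<integral>\<^sup>+x. ennreal (1 / c) * g x \<partial>M) \<le> ennreal c * (\<integral>\<^sup>+x. f x \<partial>M)"
      by (intro mult_left_mono) auto
    moreover have "ennreal c * (\<integral>\<^sup>+x. ennreal (1 / c) * g x \<partial>M) = integral\<^sup>S M g"
      using g(1) by (simp add: nn_integral_cmult cc nn_integral_eq_simple_integral)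
    ultimately show "integral\<^sup>S M g \<le> ennreal c * (\<integral>\<^sup>+x. f x \<partial>M)" by simp
  qed
  show ?thesis
  proof (rule antisym[OF le[OF assms]])
    have "(\<integral>\<^sup>+x. f x \<partial>M) = (\<integral>\<^sup>+x. ennreal (1 / c) * (ennreal c * f x) \<partial>M)"
      using assms by (simp add: mult.assoc[symmetric] ennreal_mult[symmetric])
    also have "\<dots> \<le> ennreal (1 / c) * (\<integral>\<^sup>+x. ennreal c * f x \<partial>M)"
      using assms by (intro le) auto
    finally have "ennreal c * (\<integral>\<^sup>+x. f x \<partial>M) \<le> ennreal c * (ennreal (1 / c) * (\<integral>\<^sup>+x. ennreal c * f x \<partial>M))"
      by (intro mult_left_mono) auto
    also have "\<dots> = (\<integral>\<^sup>+x. ennreal c * f x \<partial>M)"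
      using assms by (simp add: mult.assoc[symmetric] ennreal_mult[symmetric])
    finally show "ennreal c * (\<integral>\<^sup>+x. f x \<partial>M) \<le> (\<integral>\<^sup>+x. ennreal c * f x \<partial>M)" .
  qed
qed

text \<open>
  A simple function \<open>g\<close> below \<open>b + a\<close> splits as \<open>g = b + (g - b)\<close> up to an inequality, with a
  measurable second part below \<open>a\<close>. Of \<open>a\<close> only the lower integral enters.
\<close>

lemma nn_integral_add_le_any:
  assumes [measurable]: "b \<in> borel_measurable M"
  shows "(\<integral>\<^sup>+x. b x + a x \<partial>M) \<le> (\<integral>\<^sup>+x. b x \<partial>M) + (\<integral>\<^sup>+x. a x \<partial>M)"
  unfolding nn_integral_def_finite[of M "\<lambda>x. b x + a x"]
proof (rule SUP_least)
  fix g assume "g \<in> {g. simple_function M g \<and> g \<le> (\<lambda>x. b x + a x) \<and> (\<forall>x. g x < top)}"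
  then have g: "simple_function M g" "\<And>x. g x \<le> b x + a x" "\<And>x. g x < top" by (auto simp: le_fun_def)
  have [measurable]: "g \<in> borel_measurable M" using g(1) by (rule borel_measurable_simple_function)
  have "g x - b x \<le> a x" for x
    using g(2)[of x] g(3)[of x] by (auto simp: ennreal_minus_le_iff)
  then have "(\<integral>\<^sup>+x. g x - b x \<partial>M) \<le> (\<integral>\<^sup>+x. a x \<partial>M)" by (intro nn_integral_mono)
  moreover have "integral\<^sup>S M g \<le> (\<integral>\<^sup>+x. b x + (g x - b x) \<partial>M)"
    unfolding nn_integral_eq_simple_integral[OF g(1), symmetric]
  proof (intro nn_integral_mono)
    show "g x \<le> b x + (g x - b x)" for x
      using ennreal_minus_le_iff[of "g x" "b x" "g x - b x"] by simp
  qed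
  ultimately show "integral\<^sup>S M g \<le> (\<integral>\<^sup>+x. b x \<partial>M) + (\<integral>\<^sup>+x. a x \<partial>M)"
    by (subst (asm) nn_integral_add) (auto intro: order_trans add_left_mono)
qed


lemma swap_triangle:
  fixes F :: "real \<Rightarrow> real \<Rightarrow> ennreal" and a b :: real
  assumes [measurable]: "(\<lambda>p. F (fst p) (snd p)) \<in> borel_measurable LL"
  shows "(\<integral>\<^sup>+s\<in>{a<..<b}. (\<integral>\<^sup>+u\<in>{s<..<b}. F s u \<partial>lebesgue) \<partial>lebesgue)
    = (\<integral>\<^sup>+u\<in>{a<..<b}. (\<integral>\<^sup>+s\<in>{a<..<u}. F s u \<partial>lebesgue) \<partial>lebesgue)"
proof -
  let ?G = "\<lambda>s u. F s u * (if a < s \<and> s < u \<and> u < b then 1 else 0)"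
  have 1: "(\<integral>\<^sup>+u\<in>{s<..<b}. F s u \<partial>lebesgue) * indicator {a<..<b} s = (\<integral>\<^sup>+u. ?G s u \<partial>lebesgue)" for s
  proof (cases "a < s \<and> s < b")
    case True
    then show ?thesis by (auto intro!: nn_integral_cong simp: indicator_def)
  next
    case False
    then have "?G s = (\<lambda>_. 0)" by (auto simp: fun_eq_iff)
    then show ?thesis using False by simp
  qed
  have 2: "(\<integral>\<^sup>+s\<in>{a<..<u}. F s u \<partial>lebesgue) * indicator {a<..<b} u = (\<integral>\<^sup>+s. ?G s u \<partial>lebesgue)" for u
  proof (cases "a < u \<and> u < b")
    case True
    then show ?thesis by (auto intro!: nn_integral_cong simp: indicator_def)
  next
    case False
    then have "(\<lambda>s. ?G s u) = (\<lambda>_. 0)" by (auto simp: fun_eq_iff)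
    then show ?thesis using False by simp
  qed
  have "(\<lambda>(s, u). ?G s u) \<in> borel_measurable LL" by measurable
  then show ?thesis unfolding 1 2 by (rule leb.Fubini'[symmetric])
qed

lemma nn_ftc:
  fixes F f :: "real \<Rightarrow> real"
  assumes "a \<le> b" "continuous_on {a..b} F"
    and "\<And>x. a < x \<Longrightarrow> x < b \<Longrightarrow> (F has_real_derivative f x) (at x)"
    and "\<And>x. a < x \<Longrightarrow> x < b \<Longrightarrow> 0 \<le> f x"
  shows "(\<integral>\<^sup>+x\<in>{a<..<b}. ennreal (f x) \<partial>lebesgue) = ennreal (F b - F a)"
proof -
  note F = ftc_nonneg[OF assms]
  have "(\<integral>\<^sup>+x\<in>{a<..<b}. ennreal (f x) \<partial>lebesgue) = (\<integral>\<^sup>+x. ennreal (indicator {a<..<b} x *\<^sub>R f x) \<partial>lebesgue)"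
    by (intro nn_integral_cong) (auto simp: indicator_def)
  also have "\<dots> = ennreal (LINT x:{a<..<b}|lebesgue. f x)"
    unfolding set_lebesgue_integral_def using F(1) assms(4)
    by (intro nn_integral_eq_integral) (auto simp: set_integrable_def indicator_def)
  finally show ?thesis by (simp only: F(2))
qed

lemma time_weight_early:
  assumes "0 < \<alpha>" "\<alpha> < \<mu>" "u < t"
  shows "(\<integral>\<^sup>+s\<in>{u<..<t}. ennreal ((t - s) powr \<mu> * (1 / (t - s) powr (\<alpha> + 1))) \<partial>lebesgue) = ennreal ((t - u) powr (\<mu> - \<alpha>) / (\<mu> - \<alpha>))"
proof -
  have "(\<integral>\<^sup>+s\<in>{u<..<t}. ennreal ((t - s) powr \<mu> * (1 / (t - s) powr (\<alpha> + 1))) \<partial>lebesgue)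
    = ennreal (- ((t - t) powr (\<mu> - \<alpha>) / (\<mu> - \<alpha>)) - - ((t - u) powr (\<mu> - \<alpha>) / (\<mu> - \<alpha>)))"
  proof (rule nn_ftc)
    show "continuous_on {u..t} (\<lambda>s. - ((t - s) powr (\<mu> - \<alpha>) / (\<mu> - \<alpha>)))"
      using assms by (intro continuous_intros continuous_on_powr') auto
    fix s assume s: "u < s" "s < t"
    have "(t - s) powr (\<mu> - \<alpha> - 1) = (t - s) powr \<mu> * (1 / (t - s) powr (\<alpha> + 1))"
      using powr_diff[of "t - s" \<mu> "\<alpha> + 1"] by (simp add: diff_diff_eq)
    moreover have "((\<lambda>s. - ((t - s) powr (\<mu> - \<alpha>) / (\<mu> - \<alpha>))) has_real_derivative (t - s) powr (\<mu> - \<alpha> - 1)) (at s)"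
      using s assms by (auto intro!: derivative_eq_intros)
    ultimately show "((\<lambda>s. - ((t - s) powr (\<mu> - \<alpha>) / (\<mu> - \<alpha>))) has_real_derivative (t - s) powr \<mu> * (1 / (t - s) powr (\<alpha> + 1))) (at s)"
      by (simp only:)
  qed (use assms in auto)
  then show ?thesis by simp
qed

lemma time_weight_tail:
  assumes "0 < \<alpha>" "p \<le> q" "q < t"
  shows "(\<integral>\<^sup>+s\<in>{p<..<q}. ennreal (1 / (t - s) powr (\<alpha> + 1)) \<partial>lebesgue) \<le> ennreal ((t - q) powr -\<alpha> / \<alpha>)"
proof -
  note K = integral_power_kernel_left[OF assms]
  have "(\<integral>\<^sup>+s\<in>{p<..<q}. ennreal (1 / (t - s) powr (\<alpha> + 1)) \<partial>lebesgue) = (\<integral>\<^sup>+s. ennreal (indicator {p<..<q} s *\<^sub>R (1 / (t - s) powr (\<alpha> + 1))) \<partial>lebesgue)"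
    by (intro nn_integral_cong) (auto simp: indicator_def)
  also have "\<dots> = ennreal (LINT s:{p<..<q}|lebesgue. 1 / (t - s) powr (\<alpha> + 1))"
    unfolding set_lebesgue_integral_def using K(1)
    by (intro nn_integral_eq_integral) (auto simp: set_integrable_def)
  also have "\<dots> \<le> ennreal ((t - q) powr -\<alpha> / \<alpha>)"
    unfolding K(2) using assms by (intro ennreal_leI divide_right_mono) auto
  finally show ?thesis .
qed

text \<open>
  By scaling the full integral is a multiple of \<open>(t-u)^(-2\<alpha>)\<close>. The constant comes from splitting at
  distance \<open>t - u\<close> from \<open>u\<close>: closer to \<open>u\<close> the factor \<open>(t-s)^(-\<alpha>-1)\<close> is at most
  \<open>(t-u)^(-\<alpha>-1)\<close>, farther away it is at most \<open>(u-s)^(-\<alpha>-1)\<close>.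
\<close>

lemma time_weight_singular:
  assumes \<alpha>: "0 < \<alpha>" "\<alpha> < 1" and u: "0 < u" "u < t"
  shows "(\<integral>\<^sup>+s\<in>{0<..<u}. ennreal (1 / (u - s) powr \<alpha> * (1 / (t - s) powr (\<alpha> + 1))) \<partial>lebesgue)
    \<le> ennreal ((1 / (1 - \<alpha>) + 1 / (2 * \<alpha>)) * (t - u) powr (- 2 * \<alpha>))"
proof -
  \<comment> \<open>the point at distance \<open>t - u\<close> to the left of \<open>u\<close>, or \<open>0\<close> if it lies outside the interval\<close>
  define m where "m = max 0 (u - (t - u))"
  have m: "0 \<le> m" "m < u" "u - m \<le> t - u" using u by (auto simp: m_def)
  let ?f = "\<lambda>s. ennreal (1 / (u - s) powr \<alpha> * (1 / (t - s) powr (\<alpha> + 1)))"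
  have near: "?f s \<le> ennreal ((t - u) powr (-\<alpha> - 1)) * ennreal ((u - s) powr -\<alpha>)" if "s \<in> {m<..<u}" for s
  proof -
    have "(t - s) powr (-\<alpha> - 1) \<le> (t - u) powr (-\<alpha> - 1)"
      using that u \<alpha> by (intro powr_mono2') auto
    moreover have "1 / (t - s) powr (\<alpha> + 1) = (t - s) powr (-\<alpha> - 1)"
      using powr_minus_divide[of "t - s" "\<alpha> + 1"] by simp
    moreover have "1 / (u - s) powr \<alpha> = (u - s) powr -\<alpha>" by (simp add: powr_minus_divide)
    ultimately show ?thesis
      by (simp add: ennreal_mult[symmetric] mult.commute mult_left_mono ennreal_leI del: powr_minus_divide)
  qed
  have far: "?f s \<le> ennreal (1 / (u - s) powr (2 * \<alpha> + 1))" if "s \<in> {0<..<m}" for s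
  proof -
    have s: "0 < u - s" "u - s \<le> t - s" using that m u by auto
    then have "1 / (t - s) powr (\<alpha> + 1) \<le> 1 / (u - s) powr (\<alpha> + 1)"
      using \<alpha> by (intro divide_left_mono powr_mono2) auto
    then have "1 / (u - s) powr \<alpha> * (1 / (t - s) powr (\<alpha> + 1)) \<le> 1 / (u - s) powr \<alpha> * (1 / (u - s) powr (\<alpha> + 1))"
      by (intro mult_left_mono) auto
    also have "\<dots> = 1 / (u - s) powr (2 * \<alpha> + 1)"
      using powr_add[of "u - s" \<alpha> "\<alpha> + 1"] by simp
    finally show ?thesis by (rule ennreal_leI)
  qed
  have "(\<integral>\<^sup>+s\<in>{0<..<u}. ?f s \<partial>lebesgue) \<le>
    (\<integral>\<^sup>+s. ennreal ((t - u) powr (-\<alpha> - 1)) * (ennreal ((u - s) powr -\<alpha>) * indicator {m<..<u} s) + ennreal (1 / (u - s) powr (2 * \<alpha> + 1)) * indicator {0<..<m} s \<partial>lebesgue)"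
  proof (rule nn_integral_mono_AE)
    show "AE s in lebesgue. ?f s * indicator {0<..<u} s \<le> ennreal ((t - u) powr (-\<alpha> - 1)) * (ennreal ((u - s) powr -\<alpha>) * indicator {m<..<u} s)
      + ennreal (1 / (u - s) powr (2 * \<alpha> + 1)) * indicator {0<..<m} s"
      using AE_lebesgue_neq[of m]
    proof eventually_elim
      fix s assume "s \<noteq> m"
      then consider "s \<in> {0<..<m}" | "s \<in> {m<..<u}" | "s \<notin> {0<..<u}" using m by force
      then show "?f s * indicator {0<..<u} s \<le> ennreal ((t - u) powr (-\<alpha> - 1)) * (ennreal ((u - s) powr -\<alpha>) * indicator {m<..<u} s)
      + ennreal (1 / (u - s) powr (2 * \<alpha> + 1)) * indicator {0<..<m} s"
      proof cases
        case 1 then show ?thesis using far[OF 1] m by simp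
      next
        case 2 then show ?thesis using near[OF 2] m by simp
      qed auto
    qed
  qed
  also have "\<dots> = ennreal ((t - u) powr (-\<alpha> - 1)) * (\<integral>\<^sup>+s\<in>{m<..<u}. ennreal ((u - s) powr -\<alpha>) \<partial>lebesgue)
     + (\<integral>\<^sup>+s\<in>{0<..<m}. ennreal (1 / (u - s) powr (2 * \<alpha> + 1)) \<partial>lebesgue)"
    by (subst nn_integral_add) (auto simp: nn_integral_cmult)
  also have "\<dots> \<le> ennreal ((t - u) powr (-\<alpha> - 1)) * ennreal ((t - u) powr (1 - \<alpha>) / (1 - \<alpha>)) + ennreal ((t - u) powr (- (2 * \<alpha>)) / (2 * \<alpha>))"
  proof (intro add_mono mult_left_mono)
    have "(\<integral>\<^sup>+s\<in>{m<..<u}. ennreal ((u - s) powr -\<alpha>) \<partial>lebesgue) = ennreal (- ((u - u) powr (1 - \<alpha>) / (1 - \<alpha>)) - - ((u - m) powr (1 - \<alpha>) / (1 - \<alpha>)))"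
    proof (rule nn_ftc)
      show "continuous_on {m..u} (\<lambda>s. - ((u - s) powr (1 - \<alpha>) / (1 - \<alpha>)))"
        using \<alpha> by (intro continuous_intros continuous_on_powr') auto
      show "((\<lambda>s. - ((u - s) powr (1 - \<alpha>) / (1 - \<alpha>))) has_real_derivative (u - s) powr -\<alpha>) (at s)" if "m < s" "s < u" for s
        using that \<alpha> by (auto intro!: derivative_eq_intros)
    qed (use m in auto)
    also have "\<dots> \<le> ennreal ((t - u) powr (1 - \<alpha>) / (1 - \<alpha>))"
      using m \<alpha> by (auto intro!: ennreal_leI divide_right_mono powr_mono2)
    finally show "(\<integral>\<^sup>+s\<in>{m<..<u}. ennreal ((u - s) powr -\<alpha>) \<partial>lebesgue) \<le> ennreal ((t - u) powr (1 - \<alpha>) / (1 - \<alpha>))" .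
    show "(\<integral>\<^sup>+s\<in>{0<..<m}. ennreal (1 / (u - s) powr (2 * \<alpha> + 1)) \<partial>lebesgue) \<le> ennreal ((t - u) powr (- (2 * \<alpha>)) / (2 * \<alpha>))"
    proof (cases "m = 0")
      case False
      then have eq: "u - m = t - u" by (auto simp: m_def)
      show ?thesis using time_weight_tail[of "2 * \<alpha>" 0 m u, unfolded eq] m \<alpha> by simp
    qed simp
  qed simp
  also have "\<dots> = ennreal ((1 / (1 - \<alpha>) + 1 / (2 * \<alpha>)) * (t - u) powr (- 2 * \<alpha>))"
  proof -
    have "(t - u) powr (-\<alpha> - 1) * (t - u) powr (1 - \<alpha>) = (t - u) powr (- 2 * \<alpha>)"
      by (simp add: powr_add[symmetric])
    then have "(t - u) powr (-\<alpha> - 1) * ((t - u) powr (1 - \<alpha>) / (1 - \<alpha>)) + (t - u) powr (- (2 * \<alpha>)) / (2 * \<alpha>) = (1 / (1 - \<alpha>) + 1 / (2 * \<alpha>)) * (t - u) powr (- 2 * \<alpha>)"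
      by (simp add: distrib_right)
    moreover have "ennreal ((t - u) powr (-\<alpha> - 1)) * ennreal ((t - u) powr (1 - \<alpha>) / (1 - \<alpha>)) + ennreal ((t - u) powr (- (2 * \<alpha>)) / (2 * \<alpha>))
       = ennreal ((t - u) powr (-\<alpha> - 1) * ((t - u) powr (1 - \<alpha>) / (1 - \<alpha>)) + (t - u) powr (- (2 * \<alpha>)) / (2 * \<alpha>))"
      using \<alpha> by (simp add: ennreal_mult[symmetric] ennreal_plus[symmetric] del: ennreal_plus)
    ultimately show ?thesis by simp
  qed
  finally show ?thesis .
qed

text \<open>
  Each term of the increment bound is integrated against \<open>(t-s)^(-\<alpha>-1)\<close> with the order of
  integration exchanged, so that only explicit powers of \<open>s\<close> remain. The weights
  \<open>(t-u)^(-\<alpha>)\<close> and \<open>1\<close> that arise are absorbed into \<open>(t-u)^(-2\<alpha>) + u^(-\<alpha>)\<close> at the cost of \<open>T^\<alpha>\<close>.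
  The term \<open>H\<close> is carried along unchanged, through its lower integral.
\<close>

lemma time_integrated_bound:
  fixes \<Phi> H k a :: "real \<Rightarrow> ennreal" and b :: "real \<Rightarrow> real \<Rightarrow> ennreal"
  assumes \<alpha>: "0 < \<alpha>" "\<alpha> < 1" and \<mu>: "\<alpha> < \<mu>" and t: "0 < t" "t \<le> T" and L: "0 \<le> L"
    and [measurable]: "k \<in> borel_measurable lebesgue" "a \<in> borel_measurable lebesgue"
      "(\<lambda>p. b (fst p) (snd p)) \<in> borel_measurable LL"
    and le: "\<And>s. 0 \<le> s \<Longrightarrow> s < t \<Longrightarrow> \<Phi> s \<le> ennreal L *
      (ennreal ((t - s) powr \<mu>) * (\<integral>\<^sup>+u\<in>{0<..<s}. k u \<partial>lebesgue)
       + (\<integral>\<^sup>+u\<in>{s<..<t}. a u * ennreal (1 / (u - s) powr \<alpha>) \<partial>lebesgue)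
       + ennreal \<alpha> * H s
       + ennreal \<alpha> * (\<integral>\<^sup>+u\<in>{s<..<t}. (\<integral>\<^sup>+y\<in>{s<..<u}. b u y \<partial>lebesgue) \<partial>lebesgue))"
    and H0: "H 0 = 0"
  shows "\<Phi> 0 + (\<integral>\<^sup>+s\<in>{0<..<t}. \<Phi> s * ennreal (1 / (t - s) powr (\<alpha> + 1)) \<partial>lebesgue) \<le> ennreal L *
      (ennreal (1 / (\<mu> - \<alpha>)) * (\<integral>\<^sup>+u\<in>{0<..<t}. k u * ennreal ((t - u) powr (\<mu> - \<alpha>)) \<partial>lebesgue)
       + ennreal (1 + (1 / (1 - \<alpha>) + 1 / (2 * \<alpha>)) + T powr \<alpha>) * (\<integral>\<^sup>+u\<in>{0<..<t}. ennreal ((t - u) powr (- 2 * \<alpha>) + u powr -\<alpha>)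
           * (a u + (\<integral>\<^sup>+y\<in>{0<..<u}. b u y \<partial>lebesgue)) \<partial>lebesgue)
       + ennreal \<alpha> * (\<integral>\<^sup>+s\<in>{0<..<t}. H s * ennreal (1 / (t - s) powr (\<alpha> + 1)) \<partial>lebesgue))"
proof (cases "L = 0")
  case True
  \<comment> \<open>treated apart because the constant has to be positive to be moved out of a lower integral\<close>
  then have 0: "\<Phi> s = 0" if "0 \<le> s" "s < t" for s using le[OF that] by simp
  have "(\<integral>\<^sup>+s\<in>{0<..<t}. \<Phi> s * ennreal (1 / (t - s) powr (\<alpha> + 1)) \<partial>lebesgue) = (\<integral>\<^sup>+s. 0 \<partial>(lebesgue :: real measure))"
    by (intro nn_integral_cong) (auto simp: indicator_def 0)
  then show ?thesis using 0[of 0] t by simp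
next
  case False
  then have L: "0 < L" using L by simp
  define w where "w s = ennreal (1 / (t - s) powr (\<alpha> + 1))" for s
  define B where "B u = (\<integral>\<^sup>+y\<in>{0<..<u}. b u y \<partial>lebesgue)" for u
  define c2 where "c2 = 1 / (1 - \<alpha>) + 1 / (2 * \<alpha>)"
  define C4 where "C4 = 1 + c2 + T powr \<alpha>"
  have c2: "0 < c2" using \<alpha> by (auto simp: c2_def intro!: add_pos_pos)
  have [measurable]: "w \<in> borel_measurable lebesgue" unfolding w_def by measurable
  have b_meas[measurable]: "b u \<in> borel_measurable lebesgue" for u
    using measurable_compose[OF measurable_Pair1' assms(9), of u] by simp
  have [measurable]: "B \<in> borel_measurable lebesgue"
  proof -
    have "B = (\<lambda>u. \<integral>\<^sup>+y. b u y * (if 0 < y \<and> y < u then 1 else 0) \<partial>lebesgue)"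
      by (auto simp: B_def fun_eq_iff indicator_def intro!: nn_integral_cong)
    also have "\<dots> \<in> borel_measurable lebesgue" by measurable
    finally show ?thesis .
  qed
  define X1 where "X1 s = w s * (ennreal ((t - s) powr \<mu>) * (\<integral>\<^sup>+u\<in>{0<..<s}. k u \<partial>lebesgue))" for s
  define X2 where "X2 s = w s * (\<integral>\<^sup>+u\<in>{s<..<t}. a u * ennreal (1 / (u - s) powr \<alpha>) \<partial>lebesgue)" for s
  define X4 where "X4 s = w s * (\<integral>\<^sup>+u\<in>{s<..<t}. (\<integral>\<^sup>+y\<in>{s<..<u}. b u y \<partial>lebesgue) \<partial>lebesgue)" for s
  have [measurable]: "X1 \<in> borel_measurable lebesgue"
  proof -
    have "X1 = (\<lambda>s. w s * (ennreal ((t - s) powr \<mu>) * (\<integral>\<^sup>+u. k u * (if 0 < u \<and> u < s then 1 else 0) \<partial>lebesgue)))"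
      by (auto simp: X1_def fun_eq_iff indicator_def intro!: nn_integral_cong arg_cong2[where f = "(*)"])
    also have "\<dots> \<in> borel_measurable lebesgue" by measurable
    finally show ?thesis .
  qed
  have [measurable]: "X2 \<in> borel_measurable lebesgue"
  proof -
    have "X2 = (\<lambda>s. w s * (\<integral>\<^sup>+u. a u * ennreal (1 / (u - s) powr \<alpha>) * (if s < u \<and> u < t then 1 else 0) \<partial>lebesgue))"
      by (auto simp: X2_def fun_eq_iff indicator_def intro!: nn_integral_cong arg_cong2[where f = "(*)"])
    also have "\<dots> \<in> borel_measurable lebesgue" by measurable
    finally show ?thesis .
  qed
  have [measurable]: "(\<lambda>p. \<integral>\<^sup>+y\<in>{fst p<..<snd p}. b (snd p) y \<partial>lebesgue) \<in> borel_measurable LL"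
  proof -
    have "(\<lambda>p. \<integral>\<^sup>+y\<in>{fst p<..<snd p}. b (snd p) y \<partial>lebesgue) = (\<lambda>p. \<integral>\<^sup>+y. b (snd p) y * (if fst p < y \<and> y < snd p then 1 else 0) \<partial>lebesgue)"
      by (auto simp: fun_eq_iff indicator_def intro!: nn_integral_cong)
    also have "\<dots> \<in> borel_measurable LL"
    proof -
      have 1: "(\<lambda>q. (snd (fst q), snd q)) \<in> LL \<Otimes>\<^sub>M lebesgue \<rightarrow>\<^sub>M LL" by measurable
      have [measurable]: "(\<lambda>q. b (snd (fst q)) (snd q)) \<in> borel_measurable (LL \<Otimes>\<^sub>M (lebesgue :: real measure))"
        using measurable_compose[OF 1 assms(9)] by simp
      have [measurable]: "(\<lambda>q. fst (fst q)) \<in> borel_measurable (LL \<Otimes>\<^sub>M (lebesgue :: real measure))"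
        "(\<lambda>q. snd (fst q)) \<in> borel_measurable (LL \<Otimes>\<^sub>M (lebesgue :: real measure))"
        "(\<lambda>q. snd q) \<in> borel_measurable (LL \<Otimes>\<^sub>M (lebesgue :: real measure))"
        by (rule measurable_compose[OF measurable_fst measurable_fst_lebesgue] measurable_compose[OF measurable_fst measurable_snd_lebesgue]
            measurable_compose[OF measurable_snd measurable_id_lebesgue])+
      show ?thesis by measurable
    qed
    finally show ?thesis .
  qed
  have [measurable]: "X4 \<in> borel_measurable lebesgue"
  proof -
    have "X4 = (\<lambda>s. w s * (\<integral>\<^sup>+u. (\<integral>\<^sup>+y\<in>{fst (s, u)<..<snd (s, u)}. b (snd (s, u)) y \<partial>lebesgue) * (if s < u \<and> u < t then 1 else 0) \<partial>lebesgue))"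
      by (auto simp: X4_def fun_eq_iff indicator_def intro!: nn_integral_cong arg_cong2[where f = "(*)"])
    also have "\<dots> \<in> borel_measurable lebesgue" by measurable
    finally show ?thesis .
  qed

  have I1: "(\<integral>\<^sup>+s\<in>{0<..<t}. X1 s \<partial>lebesgue) = ennreal (1 / (\<mu> - \<alpha>)) * (\<integral>\<^sup>+u\<in>{0<..<t}. k u * ennreal ((t - u) powr (\<mu> - \<alpha>)) \<partial>lebesgue)"
  proof -
    let ?F = "\<lambda>u s. k u * ennreal ((t - s) powr \<mu> * (1 / (t - s) powr (\<alpha> + 1)))"
    have "(\<integral>\<^sup>+s\<in>{0<..<t}. X1 s \<partial>lebesgue) = (\<integral>\<^sup>+s\<in>{0<..<t}. (\<integral>\<^sup>+u\<in>{0<..<s}. ?F u s \<partial>lebesgue) \<partial>lebesgue)"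
    proof (intro nn_integral_cong arg_cong2[where f = "(*)"] refl)
      fix s
      have "X1 s = ennreal ((t - s) powr \<mu> * (1 / (t - s) powr (\<alpha> + 1))) * (\<integral>\<^sup>+u\<in>{0<..<s}. k u \<partial>lebesgue)"
      proof -
        have "ennreal ((t - s) powr \<mu> * (1 / (t - s) powr (\<alpha> + 1))) = ennreal ((t - s) powr \<mu>) * ennreal (1 / (t - s) powr (\<alpha> + 1))"
          by (rule ennreal_mult) auto
        then show ?thesis unfolding X1_def w_def by (simp only: mult_ac)
      qed
      also have "\<dots> = (\<integral>\<^sup>+u\<in>{0<..<s}. ?F u s \<partial>lebesgue)"
        by (subst nn_integral_cmult[symmetric]) (auto intro!: nn_integral_cong simp: mult_ac)
      finally show "X1 s = (\<integral>\<^sup>+u\<in>{0<..<s}. ?F u s \<partial>lebesgue)" .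
    qed
    also have "\<dots> = (\<integral>\<^sup>+u\<in>{0<..<t}. (\<integral>\<^sup>+s\<in>{u<..<t}. ?F u s \<partial>lebesgue) \<partial>lebesgue)"
      by (rule swap_triangle[symmetric]) measurable
    also have "\<dots> = (\<integral>\<^sup>+u. ennreal (1 / (\<mu> - \<alpha>)) * (k u * ennreal ((t - u) powr (\<mu> - \<alpha>)) * indicator {0<..<t} u) \<partial>lebesgue)"
    proof (rule nn_integral_cong)
      fix u
      show "(\<integral>\<^sup>+s\<in>{u<..<t}. ?F u s \<partial>lebesgue) * indicator {0<..<t} u
        = ennreal (1 / (\<mu> - \<alpha>)) * (k u * ennreal ((t - u) powr (\<mu> - \<alpha>)) * indicator {0<..<t} u)"
      proof (cases "u \<in> {0<..<t}")
        case True
        have "(\<integral>\<^sup>+s\<in>{u<..<t}. ?F u s \<partial>lebesgue) = k u * (\<integral>\<^sup>+s\<in>{u<..<t}. ennreal ((t - s) powr \<mu> * (1 / (t - s) powr (\<alpha> + 1))) \<partial>lebesgue)"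
          by (subst nn_integral_cmult[symmetric]) (auto intro!: nn_integral_cong simp: mult_ac)
        also have "\<dots> = k u * ennreal (1 / (\<mu> - \<alpha>) * (t - u) powr (\<mu> - \<alpha>))"
          using time_weight_early[OF \<alpha>(1) \<mu>, of u t] True by simp
        also have "\<dots> = ennreal (1 / (\<mu> - \<alpha>)) * (k u * ennreal ((t - u) powr (\<mu> - \<alpha>)))"
          using \<mu> by (subst ennreal_mult) (auto simp: mult_ac)
        finally show ?thesis using True by simp
      qed simp
    qed
    also have "\<dots> = ennreal (1 / (\<mu> - \<alpha>)) * (\<integral>\<^sup>+u\<in>{0<..<t}. k u * ennreal ((t - u) powr (\<mu> - \<alpha>)) \<partial>lebesgue)"
      by (rule nn_integral_cmult) measurable
    finally show ?thesis .
  qed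

  have I2: "(\<integral>\<^sup>+s\<in>{0<..<t}. X2 s \<partial>lebesgue) \<le> (\<integral>\<^sup>+u\<in>{0<..<t}. a u * ennreal (c2 * (t - u) powr (- 2 * \<alpha>)) \<partial>lebesgue)"
  proof -
    let ?F = "\<lambda>s u. a u * ennreal (1 / (u - s) powr \<alpha> * (1 / (t - s) powr (\<alpha> + 1)))"
    have "(\<integral>\<^sup>+s\<in>{0<..<t}. X2 s \<partial>lebesgue) = (\<integral>\<^sup>+s\<in>{0<..<t}. (\<integral>\<^sup>+u\<in>{s<..<t}. ?F s u \<partial>lebesgue) \<partial>lebesgue)"
    proof (intro nn_integral_cong arg_cong2[where f = "(*)"] refl)
      fix s
      show "X2 s = (\<integral>\<^sup>+u\<in>{s<..<t}. ?F s u \<partial>lebesgue)"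
        unfolding X2_def w_def by (subst nn_integral_cmult[symmetric]) (auto intro!: nn_integral_cong simp: ennreal_mult mult_ac simp del: times_divide_eq_right times_divide_eq_left)
    qed
    also have "\<dots> = (\<integral>\<^sup>+u\<in>{0<..<t}. (\<integral>\<^sup>+s\<in>{0<..<u}. ?F s u \<partial>lebesgue) \<partial>lebesgue)"
      by (rule swap_triangle) measurable
    also have "\<dots> \<le> (\<integral>\<^sup>+u\<in>{0<..<t}. a u * ennreal (c2 * (t - u) powr (- 2 * \<alpha>)) \<partial>lebesgue)"
    proof (rule nn_integral_mono)
      fix u
      show "(\<integral>\<^sup>+s\<in>{0<..<u}. ?F s u \<partial>lebesgue) * indicator {0<..<t} u \<le> a u * ennreal (c2 * (t - u) powr (- 2 * \<alpha>)) * indicator {0<..<t} u"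
      proof (cases "u \<in> {0<..<t}")
        case True
        have "(\<integral>\<^sup>+s\<in>{0<..<u}. ?F s u \<partial>lebesgue) = a u * (\<integral>\<^sup>+s\<in>{0<..<u}. ennreal (1 / (u - s) powr \<alpha> * (1 / (t - s) powr (\<alpha> + 1))) \<partial>lebesgue)"
          by (subst nn_integral_cmult[symmetric]) (auto intro!: nn_integral_cong simp: mult_ac)
        also have "\<dots> \<le> a u * ennreal (c2 * (t - u) powr (- 2 * \<alpha>))"
          unfolding c2_def using True by (intro mult_left_mono time_weight_singular \<alpha>) auto
        finally show ?thesis using True by simp
      qed simp
    qed
    finally show ?thesis .
  qed

  have I4: "(\<integral>\<^sup>+s\<in>{0<..<t}. X4 s \<partial>lebesgue) \<le> (\<integral>\<^sup>+u\<in>{0<..<t}. B u * ennreal ((t - u) powr -\<alpha> / \<alpha>) \<partial>lebesgue)"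
  proof -
    have "(\<integral>\<^sup>+s\<in>{0<..<t}. X4 s \<partial>lebesgue) = (\<integral>\<^sup>+s\<in>{0<..<t}. (\<integral>\<^sup>+u\<in>{s<..<t}. w s * (\<integral>\<^sup>+y\<in>{fst (s, u)<..<snd (s, u)}. b (snd (s, u)) y \<partial>lebesgue) \<partial>lebesgue) \<partial>lebesgue)"
      unfolding X4_def by (intro nn_integral_cong arg_cong2[where f = "(*)"] refl, subst nn_integral_cmult[symmetric])
        (measurable, auto intro!: nn_integral_cong simp: mult_ac)
    also have "\<dots> = (\<integral>\<^sup>+u\<in>{0<..<t}. (\<integral>\<^sup>+s\<in>{0<..<u}. w s * (\<integral>\<^sup>+y\<in>{fst (s, u)<..<snd (s, u)}. b (snd (s, u)) y \<partial>lebesgue) \<partial>lebesgue) \<partial>lebesgue)"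
    proof (rule swap_triangle)
      show "(\<lambda>p. w (fst p) * (\<integral>\<^sup>+y\<in>{fst (fst p, snd p)<..<snd (fst p, snd p)}. b (snd (fst p, snd p)) y \<partial>lebesgue)) \<in> borel_measurable LL"
        unfolding prod.collapse by measurable
    qed
    also have "\<dots> \<le> (\<integral>\<^sup>+u\<in>{0<..<t}. B u * ennreal ((t - u) powr -\<alpha> / \<alpha>) \<partial>lebesgue)"
    proof (rule nn_integral_mono)
      fix u
      show "(\<integral>\<^sup>+s\<in>{0<..<u}. w s * (\<integral>\<^sup>+y\<in>{fst (s, u)<..<snd (s, u)}. b (snd (s, u)) y \<partial>lebesgue) \<partial>lebesgue) * indicator {0<..<t} u
        \<le> B u * ennreal ((t - u) powr -\<alpha> / \<alpha>) * indicator {0<..<t} u"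
      proof (cases "u \<in> {0<..<t}")
        case True
        have "(\<integral>\<^sup>+s\<in>{0<..<u}. w s * (\<integral>\<^sup>+y\<in>{fst (s, u)<..<snd (s, u)}. b (snd (s, u)) y \<partial>lebesgue) \<partial>lebesgue)
          = (\<integral>\<^sup>+s\<in>{0<..<u}. (\<integral>\<^sup>+y\<in>{s<..<u}. w s * b u y \<partial>lebesgue) \<partial>lebesgue)"
          by (intro nn_integral_cong arg_cong2[where f = "(*)"] refl, subst nn_integral_cmult[symmetric])
            (measurable, auto intro!: nn_integral_cong simp: mult_ac)
        also have "\<dots> = (\<integral>\<^sup>+y\<in>{0<..<u}. (\<integral>\<^sup>+s\<in>{0<..<y}. w s * b u y \<partial>lebesgue) \<partial>lebesgue)"
          by (rule swap_triangle) measurable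
        also have "\<dots> \<le> (\<integral>\<^sup>+y. ennreal ((t - u) powr -\<alpha> / \<alpha>) * (b u y * indicator {0<..<u} y) \<partial>lebesgue)"
        proof (rule nn_integral_mono)
          fix y
          show "(\<integral>\<^sup>+s\<in>{0<..<y}. w s * b u y \<partial>lebesgue) * indicator {0<..<u} y \<le> ennreal ((t - u) powr -\<alpha> / \<alpha>) * (b u y * indicator {0<..<u} y)"
          proof (cases "y \<in> {0<..<u}")
            case y: True
            have "(\<integral>\<^sup>+s\<in>{0<..<y}. w s * b u y \<partial>lebesgue) = b u y * (\<integral>\<^sup>+s\<in>{0<..<y}. w s \<partial>lebesgue)"
              by (subst nn_integral_cmult[symmetric]) (auto intro!: nn_integral_cong simp: mult_ac)
            also have "\<dots> \<le> b u y * ennreal ((t - y) powr -\<alpha> / \<alpha>)"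
              unfolding w_def using y True by (intro mult_left_mono time_weight_tail \<alpha>) auto
            also have "\<dots> \<le> b u y * ennreal ((t - u) powr -\<alpha> / \<alpha>)"
              using y True \<alpha> by (intro mult_left_mono ennreal_leI divide_right_mono powr_mono2') auto
            finally show ?thesis using y by (simp add: mult_ac)
          qed simp
        qed
        also have "\<dots> = ennreal ((t - u) powr -\<alpha> / \<alpha>) * B u"
          unfolding B_def by (rule nn_integral_cmult) measurable
        finally show ?thesis using True by (simp add: mult_ac)
      qed simp
    qed
    finally show ?thesis .
  qed

  let ?IH = "\<integral>\<^sup>+s\<in>{0<..<t}. H s * w s \<partial>lebesgue"
  let ?IK = "\<integral>\<^sup>+u\<in>{0<..<t}. k u * ennreal ((t - u) powr (\<mu> - \<alpha>)) \<partial>lebesgue"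
  let ?IW = "\<integral>\<^sup>+u\<in>{0<..<t}. ennreal ((t - u) powr (- 2 * \<alpha>) + u powr -\<alpha>) * (a u + B u) \<partial>lebesgue"
  have tail: "(\<integral>\<^sup>+s\<in>{0<..<t}. \<Phi> s * w s \<partial>lebesgue) \<le> ennreal L *
      (((\<integral>\<^sup>+s\<in>{0<..<t}. X1 s \<partial>lebesgue) + ((\<integral>\<^sup>+s\<in>{0<..<t}. X2 s \<partial>lebesgue) + ennreal \<alpha> * (\<integral>\<^sup>+s\<in>{0<..<t}. X4 s \<partial>lebesgue))) + ennreal \<alpha> * ?IH)"
  proof -
    have "(\<integral>\<^sup>+s\<in>{0<..<t}. \<Phi> s * w s \<partial>lebesgue) \<le> (\<integral>\<^sup>+s. ennreal L *
      ((X1 s * indicator {0<..<t} s + (X2 s * indicator {0<..<t} s + ennreal \<alpha> * (X4 s * indicator {0<..<t} s))) + ennreal \<alpha> * (H s * w s * indicator {0<..<t} s)) \<partial>lebesgue)"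
    proof (rule nn_integral_mono)
      fix s
      show "\<Phi> s * w s * indicator {0<..<t} s \<le> ennreal L *
        ((X1 s * indicator {0<..<t} s + (X2 s * indicator {0<..<t} s + ennreal \<alpha> * (X4 s * indicator {0<..<t} s))) + ennreal \<alpha> * (H s * w s * indicator {0<..<t} s))"
      proof (cases "s \<in> {0<..<t}")
        case True
        have "\<Phi> s * w s \<le> (ennreal L *
          (ennreal ((t - s) powr \<mu>) * (\<integral>\<^sup>+u\<in>{0<..<s}. k u \<partial>lebesgue)
          + (\<integral>\<^sup>+u\<in>{s<..<t}. a u * ennreal (1 / (u - s) powr \<alpha>) \<partial>lebesgue)
          + ennreal \<alpha> * H s
          + ennreal \<alpha> * (\<integral>\<^sup>+u\<in>{s<..<t}. (\<integral>\<^sup>+y\<in>{s<..<u}. b u y \<partial>lebesgue) \<partial>lebesgue))) * w s"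
          using True by (intro mult_right_mono le) auto
        also have "\<dots> = ennreal L * ((X1 s + (X2 s + ennreal \<alpha> * X4 s)) + ennreal \<alpha> * (H s * w s))"
          unfolding X1_def X2_def X4_def by (simp only: distrib_left distrib_right mult_ac add_ac)
        finally show ?thesis using True by simp
      qed simp
    qed
    also have "\<dots> = ennreal L * (\<integral>\<^sup>+s. 
      ((X1 s * indicator {0<..<t} s + (X2 s * indicator {0<..<t} s + ennreal \<alpha> * (X4 s * indicator {0<..<t} s))) + ennreal \<alpha> * (H s * w s * indicator {0<..<t} s)) \<partial>lebesgue)"
      by (rule nn_integral_cmult_any[OF L])
    also have "\<dots> \<le> ennreal L * ((\<integral>\<^sup>+s. (X1 s * indicator {0<..<t} s + (X2 s * indicator {0<..<t} s + ennreal \<alpha> * (X4 s * indicator {0<..<t} s))) \<partial>lebesgue)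
      + (\<integral>\<^sup>+s. ennreal \<alpha> * (H s * w s * indicator {0<..<t} s) \<partial>lebesgue))"
      by (intro mult_left_mono nn_integral_add_le_any) measurable
    also have "(\<integral>\<^sup>+s. ennreal \<alpha> * (H s * w s * indicator {0<..<t} s) \<partial>lebesgue) = ennreal \<alpha> * ?IH"
      by (rule nn_integral_cmult_any[OF \<alpha>(1)])
    also have "(\<integral>\<^sup>+s. (X1 s * indicator {0<..<t} s + (X2 s * indicator {0<..<t} s + ennreal \<alpha> * (X4 s * indicator {0<..<t} s))) \<partial>lebesgue)
      = (\<integral>\<^sup>+s\<in>{0<..<t}. X1 s \<partial>lebesgue) + ((\<integral>\<^sup>+s\<in>{0<..<t}. X2 s \<partial>lebesgue) + ennreal \<alpha> * (\<integral>\<^sup>+s\<in>{0<..<t}. X4 s \<partial>lebesgue))"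
      by (subst nn_integral_add, measurable, subst nn_integral_add, measurable, subst nn_integral_cmult, measurable)
    finally show ?thesis .
  qed
  have head: "\<Phi> 0 \<le> ennreal L * ((\<integral>\<^sup>+u\<in>{0<..<t}. a u * ennreal (1 / u powr \<alpha>) \<partial>lebesgue) + ennreal \<alpha> * (\<integral>\<^sup>+u\<in>{0<..<t}. B u \<partial>lebesgue))"
    using le[of 0] t by (simp add: H0 B_def)
  have main: "(\<integral>\<^sup>+u\<in>{0<..<t}. a u * ennreal (1 / u powr \<alpha>) \<partial>lebesgue) + ennreal \<alpha> * (\<integral>\<^sup>+u\<in>{0<..<t}. B u \<partial>lebesgue)
      + ((\<integral>\<^sup>+u\<in>{0<..<t}. a u * ennreal (c2 * (t - u) powr (- 2 * \<alpha>)) \<partial>lebesgue)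
      + ennreal \<alpha> * (\<integral>\<^sup>+u\<in>{0<..<t}. B u * ennreal ((t - u) powr -\<alpha> / \<alpha>) \<partial>lebesgue)) \<le> ennreal C4 * ?IW"
  proof -
    let ?i = "indicator {0<..<t} :: real \<Rightarrow> ennreal"
    have "(\<integral>\<^sup>+u\<in>{0<..<t}. a u * ennreal (1 / u powr \<alpha>) \<partial>lebesgue) + ennreal \<alpha> * (\<integral>\<^sup>+u\<in>{0<..<t}. B u \<partial>lebesgue)
      + ((\<integral>\<^sup>+u\<in>{0<..<t}. a u * ennreal (c2 * (t - u) powr (- 2 * \<alpha>)) \<partial>lebesgue)
      + ennreal \<alpha> * (\<integral>\<^sup>+u\<in>{0<..<t}. B u * ennreal ((t - u) powr -\<alpha> / \<alpha>) \<partial>lebesgue))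
      = (\<integral>\<^sup>+u. (a u * ennreal (1 / u powr \<alpha>) * ?i u + ennreal \<alpha> * (B u * ?i u))
         + (a u * ennreal (c2 * (t - u) powr (- 2 * \<alpha>)) * ?i u + ennreal \<alpha> * (B u * ennreal ((t - u) powr -\<alpha> / \<alpha>) * ?i u)) \<partial>lebesgue)"
    proof -
      have "(\<integral>\<^sup>+u. (f1 u + ennreal \<alpha> * f2 u) + (f3 u + ennreal \<alpha> * f4 u) \<partial>lebesgue)
        = (\<integral>\<^sup>+u. f1 u \<partial>lebesgue) + ennreal \<alpha> * (\<integral>\<^sup>+u. f2 u \<partial>lebesgue) + ((\<integral>\<^sup>+u. f3 u \<partial>lebesgue) + ennreal \<alpha> * (\<integral>\<^sup>+u. f4 u \<partial>lebesgue))"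
        if [measurable]: "f1 \<in> borel_measurable lebesgue" "f2 \<in> borel_measurable lebesgue" "f3 \<in> borel_measurable lebesgue" "f4 \<in> borel_measurable lebesgue"
        for f1 f2 f3 f4 :: "real \<Rightarrow> ennreal"
        by (simp add: nn_integral_add nn_integral_cmult)
      then show ?thesis by (rule sym) measurable
    qed
    also have "\<dots> \<le> (\<integral>\<^sup>+u. ennreal C4 * (ennreal ((t - u) powr (- 2 * \<alpha>) + u powr -\<alpha>) * (a u + B u) * ?i u) \<partial>lebesgue)"
    proof (rule nn_integral_mono)
      fix u
      show "(a u * ennreal (1 / u powr \<alpha>) * ?i u + ennreal \<alpha> * (B u * ?i u))
         + (a u * ennreal (c2 * (t - u) powr (- 2 * \<alpha>)) * ?i u + ennreal \<alpha> * (B u * ennreal ((t - u) powr -\<alpha> / \<alpha>) * ?i u))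
        \<le> ennreal C4 * (ennreal ((t - u) powr (- 2 * \<alpha>) + u powr -\<alpha>) * (a u + B u) * ?i u)"
      proof (cases "u \<in> {0<..<t}")
        case True
        \<comment> \<open>both leftover weights are at most \<open>T^\<alpha>\<close> times one of \<open>x\<close> and \<open>y\<close>\<close>
        define x where "x = (t - u) powr (- 2 * \<alpha>)"
        define y where "y = u powr -\<alpha>"
        have xy: "0 \<le> x" "0 \<le> y" by (auto simp: x_def y_def)
        have "(t - u) powr -\<alpha> = x * (t - u) powr \<alpha>"
          unfolding x_def by (simp add: powr_add[symmetric])
        also have "\<dots> \<le> x * T powr \<alpha>"
          using True t \<alpha> xy by (intro mult_left_mono powr_mono2) auto
        finally have 1: "(t - u) powr -\<alpha> \<le> T powr \<alpha> * x" by (simp add: mult.commute)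
        have "\<alpha> \<le> 1" using \<alpha> by simp
        also have "1 = y * u powr \<alpha>"
          unfolding y_def using True by (simp add: powr_add[symmetric])
        also have "\<dots> \<le> y * T powr \<alpha>"
          using True t \<alpha> xy by (intro mult_left_mono powr_mono2) auto
        finally have 2: "\<alpha> \<le> T powr \<alpha> * y" by (simp add: mult.commute)
        have "C4 * (x + y) = (1 + c2) * (x + y) + (T powr \<alpha> * x + T powr \<alpha> * y)"
          by (simp add: C4_def algebra_simps)
        moreover have "y + c2 * x \<le> (1 + c2) * (x + y)" "0 \<le> (1 + c2) * (x + y)"
          using c2 xy by (auto simp: algebra_simps)
        ultimately have r: "y + c2 * x \<le> C4 * (x + y)" "\<alpha> + (t - u) powr -\<alpha> \<le> C4 * (x + y)"
          using 1 2 xy by (auto intro!: order_trans[OF _ add_increasing2] mult_nonneg_nonneg add_nonneg_nonneg)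
        have "a u * ennreal y + ennreal \<alpha> * B u + (a u * ennreal (c2 * x) + ennreal \<alpha> * (B u * ennreal ((t - u) powr -\<alpha> / \<alpha>)))
          = a u * (ennreal y + ennreal (c2 * x)) + B u * (ennreal \<alpha> + ennreal \<alpha> * ennreal ((t - u) powr -\<alpha> / \<alpha>))"
          by (simp only: distrib_left mult_ac add_ac)
        also have "ennreal \<alpha> + ennreal \<alpha> * ennreal ((t - u) powr -\<alpha> / \<alpha>) = ennreal (\<alpha> + (t - u) powr -\<alpha>)"
          using \<alpha> by (simp add: ennreal_mult[symmetric])
        also have "ennreal y + ennreal (c2 * x) = ennreal (y + c2 * x)"
          using xy c2 by simp
        also have "a u * ennreal (y + c2 * x) + B u * ennreal (\<alpha> + (t - u) powr -\<alpha>) \<le> a u * ennreal (C4 * (x + y)) + B u * ennreal (C4 * (x + y))"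
          using r by (intro add_mono mult_left_mono ennreal_leI) auto
        also have "\<dots> = ennreal C4 * (ennreal (x + y) * (a u + B u))"
          using xy c2 by (subst (1 2) ennreal_mult) (auto simp: C4_def distrib_left mult_ac)
        finally show ?thesis using True by (simp add: x_def y_def powr_minus_divide)
      qed simp
    qed
    also have "\<dots> = ennreal C4 * ?IW"
      by (rule nn_integral_cmult) measurable
    finally show ?thesis .
  qed
  have "\<Phi> 0 + (\<integral>\<^sup>+s\<in>{0<..<t}. \<Phi> s * w s \<partial>lebesgue) \<le>
     ennreal L * ((\<integral>\<^sup>+u\<in>{0<..<t}. a u * ennreal (1 / u powr \<alpha>) \<partial>lebesgue) + ennreal \<alpha> * (\<integral>\<^sup>+u\<in>{0<..<t}. B u \<partial>lebesgue))
     + ennreal L * ((ennreal (1 / (\<mu> - \<alpha>)) * ?IK + ((\<integral>\<^sup>+u\<in>{0<..<t}. a u * ennreal (c2 * (t - u) powr (- 2 * \<alpha>)) \<partial>lebesgue)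
      + ennreal \<alpha> * (\<integral>\<^sup>+u\<in>{0<..<t}. B u * ennreal ((t - u) powr -\<alpha> / \<alpha>) \<partial>lebesgue))) + ennreal \<alpha> * ?IH)"
    by (intro add_mono head order_trans[OF tail] mult_left_mono order_refl I2 I4) (auto simp: I1)
  also have "\<dots> = ennreal L * (ennreal (1 / (\<mu> - \<alpha>)) * ?IK + 
     ((\<integral>\<^sup>+u\<in>{0<..<t}. a u * ennreal (1 / u powr \<alpha>) \<partial>lebesgue) + ennreal \<alpha> * (\<integral>\<^sup>+u\<in>{0<..<t}. B u \<partial>lebesgue)
      + ((\<integral>\<^sup>+u\<in>{0<..<t}. a u * ennreal (c2 * (t - u) powr (- 2 * \<alpha>)) \<partial>lebesgue)
      + ennreal \<alpha> * (\<integral>\<^sup>+u\<in>{0<..<t}. B u * ennreal ((t - u) powr -\<alpha> / \<alpha>) \<partial>lebesgue))) + ennreal \<alpha> * ?IH)"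
    by (simp only: distrib_left add_ac)
  also have "\<dots> \<le> ennreal L * (ennreal (1 / (\<mu> - \<alpha>)) * ?IK + ennreal C4 * ?IW + ennreal \<alpha> * ?IH)"
    by (intro mult_left_mono add_mono main order_refl) auto
  finally show ?thesis unfolding C4_def c2_def B_def w_def .
qed

section \<open>Vector-valued integrands\<close>

lemma vnorm_nonneg [simp]: "0 \<le> vnorm d v"
  by (simp add: vnorm_def)

text \<open>
  The Euclidean norm is the maximum of the pairings with vectors of norm at most one.
\<close>

lemma vnorm_dual:
  obtains w where "\<And>a. \<bar>\<Sum>i<d. w i * a i\<bar> \<le> vnorm d a" "(\<Sum>i<d. w i * v i) = vnorm d v"
proof -
  define N where "N = vnorm d v"
  \<comment> \<open>for \<open>v = 0\<close> this is the zero vector, since \<open>1 / 0 = 0\<close>\<close>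
  define w where "w i = v i * (1 / N)" for i
  have N: "0 \<le> N" by (simp add: N_def)
  have w: "L2_set w {..<d} \<le> 1"
  proof -
    have "L2_set w {..<d} = N * (1 / N)"
      unfolding w_def using N by (subst L2_set_left_distrib[symmetric]) (auto simp: N_def vnorm_def)
    then show ?thesis by (cases "N = 0") auto
  qed
  show ?thesis
  proof (rule that[of w])
    fix a
    have "\<bar>\<Sum>i<d. w i * a i\<bar> \<le> (\<Sum>i<d. \<bar>w i\<bar> * \<bar>a i\<bar>)"
      by (intro order_trans[OF sum_abs]) (simp add: abs_mult)
    also have "\<dots> \<le> L2_set w {..<d} * L2_set a {..<d}" by (rule L2_set_mult_ineq)
    also have "\<dots> \<le> 1 * vnorm d a" using w unfolding vnorm_def by (intro mult_right_mono) auto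
    finally show "\<bar>\<Sum>i<d. w i * a i\<bar> \<le> vnorm d a" by simp
    have "(\<Sum>i<d. w i * v i) = (\<Sum>i<d. (v i)\<^sup>2) / N"
      by (simp add: w_def sum_divide_distrib power2_eq_square)
    also have "(\<Sum>i<d. (v i)\<^sup>2) = N\<^sup>2"
      by (simp add: N_def vnorm_def L2_set_def sum_nonneg)
    finally show "(\<Sum>i<d. w i * v i) = vnorm d v" unfolding N_def by (simp add: power2_eq_square)
  qed
qed

lemma frac_left_cong:
  assumes "\<And>y. a < y \<Longrightarrow> y \<le> x \<Longrightarrow> p y = q y" "a < x"
  shows "frac_left \<beta> a p x = frac_left \<beta> a q x"
  unfolding frac_left_def using assms
  by (intro arg_cong2[where f = "(+)"] arg_cong2[where f = "(*)"] set_lebesgue_integral_cong) auto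

context frac_integrator
begin

lemma pairing_cong:
  assumes "\<And>x. 0 < x \<Longrightarrow> x < y \<Longrightarrow> p x = q x"
  shows "pairing p y = pairing q y"
  unfolding pairing_def
proof (rule set_lebesgue_integral_cong)
  have "frac_left \<alpha> 0 p x = frac_left \<alpha> 0 q x" if "0 < x" "x < y" for x
    using that assms by (intro frac_left_cong) auto
  then show "\<forall>x. x \<in> {0<..<y} \<longrightarrow> frac_left \<alpha> 0 p x * rho y x = frac_left \<alpha> 0 q x * rho y x" by auto
qed simp

context
  fixes g :: "real \<Rightarrow> real"
  assumes hg: "\<And>y. 0 < y \<Longrightarrow> y < t \<Longrightarrow> h y = g y" and Lim: "\<And>y. 0 < y \<Longrightarrow> y \<le> t \<Longrightarrow> Lim (at_left y) g = h y"
begin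

lemma right_weyl_eq:
  assumes "0 < x" "x < y" "y \<le> t"
  shows "right_weyl \<alpha> y g x = rho y x / Gamma \<alpha>"
proof -
  have "(LINT z:{x<..<y}|lebesgue. (g x - g z) / (z - x) powr (2 - \<alpha>)) = (LINT z:{x<..<y}|lebesgue. (h x - h z) / (z - x) powr (2 - \<alpha>))"
    using assms by (intro set_lebesgue_integral_cong) (auto simp: hg)
  then show ?thesis using assms by (simp add: right_weyl_def rho_eq Lim hg)
qed

lemma stieltjes_eq_pairing:
  assumes "y \<le> t"
  shows "stieltjes \<alpha> y \<phi> g = - (1 / (Gamma (1 - \<alpha>) * Gamma \<alpha>) * pairing \<phi> y)"
proof -
  have "(LINT x:{0<..<y}|lebesgue. left_weyl \<alpha> \<phi> x * right_weyl \<alpha> y g x)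
    = (LINT x:{0<..<y}|lebesgue. 1 / (Gamma (1 - \<alpha>) * Gamma \<alpha>) * (frac_left \<alpha> 0 \<phi> x * rho y x))"
    using assms
    by (intro set_lebesgue_integral_cong) (auto simp: right_weyl_eq left_weyl_def frac_left_def powr_minus_divide)
  then show ?thesis unfolding stieltjes_def pairing_def by (simp only: set_integral_mult_right)
qed

text \<open>
  The Gamma factors of the two derivatives combine to \<open>1 / (\<Gamma>(1-\<alpha>) \<Gamma>(\<alpha>))\<close>, and the factor
  \<open>1 / \<Gamma>(1-\<alpha>)\<close> in \<open>\<Lambda>_\<alpha>(g)\<close> is the one belonging to the left derivative.
\<close>

lemma Lambda_dominates:
  obtains L where "0 \<le> L" "Lambda \<alpha> t g = ennreal L"
    "\<And>x y. 0 < x \<Longrightarrow> x < y \<Longrightarrow> y \<le> t \<Longrightarrow> 1 / (Gamma (1 - \<alpha>) * Gamma \<alpha>) * \<bar>rho y x\<bar> \<le> L"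
proof -
  have G: "0 < Gamma \<alpha>" "0 < Gamma (1 - \<alpha>)" using \<alpha> by (auto intro: Gamma_real_pos)
  define S where "S = (SUP s\<in>{0<..<t}. SUP y\<in>{s<..<t}. ennreal \<bar>right_weyl \<alpha> y g s\<bar>)"
  have "S \<le> ennreal (2 * C / Gamma \<alpha>)"
    unfolding S_def
  proof (intro SUP_least)
    fix s y assume "s \<in> {0<..<t}" "y \<in> {s<..<t}"
    then show "ennreal \<bar>right_weyl \<alpha> y g s\<bar> \<le> ennreal (2 * C / Gamma \<alpha>)"
      using G rho_bound[of s y] by (auto simp: right_weyl_eq intro!: ennreal_leI divide_right_mono)
  qed
  then have S: "S = ennreal (enn2real S)" by (simp add: le_less_trans[OF _ ennreal_less_top])
  have le: "\<bar>rho y x\<bar> \<le> Gamma \<alpha> * enn2real S" if "0 < x" "x < y" "y < t" for x y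
  proof -
    have "ennreal \<bar>right_weyl \<alpha> y g x\<bar> \<le> S"
      unfolding S_def using that by (intro SUP_upper2[of x] SUP_upper2[of y]) auto
    then have "\<bar>right_weyl \<alpha> y g x\<bar> \<le> enn2real S"
      by (subst (asm) S) (simp add: ennreal_le_iff)
    then show ?thesis using that G by (simp add: right_weyl_eq divide_le_eq mult.commute)
  qed
  show ?thesis
  proof (rule that[of "1 / Gamma (1 - \<alpha>) * enn2real S"])
    show "0 \<le> 1 / Gamma (1 - \<alpha>) * enn2real S" using G by simp
    have "Lambda \<alpha> t g = ennreal (1 / Gamma (1 - \<alpha>)) * ennreal (enn2real S)"
      unfolding Lambda_def S_def[symmetric] by (subst S) (rule refl)
    then show "Lambda \<alpha> t g = ennreal (1 / Gamma (1 - \<alpha>) * enn2real S)"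
      using G by (simp add: ennreal_mult[symmetric])
    fix x y assume xy: "0 < x" "x < y" "y \<le> t"
    have "\<bar>rho y x\<bar> \<le> Gamma \<alpha> * enn2real S"
    proof (cases "y < t")
      case False
      then have "y = t" using xy by simp
      then show ?thesis using xy le by (auto intro!: rho_bound_at_end)
    qed (use le xy in auto)
    then have "1 / (Gamma (1 - \<alpha>) * Gamma \<alpha>) * \<bar>rho y x\<bar> \<le> 1 / (Gamma (1 - \<alpha>) * Gamma \<alpha>) * (Gamma \<alpha> * enn2real S)"
      using G by (intro mult_left_mono) auto
    also have "\<dots> = 1 / Gamma (1 - \<alpha>) * enn2real S"
      using G by simp
    finally show "1 / (Gamma (1 - \<alpha>) * Gamma \<alpha>) * \<bar>rho y x\<bar> \<le> 1 / Gamma (1 - \<alpha>) * enn2real S" .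
  qed
qed

end

end

lemma ennreal_divide_mono_ind:
  fixes a b c :: real
  assumes "x \<in> A \<Longrightarrow> a \<le> b" "0 \<le> c"
  shows "ennreal (a / c) * indicator A x \<le> ennreal (b / c) * indicator A x"
proof (cases "x \<in> A")
  case True
  then have "a / c \<le> b / c" using assms by (intro divide_right_mono) auto
  from ennreal_leI[OF this] show ?thesis by (rule mult_right_mono) simp
qed simp

text \<open>
  Pairing with the unit vector \<open>w\<close> in the direction of the increment turns the norm of the increment
  into the increment for the real integrand \<open>\<Sum> w_i f_i\<close>, whose differences are bounded by the norms
  of those of \<open>f\<close>.
\<close>

lemma increment_bound_vector:
  fixes T \<alpha> s t :: real and g :: "real \<Rightarrow> real" and d :: nat and f :: "real \<Rightarrow> real \<Rightarrow> nat \<Rightarrow> real"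
  assumes T: "0 < T" and \<alpha>: "0 < \<alpha>" "\<alpha> < 1" and g: "g \<in> W_T_inf \<alpha> T"
    and f: "\<And>r i. r \<in> {0..T} \<Longrightarrow> i < d \<Longrightarrow> (\<lambda>x. f r x i) \<in> W_0_one \<alpha> T"
    and st: "0 \<le> s" "s < t" "t \<le> T"
  shows "ennreal (vnorm d (\<lambda>i. G \<alpha> g f t i - G \<alpha> g f s i)) \<le> Lambda \<alpha> T g *
         ((\<integral>\<^sup>+ u\<in>{0<..<s}. ennreal (vnorm d (\<lambda>i. f t u i - f s u i) / u powr \<alpha>) \<partial>lebesgue)
          + (\<integral>\<^sup>+ u\<in>{s<..<t}. ennreal (vnorm d (f t u) / (u - s) powr \<alpha>) \<partial>lebesgue)
          + ennreal \<alpha> * (\<integral>\<^sup>+ u\<in>{0<..<s}. (\<integral>\<^sup>+ y\<in>{0<..<u}.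
              ennreal (vnorm d (\<lambda>i. f t u i - f s u i - f t y i + f s y i)
                       / (u - y) powr (\<alpha> + 1)) \<partial>lebesgue) \<partial>lebesgue)
          + ennreal \<alpha> * (\<integral>\<^sup>+ u\<in>{s<..<t}. (\<integral>\<^sup>+ y\<in>{s<..<u}.
              ennreal (vnorm d (\<lambda>i. f t u i - f t y i)
                       / (u - y) powr (\<alpha> + 1)) \<partial>lebesgue) \<partial>lebesgue))"
    (is "_ \<le> _ * (?X1 + ?X2 + _ * ?X3 + _ * ?X4)")
proof -
  obtain h C where h: "frac_integrator \<alpha> T C h" "\<And>y. 0 < y \<Longrightarrow> y < T \<Longrightarrow> h y = g y"
    "\<And>y. 0 < y \<Longrightarrow> y \<le> T \<Longrightarrow> Lim (at_left y) g = h y"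
    by (rule frac_integrator_of_W_T_inf[OF \<alpha> T g]) (rule that; simp)
  interpret frac_integrator \<alpha> T C h by (rule h(1))
  obtain L where L: "0 \<le> L" "Lambda \<alpha> T g = ennreal L"
    "\<And>x y. 0 < x \<Longrightarrow> x < y \<Longrightarrow> y \<le> T \<Longrightarrow> 1 / (Gamma (1 - \<alpha>) * Gamma \<alpha>) * \<bar>rho y x\<bar> \<le> L"
    by (rule Lambda_dominates[OF h(2,3)]) (assumption | rule that; simp)+
  define c where "c = 1 / (Gamma (1 - \<alpha>) * Gamma \<alpha>)"
  have c: "0 \<le> c" using \<alpha> by (auto simp: c_def intro!: mult_nonneg_nonneg less_imp_le[OF Gamma_real_pos])
  define F where "F r i x = (if x \<in> {0..T} then f r x i else 0)" for r i x
  have reg: "frac_regular \<alpha> 0 T (F r i)" if "r \<in> {0..T}" "i < d" for r i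
    using frac_regular_of_W_0_one[OF \<alpha>(1) f[OF that]] by (simp add: F_def[abs_def])
  have GJ: "G \<alpha> g f r i = - (c * pairing (F r i) r)" if "r \<in> {0..T}" for r i
  proof -
    have "pairing (\<lambda>x. f r x i) r = pairing (F r i) r" using that by (intro pairing_cong) (auto simp: F_def)
    then show ?thesis unfolding G_def c_def using stieltjes_eq_pairing[OF h(2,3), of r] that by simp
  qed
  obtain w where w: "\<And>a. \<bar>\<Sum>i<d. w i * a i\<bar> \<le> vnorm d a"
    "(\<Sum>i<d. w i * (G \<alpha> g f t i - G \<alpha> g f s i)) = vnorm d (\<lambda>i. G \<alpha> g f t i - G \<alpha> g f s i)"
    by (rule vnorm_dual[of d "\<lambda>i. G \<alpha> g f t i - G \<alpha> g f s i"]) (rule that; simp)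
  define P where "P r x = (\<Sum>i<d. w i * F r i x)" for r x
  have P: "frac_regular \<alpha> 0 y (P r)" "pairing (P r) y = (\<Sum>i<d. w i * pairing (F r i) y)" if "r \<in> {0..T}" "y \<le> T" for r y
    using pairing_sum[of "{..<d}" y "F r" w] frac_regular_mono[OF reg[OF that(1)] that(2)] that by (auto simp: P_def[abs_def])
  have Pf: "P r x = (\<Sum>i<d. w i * f r x i)" if "0 < x" "x < T" for r x
    using that by (simp add: P_def F_def)
  have v: "vnorm d (\<lambda>i. G \<alpha> g f t i - G \<alpha> g f s i) = - (c * (pairing (P t) t - pairing (P s) s))"
    unfolding w(2)[symmetric] using st
    by (simp add: P(2) GJ right_diff_distrib sum_subtractf sum_distrib_left sum_negf mult.left_commute)
  have "ennreal (vnorm d (\<lambda>i. G \<alpha> g f t i - G \<alpha> g f s i)) = ennreal \<bar>c * (pairing (P t) t - pairing (P s) s)\<bar>"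
    using v vnorm_nonneg[of d "\<lambda>i. G \<alpha> g f t i - G \<alpha> g f s i"] by (simp add: abs_of_nonpos)
  also have "\<dots> \<le> ennreal L *
     ((\<integral>\<^sup>+x\<in>{0<..<s}. ennreal (\<bar>P t x - P s x\<bar> / x powr \<alpha>) \<partial>lebesgue)
      + (\<integral>\<^sup>+x\<in>{s<..<t}. ennreal (\<bar>P t x\<bar> / (x - s) powr \<alpha>) \<partial>lebesgue)
      + ennreal \<alpha> * (\<integral>\<^sup>+x\<in>{0<..<s}. (\<integral>\<^sup>+z\<in>{0<..<x}. ennreal (\<bar>P t x - P s x - P t z + P s z\<bar> / (x - z) powr (\<alpha> + 1)) \<partial>lebesgue) \<partial>lebesgue)
      + ennreal \<alpha> * (\<integral>\<^sup>+x\<in>{s<..<t}. (\<integral>\<^sup>+z\<in>{s<..<x}. ennreal (\<bar>P t x - P t z\<bar> / (x - z) powr (\<alpha> + 1)) \<partial>lebesgue) \<partial>lebesgue))"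
    using L(3) st c unfolding c_def[symmetric] by (intro increment_bound P) auto
  also have "\<dots> \<le> Lambda \<alpha> T g * (?X1 + ?X2 + ennreal \<alpha> * ?X3 + ennreal \<alpha> * ?X4)"
    unfolding L(2)
  proof (intro mult_left_mono add_mono)
    show "(\<integral>\<^sup>+x\<in>{0<..<s}. ennreal (\<bar>P t x - P s x\<bar> / x powr \<alpha>) \<partial>lebesgue)
      \<le> (\<integral>\<^sup>+ u\<in>{0<..<s}. ennreal (vnorm d (\<lambda>i. f t u i - f s u i) / u powr \<alpha>) \<partial>lebesgue)"
    proof (intro nn_integral_mono ennreal_divide_mono_ind)
      fix x assume "x \<in> {0<..<s}"
      then have "P t x - P s x = (\<Sum>i<d. w i * (f t x i - f s x i))"
        using st by (simp add: Pf right_diff_distrib sum_subtractf)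
      then show "\<bar>P t x - P s x\<bar> \<le> vnorm d (\<lambda>i. f t x i - f s x i)" using w(1) by simp
    qed simp
    show "(\<integral>\<^sup>+x\<in>{s<..<t}. ennreal (\<bar>P t x\<bar> / (x - s) powr \<alpha>) \<partial>lebesgue)
      \<le> (\<integral>\<^sup>+ u\<in>{s<..<t}. ennreal (vnorm d (f t u) / (u - s) powr \<alpha>) \<partial>lebesgue)"
    proof (intro nn_integral_mono ennreal_divide_mono_ind)
      fix x assume "x \<in> {s<..<t}"
      then show "\<bar>P t x\<bar> \<le> vnorm d (f t x)" using st w(1)[of "f t x"] by (simp add: Pf)
    qed simp
    show "(\<integral>\<^sup>+x\<in>{0<..<s}. (\<integral>\<^sup>+z\<in>{0<..<x}. ennreal (\<bar>P t x - P s x - P t z + P s z\<bar> / (x - z) powr (\<alpha> + 1)) \<partial>lebesgue) \<partial>lebesgue)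
      \<le> (\<integral>\<^sup>+ u\<in>{0<..<s}. (\<integral>\<^sup>+ y\<in>{0<..<u}. ennreal (vnorm d (\<lambda>i. f t u i - f s u i - f t y i + f s y i) / (u - y) powr (\<alpha> + 1)) \<partial>lebesgue) \<partial>lebesgue)"
    proof (rule nn_integral_mono)
      fix x
      show "(\<integral>\<^sup>+z\<in>{0<..<x}. ennreal (\<bar>P t x - P s x - P t z + P s z\<bar> / (x - z) powr (\<alpha> + 1)) \<partial>lebesgue) * indicator {0<..<s} x
        \<le> (\<integral>\<^sup>+ y\<in>{0<..<x}. ennreal (vnorm d (\<lambda>i. f t x i - f s x i - f t y i + f s y i) / (x - y) powr (\<alpha> + 1)) \<partial>lebesgue) * indicator {0<..<s} x"
      proof (cases "x \<in> {0<..<s}")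
        case True
        show ?thesis
        proof (rule mult_right_mono, intro nn_integral_mono ennreal_divide_mono_ind)
          fix z assume "z \<in> {0<..<x}"
          then have "P t x - P s x - P t z + P s z = (\<Sum>i<d. w i * (f t x i - f s x i - f t z i + f s z i))"
            using True st by (simp add: Pf right_diff_distrib distrib_left sum_subtractf sum.distrib)
          then show "\<bar>P t x - P s x - P t z + P s z\<bar> \<le> vnorm d (\<lambda>i. f t x i - f s x i - f t z i + f s z i)" using w(1) by simp
        qed auto
      qed simp
    qed
    show "(\<integral>\<^sup>+x\<in>{s<..<t}. (\<integral>\<^sup>+z\<in>{s<..<x}. ennreal (\<bar>P t x - P t z\<bar> / (x - z) powr (\<alpha> + 1)) \<partial>lebesgue) \<partial>lebesgue)
      \<le> (\<integral>\<^sup>+ u\<in>{s<..<t}. (\<integral>\<^sup>+ y\<in>{s<..<u}. ennreal (vnorm d (\<lambda>i. f t u i - f t y i) / (u - y) powr (\<alpha> + 1)) \<partial>lebesgue) \<partial>lebesgue)"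
    proof (rule nn_integral_mono)
      fix x
      show "(\<integral>\<^sup>+z\<in>{s<..<x}. ennreal (\<bar>P t x - P t z\<bar> / (x - z) powr (\<alpha> + 1)) \<partial>lebesgue) * indicator {s<..<t} x
        \<le> (\<integral>\<^sup>+ y\<in>{s<..<x}. ennreal (vnorm d (\<lambda>i. f t x i - f t y i) / (x - y) powr (\<alpha> + 1)) \<partial>lebesgue) * indicator {s<..<t} x"
      proof (cases "x \<in> {s<..<t}")
        case True
        show ?thesis
        proof (rule mult_right_mono, intro nn_integral_mono ennreal_divide_mono_ind)
          fix z assume "z \<in> {s<..<x}"
          then have "P t x - P t z = (\<Sum>i<d. w i * (f t x i - f t z i))"
            using True st by (simp add: Pf right_diff_distrib sum_subtractf)
          then show "\<bar>P t x - P t z\<bar> \<le> vnorm d (\<lambda>i. f t x i - f t z i)" using w(1) by simp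
        qed auto
      qed simp
    qed
  qed auto
  finally show ?thesis .
qed

lemma Lambda_finite:
  assumes T: "0 < T" and \<alpha>: "0 < \<alpha>" "\<alpha> < 1" and g: "g \<in> W_T_inf \<alpha> T"
  shows "\<exists>L\<ge>0. Lambda \<alpha> T g = ennreal L"
proof -
  obtain h C where h: "frac_integrator \<alpha> T C h" "\<And>y. 0 < y \<Longrightarrow> y < T \<Longrightarrow> h y = g y"
    "\<And>y. 0 < y \<Longrightarrow> y \<le> T \<Longrightarrow> Lim (at_left y) g = h y"
    by (rule frac_integrator_of_W_T_inf[OF \<alpha> T g]) (rule that; simp)
  show ?thesis
    by (rule frac_integrator.Lambda_dominates[OF h]) auto
qed

lemma measurable_vnorm:
  assumes "\<And>i. i < d \<Longrightarrow> h i \<in> borel_measurable M"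
  shows "(\<lambda>x. vnorm d (\<lambda>i. h i x)) \<in> borel_measurable M"
proof -
  define S where "S x = (\<Sum>i<d. (h i x)\<^sup>2)" for x
  have [measurable]: "S \<in> borel_measurable M"
    unfolding S_def[abs_def] using assms by (intro borel_measurable_sum borel_measurable_power) auto
  have "(\<lambda>x. sqrt (S x)) \<in> borel_measurable M" by measurable
  then show ?thesis by (simp add: vnorm_def L2_set_def S_def)
qed

lemma increment_estimate:
  fixes T \<alpha> \<mu> s t :: real and g K :: "real \<Rightarrow> real" and d :: nat and f :: "real \<Rightarrow> real \<Rightarrow> nat \<Rightarrow> real"
  assumes T: "0 < T" and \<alpha>: "0 < \<alpha>" "\<alpha> < 1" and g: "g \<in> W_T_inf \<alpha> T"
    and f: "\<forall>t\<in>{0..T}. \<forall>i<d. (\<lambda>s. f t s i) \<in> W_0_one \<alpha> T"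
    and hol: "\<forall>s\<in>{0..T}. \<forall>t1\<in>{0..T}. \<forall>t2\<in>{0..T}.
         vnorm d (\<lambda>i. f t1 s i - f t2 s i) \<le> K s * \<bar>t1 - t2\<bar> powr \<mu>"
    and st: "0 \<le> s" "s < t" "t \<le> T"
  shows "ennreal (vnorm d (\<lambda>i. G \<alpha> g f t i - G \<alpha> g f s i)) \<le>
         Lambda \<alpha> T g *
         (ennreal (\<bar>t - s\<bar> powr \<mu>) * (\<integral>\<^sup>+ u\<in>{0<..<s}. ennreal (K u / u powr \<alpha>) \<partial>lebesgue)
          + (\<integral>\<^sup>+ u\<in>{s<..<t}. ennreal (vnorm d (f t u) / (u - s) powr \<alpha>) \<partial>lebesgue)
          + ennreal \<alpha> * (\<integral>\<^sup>+ u\<in>{0<..<s}. (\<integral>\<^sup>+ y\<in>{0<..<u}.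
              ennreal (vnorm d (\<lambda>i. f t u i - f s u i - f t y i + f s y i)
                       / (u - y) powr (\<alpha> + 1)) \<partial>lebesgue) \<partial>lebesgue)
          + ennreal \<alpha> * (\<integral>\<^sup>+ u\<in>{s<..<t}. (\<integral>\<^sup>+ y\<in>{s<..<u}.
              ennreal (vnorm d (\<lambda>i. f t u i - f t y i)
                       / (u - y) powr (\<alpha> + 1)) \<partial>lebesgue) \<partial>lebesgue))"
proof -
  have "(\<integral>\<^sup>+ u\<in>{0<..<s}. ennreal (vnorm d (\<lambda>i. f t u i - f s u i) / u powr \<alpha>) \<partial>lebesgue)
     \<le> (\<integral>\<^sup>+ u. ennreal (\<bar>t - s\<bar> powr \<mu>) * (ennreal (K u / u powr \<alpha>) * indicator {0<..<s} u) \<partial>lebesgue)"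
  proof (rule nn_integral_mono)
    fix u
    show "ennreal (vnorm d (\<lambda>i. f t u i - f s u i) / u powr \<alpha>) * indicator {0<..<s} u
      \<le> ennreal (\<bar>t - s\<bar> powr \<mu>) * (ennreal (K u / u powr \<alpha>) * indicator {0<..<s} u)"
    proof (cases "u \<in> {0<..<s}")
      case True
      have "vnorm d (\<lambda>i. f t u i - f s u i) / u powr \<alpha> \<le> K u * \<bar>t - s\<bar> powr \<mu> / u powr \<alpha>"
        using True st by (intro divide_right_mono hol[rule_format]) auto
      then have "ennreal (vnorm d (\<lambda>i. f t u i - f s u i) / u powr \<alpha>) \<le> ennreal (\<bar>t - s\<bar> powr \<mu> * (K u / u powr \<alpha>))"
        by (intro ennreal_leI) (simp add: mult.commute)
      also have "\<dots> = ennreal (\<bar>t - s\<bar> powr \<mu>) * ennreal (K u / u powr \<alpha>)"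
        by (rule ennreal_mult') simp
      finally show ?thesis using True by simp
    qed simp
  qed
  also have "\<dots> = ennreal (\<bar>t - s\<bar> powr \<mu>) * (\<integral>\<^sup>+ u\<in>{0<..<s}. ennreal (K u / u powr \<alpha>) \<partial>lebesgue)"
    using st by (intro nn_integral_cmult_any) auto
  finally show ?thesis
    by (intro order_trans[OF increment_bound_vector[OF T \<alpha> g f[rule_format] st]] mult_left_mono add_mono order_refl) auto
qed

text \<open>
  Only the values of \<open>f(t,.)\<close> and \<open>K\<close> on \<open>(0,t)\<close> enter, so both are cut off to obtain functions that are
  measurable on the whole line.
\<close>

lemma weighted_estimate:
  fixes T \<alpha> \<mu> t :: real and g K :: "real \<Rightarrow> real" and d :: nat and f :: "real \<Rightarrow> real \<Rightarrow> nat \<Rightarrow> real"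
  assumes T: "0 < T" and \<alpha>: "0 < \<alpha>" "\<alpha> < 1" and g: "g \<in> W_T_inf \<alpha> T"
    and f: "\<forall>t\<in>{0..T}. \<forall>i<d. (\<lambda>s. f t s i) \<in> W_0_one \<alpha> T"
    and hol: "\<forall>s\<in>{0..T}. \<forall>t1\<in>{0..T}. \<forall>t2\<in>{0..T}.
         vnorm d (\<lambda>i. f t1 s i - f t2 s i) \<le> K s * \<bar>t1 - t2\<bar> powr \<mu>"
    and \<mu>: "\<alpha> < \<mu>" and K: "K \<in> borel_measurable (lebesgue_on {0..T})" and t: "t \<in> {0..T}"
  shows "ennreal (vnorm d (G \<alpha> g f t))
         + (\<integral>\<^sup>+ s\<in>{0<..<t}. ennreal (vnorm d (\<lambda>i. G \<alpha> g f t i - G \<alpha> g f s i)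
                                   / (t - s) powr (\<alpha> + 1)) \<partial>lebesgue) \<le>
         Lambda \<alpha> T g *
         (ennreal (1 / (\<mu> - \<alpha>)) * (\<integral>\<^sup>+ u\<in>{0<..<t}.
              ennreal (K u / u powr \<alpha> * (t - u) powr (\<mu> - \<alpha>)) \<partial>lebesgue)
          + ennreal (1 + (1 / (1 - \<alpha>) + 1 / (2 * \<alpha>)) + T powr \<alpha>) * (\<integral>\<^sup>+ u\<in>{0<..<t}.
              ennreal ((t - u) powr (- 2 * \<alpha>) + u powr (- \<alpha>))
              * (ennreal (vnorm d (f t u))
                 + (\<integral>\<^sup>+ y\<in>{0<..<u}. ennreal (vnorm d (\<lambda>i. f t u i - f t y i)
                                           / (u - y) powr (\<alpha> + 1)) \<partial>lebesgue)) \<partial>lebesgue)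
          + ennreal \<alpha> * (\<integral>\<^sup>+ s\<in>{0<..<t}. (\<integral>\<^sup>+ u\<in>{0<..<s}. (\<integral>\<^sup>+ y\<in>{0<..<u}.
              ennreal (vnorm d (\<lambda>i. f t u i - f s u i - f t y i + f s y i)
                       / ((u - y) powr (\<alpha> + 1) * (t - s) powr (\<alpha> + 1)))
              \<partial>lebesgue) \<partial>lebesgue) \<partial>lebesgue))"
    (is "_ + ?Y0 \<le> _ * (_ * ?Y1 + _ * ?Y2 + _ * ?Y3)")
proof (cases "t = 0")
  case True
  then show ?thesis by (simp add: G_def stieltjes_def set_lebesgue_integral_def vnorm_def L2_set_def)
next
  case False
  then have t: "0 < t" "t \<le> T" using t by auto
  obtain L where L: "0 \<le> L" "Lambda \<alpha> T g = ennreal L"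
    using Lambda_finite[OF T \<alpha> g] by blast
  define F where "F i x = (if x \<in> {0..T} then f t x i else 0)" for i x
  have F: "F i x = f t x i" if "0 < x" "x < t" for i x using that t by (simp add: F_def)
  have Fm[measurable]: "F i \<in> borel_measurable lebesgue" if "i < d" for i
    using f[rule_format, of t i] borel_measurable_if[of "{0..T}" "\<lambda>x. f t x i"] that t by (simp add: W_0_one_def F_def[abs_def])
  define K' where "K' x = (if x \<in> {0..T} then K x else 0)" for x
  have [measurable]: "K' \<in> borel_measurable lebesgue"
    using K borel_measurable_if[of "{0..T}" K] by (simp add: K'_def[abs_def])
  define \<Phi> where "\<Phi> s = ennreal (vnorm d (\<lambda>i. G \<alpha> g f t i - G \<alpha> g f s i))" for s
  define k where "k u = ennreal (K' u / u powr \<alpha>)" for u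
  define a where "a u = ennreal (vnorm d (\<lambda>i. F i u))" for u
  define b where "b u y = ennreal (vnorm d (\<lambda>i. F i u - F i y) / (u - y) powr (\<alpha> + 1))" for u y
  define H where "H s = (\<integral>\<^sup>+ u\<in>{0<..<s}. (\<integral>\<^sup>+ y\<in>{0<..<u}.
      ennreal (vnorm d (\<lambda>i. f t u i - f s u i - f t y i + f s y i) / (u - y) powr (\<alpha> + 1)) \<partial>lebesgue) \<partial>lebesgue)" for s
  have km: "k \<in> borel_measurable lebesgue" unfolding k_def[abs_def] by measurable
  have am: "a \<in> borel_measurable lebesgue"
    unfolding a_def[abs_def] by (rule measurable_compose[OF measurable_vnorm[OF Fm] measurable_ennreal])
  have bm: "(\<lambda>p. b (fst p) (snd p)) \<in> borel_measurable LL"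
  proof -
    have 1: "(\<lambda>p. F i (fst p)) \<in> borel_measurable LL" "(\<lambda>p. F i (snd p)) \<in> borel_measurable LL" if "i < d" for i
      using measurable_compose[OF measurable_fst Fm[OF that]] measurable_compose[OF measurable_snd Fm[OF that]] by auto
    have 2: "(\<lambda>p. vnorm d (\<lambda>i. F i (fst p) - F i (snd p))) \<in> borel_measurable LL"
      by (intro measurable_vnorm borel_measurable_diff 1)
    have 3: "(\<lambda>p. (fst p - snd p) powr (\<alpha> + 1)) \<in> borel_measurable LL" by measurable
    show ?thesis unfolding b_def
      by (rule measurable_compose[OF borel_measurable_divide[OF 2 3] measurable_ennreal])
  qed
  have eb: "(\<integral>\<^sup>+ y\<in>{s<..<u}. ennreal (vnorm d (\<lambda>i. f t u i - f t y i) / (u - y) powr (\<alpha> + 1)) \<partial>lebesgue) = (\<integral>\<^sup>+ y\<in>{s<..<u}. b u y \<partial>lebesgue)"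
    if "0 \<le> s" "s < u" "u < t" for s u
    using that by (intro nn_integral_cong) (auto simp: b_def F indicator_def)
  have le: "\<Phi> s \<le> ennreal L *
    (ennreal ((t - s) powr \<mu>) * (\<integral>\<^sup>+u\<in>{0<..<s}. k u \<partial>lebesgue)
     + (\<integral>\<^sup>+u\<in>{s<..<t}. a u * ennreal (1 / (u - s) powr \<alpha>) \<partial>lebesgue)
     + ennreal \<alpha> * H s
     + ennreal \<alpha> * (\<integral>\<^sup>+u\<in>{s<..<t}. (\<integral>\<^sup>+y\<in>{s<..<u}. b u y \<partial>lebesgue) \<partial>lebesgue))" if s: "0 \<le> s" "s < t" for s
  proof -
    have 1: "(\<integral>\<^sup>+ u\<in>{0<..<s}. ennreal (K u / u powr \<alpha>) \<partial>lebesgue) = (\<integral>\<^sup>+u\<in>{0<..<s}. k u \<partial>lebesgue)"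
      using s t by (intro nn_integral_cong) (auto simp: k_def K'_def indicator_def)
    have 2: "(\<integral>\<^sup>+ u\<in>{s<..<t}. ennreal (vnorm d (f t u) / (u - s) powr \<alpha>) \<partial>lebesgue) = (\<integral>\<^sup>+u\<in>{s<..<t}. a u * ennreal (1 / (u - s) powr \<alpha>) \<partial>lebesgue)"
      using s by (intro nn_integral_cong) (auto simp: a_def F indicator_def ennreal_mult[symmetric])
    have 3: "(\<integral>\<^sup>+ u\<in>{s<..<t}. (\<integral>\<^sup>+ y\<in>{s<..<u}. ennreal (vnorm d (\<lambda>i. f t u i - f t y i) / (u - y) powr (\<alpha> + 1)) \<partial>lebesgue) \<partial>lebesgue)
       = (\<integral>\<^sup>+u\<in>{s<..<t}. (\<integral>\<^sup>+y\<in>{s<..<u}. b u y \<partial>lebesgue) \<partial>lebesgue)"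
    proof (rule nn_integral_cong)
      fix u
      show "(\<integral>\<^sup>+ y\<in>{s<..<u}. ennreal (vnorm d (\<lambda>i. f t u i - f t y i) / (u - y) powr (\<alpha> + 1)) \<partial>lebesgue) * indicator {s<..<t} u
        = (\<integral>\<^sup>+y\<in>{s<..<u}. b u y \<partial>lebesgue) * indicator {s<..<t} u"
      proof (cases "u \<in> {s<..<t}")
        case True
        then show ?thesis using eb[of s u] s by simp
      qed simp
    qed
    have 4: "\<bar>t - s\<bar> = t - s" using s by simp
    show ?thesis
      using increment_estimate[OF T \<alpha> g f hol s t(2)] unfolding \<Phi>_def H_def L(2) 1 2 3 4 .
  qed
  have H0: "H 0 = 0" by (simp add: H_def)
  note B = time_integrated_bound[OF \<alpha> \<mu> t L(1) km am bm le H0]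
  \<comment> \<open>the bound at time zero is the one at \<open>s = 0\<close>, since the integral over the empty interval vanishes\<close>
  have \<Phi>0: "\<Phi> 0 = ennreal (vnorm d (G \<alpha> g f t))"
    by (simp add: \<Phi>_def G_def stieltjes_def set_lebesgue_integral_def)
  have e1: "(\<integral>\<^sup>+s\<in>{0<..<t}. \<Phi> s * ennreal (1 / (t - s) powr (\<alpha> + 1)) \<partial>lebesgue)
    = (\<integral>\<^sup>+ s\<in>{0<..<t}. ennreal (vnorm d (\<lambda>i. G \<alpha> g f t i - G \<alpha> g f s i) / (t - s) powr (\<alpha> + 1)) \<partial>lebesgue)"
    by (intro nn_integral_cong) (simp add: \<Phi>_def ennreal_mult[symmetric])
  have e2: "(\<integral>\<^sup>+u\<in>{0<..<t}. k u * ennreal ((t - u) powr (\<mu> - \<alpha>)) \<partial>lebesgue)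
    = (\<integral>\<^sup>+ u\<in>{0<..<t}. ennreal (K u / u powr \<alpha> * (t - u) powr (\<mu> - \<alpha>)) \<partial>lebesgue)"
  proof (rule nn_integral_cong)
    fix u
    show "k u * ennreal ((t - u) powr (\<mu> - \<alpha>)) * indicator {0<..<t} u = ennreal (K u / u powr \<alpha> * (t - u) powr (\<mu> - \<alpha>)) * indicator {0<..<t} u"
    proof (cases "u \<in> {0<..<t}")
      case True
      then have "k u = ennreal (K u / u powr \<alpha>)" using t by (simp add: k_def K'_def)
      then show ?thesis by (simp only: ennreal_mult''[OF powr_ge_zero])
    qed simp
  qed
  have e3: "(\<integral>\<^sup>+u\<in>{0<..<t}. ennreal ((t - u) powr (- 2 * \<alpha>) + u powr -\<alpha>) * (a u + (\<integral>\<^sup>+y\<in>{0<..<u}. b u y \<partial>lebesgue)) \<partial>lebesgue)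
    = (\<integral>\<^sup>+ u\<in>{0<..<t}. ennreal ((t - u) powr (- 2 * \<alpha>) + u powr (- \<alpha>)) * (ennreal (vnorm d (f t u))
               + (\<integral>\<^sup>+ y\<in>{0<..<u}. ennreal (vnorm d (\<lambda>i. f t u i - f t y i) / (u - y) powr (\<alpha> + 1)) \<partial>lebesgue)) \<partial>lebesgue)"
  proof (rule nn_integral_cong)
    fix u
    show "ennreal ((t - u) powr (- 2 * \<alpha>) + u powr -\<alpha>) * (a u + (\<integral>\<^sup>+y\<in>{0<..<u}. b u y \<partial>lebesgue)) * indicator {0<..<t} u
      = ennreal ((t - u) powr (- 2 * \<alpha>) + u powr (- \<alpha>)) * (ennreal (vnorm d (f t u))
               + (\<integral>\<^sup>+ y\<in>{0<..<u}. ennreal (vnorm d (\<lambda>i. f t u i - f t y i) / (u - y) powr (\<alpha> + 1)) \<partial>lebesgue)) * indicator {0<..<t} u"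
    proof (cases "u \<in> {0<..<t}")
      case True
      then have "a u = ennreal (vnorm d (f t u))" by (simp add: a_def F)
      then show ?thesis using eb[of 0 u] True by simp
    qed simp
  qed
  have e4: "(\<integral>\<^sup>+s\<in>{0<..<t}. H s * ennreal (1 / (t - s) powr (\<alpha> + 1)) \<partial>lebesgue)
    = (\<integral>\<^sup>+ s\<in>{0<..<t}. (\<integral>\<^sup>+ u\<in>{0<..<s}. (\<integral>\<^sup>+ y\<in>{0<..<u}.
            ennreal (vnorm d (\<lambda>i. f t u i - f s u i - f t y i + f s y i)
                     / ((u - y) powr (\<alpha> + 1) * (t - s) powr (\<alpha> + 1)))
            \<partial>lebesgue) \<partial>lebesgue) \<partial>lebesgue)"
  proof (rule nn_integral_cong)
    fix s
    show "H s * ennreal (1 / (t - s) powr (\<alpha> + 1)) * indicator {0<..<t} s = (\<integral>\<^sup>+ u\<in>{0<..<s}. (\<integral>\<^sup>+ y\<in>{0<..<u}.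
            ennreal (vnorm d (\<lambda>i. f t u i - f s u i - f t y i + f s y i)
                     / ((u - y) powr (\<alpha> + 1) * (t - s) powr (\<alpha> + 1)))
            \<partial>lebesgue) \<partial>lebesgue) * indicator {0<..<t} s"
    proof (cases "s \<in> {0<..<t}")
      case True
      define c where "c = 1 / (t - s) powr (\<alpha> + 1)"
      have c: "0 < c" using True by (simp add: c_def)
      have "H s * ennreal c = (\<integral>\<^sup>+ u. ennreal c * ((\<integral>\<^sup>+ y\<in>{0<..<u}.
         ennreal (vnorm d (\<lambda>i. f t u i - f s u i - f t y i + f s y i) / (u - y) powr (\<alpha> + 1)) \<partial>lebesgue) * indicator {0<..<s} u) \<partial>lebesgue)"
        unfolding H_def by (subst mult.commute) (rule nn_integral_cmult_any[OF c, symmetric])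
      also have "\<dots> = (\<integral>\<^sup>+ u\<in>{0<..<s}. (\<integral>\<^sup>+ y. ennreal c * (
         ennreal (vnorm d (\<lambda>i. f t u i - f s u i - f t y i + f s y i) / (u - y) powr (\<alpha> + 1)) * indicator {0<..<u} y) \<partial>lebesgue) \<partial>lebesgue)"
        by (rule nn_integral_cong) (simp only: nn_integral_cmult_any[OF c] mult.assoc)
      also have "\<dots> = (\<integral>\<^sup>+ u\<in>{0<..<s}. (\<integral>\<^sup>+ y\<in>{0<..<u}.
            ennreal (vnorm d (\<lambda>i. f t u i - f s u i - f t y i + f s y i)
                     / ((u - y) powr (\<alpha> + 1) * (t - s) powr (\<alpha> + 1)))
            \<partial>lebesgue) \<partial>lebesgue)"
      proof (rule nn_integral_cong, rule arg_cong2[where f = "(*)", OF _ refl], rule nn_integral_cong)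
        fix u y
        have "c * (v / p) = v / (p * (t - s) powr (\<alpha> + 1))" for v p :: real by (simp add: c_def)
        moreover have "ennreal c * ennreal x = ennreal (c * x)" for x
          using c by (simp add: ennreal_mult')
        ultimately show "ennreal c * (ennreal (vnorm d (\<lambda>i. f t u i - f s u i - f t y i + f s y i) / (u - y) powr (\<alpha> + 1)) * indicator {0<..<u} y)
          = ennreal (vnorm d (\<lambda>i. f t u i - f s u i - f t y i + f s y i) / ((u - y) powr (\<alpha> + 1) * (t - s) powr (\<alpha> + 1))) * indicator {0<..<u} y"
          by (simp only: mult.assoc[symmetric])
      qed
      finally show ?thesis using True unfolding c_def by simp
    qed simp
  qed
  show ?thesis
    using B unfolding \<Phi>0 e1 e2 e3 e4 L(2) .
qed

theorem proposition3p1: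
  "\<exists>(C3 :: real \<Rightarrow> real \<Rightarrow> real) (C4 :: real \<Rightarrow> real \<Rightarrow> real).
    \<forall>(T :: real) (\<alpha> :: real) (\<mu> :: real) (g :: real \<Rightarrow> real) (d :: nat)
      (f :: real \<Rightarrow> real \<Rightarrow> nat \<Rightarrow> real) (K :: real \<Rightarrow> real).
      0 < T \<and> 0 < \<alpha> \<and> \<alpha> < 1/2 \<and> \<alpha> < \<mu> \<and> g \<in> W_T_inf \<alpha> T \<and>
      (\<forall>t\<in>{0..T}. \<forall>i<d. (\<lambda>s. f t s i) \<in> W_0_one \<alpha> T) \<and>
      K \<in> borel_measurable (lebesgue_on {0..T}) \<and> (\<forall>s\<in>{0..T}. 0 \<le> K s) \<and>
      (\<forall>s\<in>{0..T}. \<forall>t1\<in>{0..T}. \<forall>t2\<in>{0..T}.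
         vnorm d (\<lambda>i. f t1 s i - f t2 s i) \<le> K s * \<bar>t1 - t2\<bar> powr \<mu>)
      \<longrightarrow>
      (\<forall>s t. 0 \<le> s \<and> s < t \<and> t \<le> T \<longrightarrow>
         ennreal (vnorm d (\<lambda>i. G \<alpha> g f t i - G \<alpha> g f s i)) \<le>
         Lambda \<alpha> T g *
         (ennreal (\<bar>t - s\<bar> powr \<mu>) * (\<integral>\<^sup>+ u\<in>{0<..<s}. ennreal (K u / u powr \<alpha>) \<partial>lebesgue)
          + (\<integral>\<^sup>+ u\<in>{s<..<t}. ennreal (vnorm d (f t u) / (u - s) powr \<alpha>) \<partial>lebesgue)
          + ennreal \<alpha> * (\<integral>\<^sup>+ u\<in>{0<..<s}. (\<integral>\<^sup>+ y\<in>{0<..<u}.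
              ennreal (vnorm d (\<lambda>i. f t u i - f s u i - f t y i + f s y i)
                       / (u - y) powr (\<alpha> + 1)) \<partial>lebesgue) \<partial>lebesgue)
          + ennreal \<alpha> * (\<integral>\<^sup>+ u\<in>{s<..<t}. (\<integral>\<^sup>+ y\<in>{s<..<u}.
              ennreal (vnorm d (\<lambda>i. f t u i - f t y i)
                       / (u - y) powr (\<alpha> + 1)) \<partial>lebesgue) \<partial>lebesgue)))
      \<and>
      (\<forall>t\<in>{0..T}.
         ennreal (vnorm d (G \<alpha> g f t))
         + (\<integral>\<^sup>+ s\<in>{0<..<t}. ennreal (vnorm d (\<lambda>i. G \<alpha> g f t i - G \<alpha> g f s i)
                                   / (t - s) powr (\<alpha> + 1)) \<partial>lebesgue) \<le>
         Lambda \<alpha> T g *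
         (ennreal (C3 \<alpha> \<mu>) * (\<integral>\<^sup>+ u\<in>{0<..<t}.
              ennreal (K u / u powr \<alpha> * (t - u) powr (\<mu> - \<alpha>)) \<partial>lebesgue)
          + ennreal (C4 \<alpha> T) * (\<integral>\<^sup>+ u\<in>{0<..<t}.
              ennreal ((t - u) powr (- 2 * \<alpha>) + u powr (- \<alpha>))
              * (ennreal (vnorm d (f t u))
                 + (\<integral>\<^sup>+ y\<in>{0<..<u}. ennreal (vnorm d (\<lambda>i. f t u i - f t y i)
                                           / (u - y) powr (\<alpha> + 1)) \<partial>lebesgue)) \<partial>lebesgue)
          + ennreal \<alpha> * (\<integral>\<^sup>+ s\<in>{0<..<t}. (\<integral>\<^sup>+ u\<in>{0<..<s}. (\<integral>\<^sup>+ y\<in>{0<..<u}.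
              ennreal (vnorm d (\<lambda>i. f t u i - f s u i - f t y i + f s y i)
                       / ((u - y) powr (\<alpha> + 1) * (t - s) powr (\<alpha> + 1)))
              \<partial>lebesgue) \<partial>lebesgue) \<partial>lebesgue)))"
proof (rule exI[of _ "\<lambda>\<alpha> \<mu>. 1 / (\<mu> - \<alpha>)"], rule exI[of _ "\<lambda>\<alpha> T. 1 + (1 / (1 - \<alpha>) + 1 / (2 * \<alpha>)) + T powr \<alpha>"],
    intro allI impI conjI ballI; elim conjE)
qed (rule increment_estimate weighted_estimate; (assumption | simp))+

end
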